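(* Let $X$ be an infinite-dimensional complex Banach space and $T\in L(X)$. The following are equivalent: (i) $\sigma_{gKR}(T)=\emptyset$; (ii) $\sigma_{gDR}(T)=\emptyset$; (iii) $T$ is polynomially Riesz; (iv) $\sigma_{\mathcal B}(T)$ is a finite set; (v) $\theta(T)$ is a finite set, where $\theta$ is one of $\sigma_{eK}$, $\sigma_{\Phi_+}$, $\sigma_{\Phi_-}$, $\sigma_{\Phi}$, $\sigma_{\mathcal W_+}$, $\sigma_{\mathcal W_-}$, $\sigma_{\mathcal W}$, $\sigma_{\mathcal B_+}$, $\sigma_{\mathcal B_-}$.
   Context: $S$ is Kato if $R(S)$ is closed and $N(S)\subset R(S^n)$ for all $n$; $S$ is Riesz if $S-\lambda$ is Fredholm for all $\lambda\ne0$. $\sigma_{gKR}(T)$ is the set of $\lambda$ for which there are no closed $(T-\lambda)$-invariant $M,N$ with $X=M\oplus N$, $(T-\lambda)_M$ Kato and $(T-\lambda)_N$ Riesz. $\sigma_{gDR}(T)$ is the set of $\lambda$ such that $T-\lambda$ is not generalized Drazin-Riesz invertible, where $A$ is generalized Drazin-Riesz invertible if there is $S\in L(X)$ with $AS=SA$, $SAS=S$ and $ASA-A$ Riesz. $T$ is polynomially Riesz if $p(T)$ is Riesz for some nonzero complex polynomial $p$. $S$ is essentially Kato if there are closed $S$-invariant $M,N$ with $X=M\oplus N$, $N$ finite-dimensional, $S_M$ Kato and $S_N$ nilpotent; $\sigma_{eK}(T)$ is the set of $\lambda$ with $T-\lambda$ not essentially Kato. $\Phi_+$: finite-dimensional kernel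 and closed range; $\Phi_-$: finite-codimensional range; $\Phi=\Phi_+\cap\Phi_-$; $\mathcal W_+$, $\mathcal W_-$, $\mathcal W$: those in $\Phi_+$, $\Phi_-$, $\Phi$ with index $\le0$, $\ge0$, $=0$; $\mathcal B_+$: $\Phi_+$ with finite ascent; $\mathcal B_-$: $\Phi_-$ with finite descent; $\mathcal B$: Fredholm with finite ascent and descent; $\sigma_{\mathbf R}(T)=\{\lambda:T-\lambda\notin\mathbf R\}$. *)

theory Defs
  imports "HOL-Analysis.Analysis" "HOL-Computational_Algebra.Polynomial"
begin

class complex_banach = banach +
  fixes scaleC :: "complex \<Rightarrow> 'a \<Rightarrow> 'a"
  assumes scaleC_of_real: "scaleC (complex_of_real r) x = scaleR r x"
    and scaleC_add_right: "scaleC a (x + y) = scaleC a x + scaleC a y"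
    and scaleC_add_left: "scaleC (a + b) x = scaleC a x + scaleC b x"
    and scaleC_scaleC: "scaleC a (scaleC b x) = scaleC (a * b) x"
    and scaleC_one: "scaleC 1 x = x"
    and norm_scaleC: "norm (scaleC a x) = cmod a * norm x"

definition bounded_op :: "('a::complex_banach \<Rightarrow> 'a) \<Rightarrow> bool" where
  "bounded_op T \<longleftrightarrow> (\<forall>x y. T (x + y) = T x + T y) \<and> (\<forall>c x. T (scaleC c x) = scaleC c (T x))
     \<and> (\<exists>K. \<forall>x. norm (T x) \<le> K * norm x)"

definition csubspace :: "'a::complex_banach set \<Rightarrow> bool" where
  "csubspace M \<longleftrightarrow> 0 \<in> M \<and> (\<forall>x\<in>M. \<forall>y\<in>M. x + y \<in> M) \<and> (\<forall>c. \<forall>x\<in>M. scaleC c x \<in> M)"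

definition cspan :: "'a::complex_banach set \<Rightarrow> 'a set" where
  "cspan B = {x. \<exists>F c. finite F \<and> F \<subseteq> B \<and> x = (\<Sum>b\<in>F. scaleC (c b) b)}"

definition cfin_dim :: "'a::complex_banach set \<Rightarrow> bool" where
  "cfin_dim K \<longleftrightarrow> (\<exists>B. finite B \<and> B \<subseteq> K \<and> K \<subseteq> cspan B)"

definition cdim :: "'a::complex_banach set \<Rightarrow> nat" where
  "cdim K = (LEAST n. \<exists>B. finite B \<and> card B = n \<and> B \<subseteq> K \<and> K \<subseteq> cspan B)"

definition fin_codim :: "'a::complex_banach set \<Rightarrow> 'a set \<Rightarrow> bool" where
  "fin_codim N R \<longleftrightarrow> (\<exists>B. finite B \<and> B \<subseteq> N \<and> N \<subseteq> {r + f |r f. r \<in> R \<and> f \<in> cspan B})"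

definition ccodim :: "'a::complex_banach set \<Rightarrow> 'a set \<Rightarrow> nat" where
  "ccodim N R = (LEAST n. \<exists>B. finite B \<and> card B = n \<and> B \<subseteq> N
                      \<and> N \<subseteq> {r + f |r f. r \<in> R \<and> f \<in> cspan B})"

definition direct_sum :: "'a::complex_banach set \<Rightarrow> 'a set \<Rightarrow> bool" where
  "direct_sum M N \<longleftrightarrow> M \<inter> N = {0} \<and> (\<forall>x. \<exists>m\<in>M. \<exists>n\<in>N. x = m + n)"

definition invariant :: "('a \<Rightarrow> 'a) \<Rightarrow> 'a set \<Rightarrow> bool" where
  "invariant S M \<longleftrightarrow> S ` M \<subseteq> M"

definition ker_on :: "'a::complex_banach set \<Rightarrow> ('a \<Rightarrow> 'a) \<Rightarrow> 'a set" where
  "ker_on M S = {x \<in> M. S x = 0}"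

definition shift :: "('a::complex_banach \<Rightarrow> 'a) \<Rightarrow> complex \<Rightarrow> 'a \<Rightarrow> 'a" where
  "shift S mu = (\<lambda>x. S x - scaleC mu x)"

definition upper_fredholm_on :: "'a::complex_banach set \<Rightarrow> ('a \<Rightarrow> 'a) \<Rightarrow> bool" where
  "upper_fredholm_on M S \<longleftrightarrow> cfin_dim (ker_on M S) \<and> closed (S ` M)"

definition lower_fredholm_on :: "'a::complex_banach set \<Rightarrow> ('a \<Rightarrow> 'a) \<Rightarrow> bool" where
  "lower_fredholm_on M S \<longleftrightarrow> fin_codim M (S ` M)"

definition fredholm_on :: "'a::complex_banach set \<Rightarrow> ('a \<Rightarrow> 'a) \<Rightarrow> bool" where
  "fredholm_on M S \<longleftrightarrow> upper_fredholm_on M S \<and> lower_fredholm_on M S"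

definition op_index :: "'a::complex_banach set \<Rightarrow> ('a \<Rightarrow> 'a) \<Rightarrow> ereal" where
  "op_index M S =
     (if cfin_dim (ker_on M S) then ereal (real (cdim (ker_on M S))) else \<infinity>)
   - (if fin_codim M (S ` M) then ereal (real (ccodim M (S ` M))) else \<infinity>)"

definition kato_on :: "'a::complex_banach set \<Rightarrow> ('a \<Rightarrow> 'a) \<Rightarrow> bool" where
  "kato_on M S \<longleftrightarrow> closed (S ` M) \<and> (\<forall>n. ker_on M S \<subseteq> (S ^^ n) ` M)"

definition riesz_on :: "'a::complex_banach set \<Rightarrow> ('a \<Rightarrow> 'a) \<Rightarrow> bool" where
  "riesz_on M S \<longleftrightarrow> (\<forall>mu. mu \<noteq> 0 \<longrightarrow> fredholm_on M (shift S mu))"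

definition nilpotent_on :: "'a::complex_banach set \<Rightarrow> ('a \<Rightarrow> 'a) \<Rightarrow> bool" where
  "nilpotent_on M S \<longleftrightarrow> (\<exists>n. \<forall>x\<in>M. (S ^^ n) x = 0)"

definition is_kato :: "('a::complex_banach \<Rightarrow> 'a) \<Rightarrow> bool" where
  "is_kato S \<longleftrightarrow> kato_on UNIV S"

definition is_riesz :: "('a::complex_banach \<Rightarrow> 'a) \<Rightarrow> bool" where
  "is_riesz S \<longleftrightarrow> riesz_on UNIV S"

definition finite_ascent :: "('a::complex_banach \<Rightarrow> 'a) \<Rightarrow> bool" where
  "finite_ascent S \<longleftrightarrow> (\<exists>n. ker_on UNIV (S ^^ n) = ker_on UNIV (S ^^ Suc n))"

definition finite_descent :: "('a::complex_banach \<Rightarrow> 'a) \<Rightarrow> bool" where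
  "finite_descent S \<longleftrightarrow> (\<exists>n. range (S ^^ n) = range (S ^^ Suc n))"

definition Phi_plus :: "('a::complex_banach \<Rightarrow> 'a) \<Rightarrow> bool" where
  "Phi_plus S \<longleftrightarrow> upper_fredholm_on UNIV S"

definition Phi_minus :: "('a::complex_banach \<Rightarrow> 'a) \<Rightarrow> bool" where
  "Phi_minus S \<longleftrightarrow> lower_fredholm_on UNIV S"

definition Phi :: "('a::complex_banach \<Rightarrow> 'a) \<Rightarrow> bool" where
  "Phi S \<longleftrightarrow> Phi_plus S \<and> Phi_minus S"

definition W_plus :: "('a::complex_banach \<Rightarrow> 'a) \<Rightarrow> bool" where
  "W_plus S \<longleftrightarrow> Phi_plus S \<and> op_index UNIV S \<le> 0"

definition W_minus :: "('a::complex_banach \<Rightarrow> 'a) \<Rightarrow> bool" where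
  "W_minus S \<longleftrightarrow> Phi_minus S \<and> op_index UNIV S \<ge> 0"

definition Weyl :: "('a::complex_banach \<Rightarrow> 'a) \<Rightarrow> bool" where
  "Weyl S \<longleftrightarrow> Phi S \<and> op_index UNIV S = 0"

definition B_plus :: "('a::complex_banach \<Rightarrow> 'a) \<Rightarrow> bool" where
  "B_plus S \<longleftrightarrow> Phi_plus S \<and> finite_ascent S"

definition B_minus :: "('a::complex_banach \<Rightarrow> 'a) \<Rightarrow> bool" where
  "B_minus S \<longleftrightarrow> Phi_minus S \<and> finite_descent S"

definition Browder :: "('a::complex_banach \<Rightarrow> 'a) \<Rightarrow> bool" where
  "Browder S \<longleftrightarrow> Phi S \<and> finite_ascent S \<and> finite_descent S"

definition essentially_kato :: "('a::complex_banach \<Rightarrow> 'a) \<Rightarrow> bool" where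
  "essentially_kato S \<longleftrightarrow> (\<exists>M N. csubspace M \<and> csubspace N \<and> closed M \<and> closed N
      \<and> invariant S M \<and> invariant S N \<and> direct_sum M N \<and> cfin_dim N
      \<and> kato_on M S \<and> nilpotent_on N S)"

definition gDR_invertible :: "('a::complex_banach \<Rightarrow> 'a) \<Rightarrow> bool" where
  "gDR_invertible A \<longleftrightarrow> (\<exists>S. bounded_op S \<and> A \<circ> S = S \<circ> A \<and> S \<circ> A \<circ> S = S
      \<and> is_riesz (\<lambda>x. A (S (A x)) - A x))"

definition gKR_decomposable :: "('a::complex_banach \<Rightarrow> 'a) \<Rightarrow> bool" where
  "gKR_decomposable S \<longleftrightarrow> (\<exists>M N. csubspace M \<and> csubspace N \<and> closed M \<and> closed N
      \<and> invariant S M \<and> invariant S N \<and> direct_sum M N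
      \<and> kato_on M S \<and> riesz_on N S)"

definition spec :: "(('a::complex_banach \<Rightarrow> 'a) \<Rightarrow> bool) \<Rightarrow> ('a \<Rightarrow> 'a) \<Rightarrow> complex set" where
  "spec P T = {mu. \<not> P (shift T mu)}"

definition sigma_gKR :: "('a::complex_banach \<Rightarrow> 'a) \<Rightarrow> complex set" where
  "sigma_gKR T = spec gKR_decomposable T"

definition sigma_gDR :: "('a::complex_banach \<Rightarrow> 'a) \<Rightarrow> complex set" where
  "sigma_gDR T = spec gDR_invertible T"

definition sigma_eK :: "('a::complex_banach \<Rightarrow> 'a) \<Rightarrow> complex set" where
  "sigma_eK T = spec essentially_kato T"

definition op_poly :: "complex poly \<Rightarrow> ('a::complex_banach \<Rightarrow> 'a) \<Rightarrow> 'a \<Rightarrow> 'a" where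
  "op_poly p T = (\<lambda>x. \<Sum>i\<le>degree p. scaleC (coeff p i) ((T ^^ i) x))"

definition polynomially_riesz :: "('a::complex_banach \<Rightarrow> 'a) \<Rightarrow> bool" where
  "polynomially_riesz T \<longleftrightarrow> (\<exists>p. p \<noteq> 0 \<and> is_riesz (op_poly p T))"

end

theory Submission
  imports Defs "HOL-Computational_Algebra.Fundamental_Theorem_Algebra"
begin

text \<open>
  Each of the conditions amounts to finiteness of the Browder spectrum.
  The central observation is local: if S is Kato on a closed invariant subspace M and S - mu is
  bijective on M for arbitrarily small mu, then S itself is bijective on M. A semi-Fredholm operator
  is Kato on the range of one of its powers, so a semi-Fredholm or essentially Kato T - lambda with
  lambda in the closure of the resolvent set is Browder, and then a punctured neighbourhood of
  lambda lies in the resolvent set. Hence on a connected open set of such lambda that meets the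
  resolvent set, T - lambda is Browder throughout; the complement of a finite set is connected,
  which settles (v). For (i), the same argument on punctured discs shows that the closure of the
  resolvent set is clopen and that the Browder spectrum has no limit point.

  Polynomially Riesz operators are treated by factoring p(T) - p(lambda) = (T - lambda) q(T) in one
  direction and p(T) - mu into linear factors in the other. For (ii), a circle of radius r around
  lambda inside the resolvent set separates the spectrum, and with A = T - lambda the Riesz
  projection is the limit of the operators (1 - (A/r)^n)^(-1): these are Riemann sums of the
  resolvent over the n-th roots of unity, so no contour integration is needed.
\<close>

section \<open>Open mappings and bounded operators\<close>

text \<open>No stability theory of semi-Fredholm operators or of their index is invoked. Being a
  limit of resolvent points replaces it: that forces the Kato part of the operator to be bijective
  and turns each one-sided condition into the two-sided splitting \<open>core_nilpotent\<close>. The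
  summands M and N occur as sets and not as spaces of their own, so open mappings, closed ranges and
  small perturbations are treated relative to closed subspaces. In (1 - (A/r)^n)^(-1) the scalar
  function 1/(1 - (w/r)^n) tends to 1 for |w| < r and to 0 for |w| > r. Idempotence of the limit
  comes from 1/(1-u) * 1/(1-u/2) = 2/(1-u) - 1/(1-u/2), that is, from two radii whose n-th powers
  differ by the factor 2; hence the construction runs in an annulus and not on one circle. The Riesz
  property is checked separately on the two sides of the radius: below it shifts of A are Browder,
  above it a norm bound for a power of A P makes the shift bijective.\<close>

lemma open_mapping_on_closed_subspace:
  fixes T :: "'a::banach \<Rightarrow> 'b::banach"
  assumes T: "bounded_linear T" and A: "subspace A" "closed A" and clT: "closed (T ` A)"
  obtains C where "C > 0" "\<And>y. y \<in> T ` A \<Longrightarrow> \<exists>x\<in>A. T x = y \<and> norm x \<le> C * norm y"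
proof -
  interpret T: bounded_linear T by fact
  define Y where "Y = T ` A"
  have subY: "subspace Y"
    unfolding Y_def using A(1) T.linear_axioms by (rule linear_subspace_image[rotated])
  define D where "D = (\<lambda>n::nat. closure (T ` (A \<inter> cball 0 (real n))))"
  have DY: "D n \<subseteq> Y" for n
    unfolding D_def Y_def by (rule closure_minimal) (use clT in auto)
  have un: "\<Union>(range D) = Y"
  proof
    show "\<Union>(range D) \<subseteq> Y" using DY by auto
    show "Y \<subseteq> \<Union>(range D)"
    proof
      fix y assume "y \<in> Y"
      then obtain x where x: "x \<in> A" "y = T x" by (auto simp: Y_def)
      obtain n where "norm x \<le> real n" using real_arch_simple by blast
      then have "y \<in> T ` (A \<inter> cball 0 (real n))" using x by auto
      then show "y \<in> \<Union>(range D)" unfolding D_def using closure_subset by fastforce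
    qed
  qed
  \<comment> \<open>Baire's theorem applies in \<open>Y\<close> itself, which is completely
    metrizable because the image is closed.\<close>
  have "\<exists>n. (top_of_set Y) interior_of (D n) \<noteq> {}"
  proof (rule ccontr)
    assume "\<not> ?thesis"
    then have e: "(top_of_set Y) interior_of (D n) = {}" for n by auto
    have "(top_of_set Y) interior_of (\<Union>(range D)) = {}"
    proof (rule Baire_category_alt)
      show "completely_metrizable_space (top_of_set Y) \<or>
        locally_compact_space (top_of_set Y) \<and> regular_space (top_of_set Y)"
        using clT unfolding Y_def
        by (metis closed_closedin completely_metrizable_space_closedin completely_metrizable_space_euclidean)
      show "closedin (top_of_set Y) S \<and> (top_of_set Y) interior_of S = {}" if "S \<in> range D" for S
        using that e DY by (auto simp: D_def intro!: closed_subset)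
    qed auto
    then have "Y = {}" using un interior_of_topspace[of "top_of_set Y"] by simp
    then show False using subspace_0[OF subY] by auto
  qed
  then obtain n y0 where "y0 \<in> (top_of_set Y) interior_of (D n)" by blast
  then obtain U where U: "openin (top_of_set Y) U" "y0 \<in> U" "U \<subseteq> D n"
    by (auto simp: interior_of_def)
  then obtain e where e: "e > 0" "ball y0 e \<inter> Y \<subseteq> U"
    by (meson openin_contains_ball)
  have y0: "y0 \<in> Y" using U DY by auto
  \<comment> \<open>A difference of two points of the ball of radius n, scaled by 1/c = 2 norm y /
    e, has norm at most (4 n / e) norm y; the extra 1 keeps \<open>K\<close> positive for n =
    0.\<close>
  define K where "K = (4 * real n + 1) / e"
  have K: "K > 0" using e by (simp add: K_def)
  \<comment> \<open>Both y0 and y0 + c y lie in the closure \<open>D n\<close>, so subtracting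
    approximate preimages of the two gives one of c y, with error at most 2 d = c norm y /
    2.\<close>
  have approx: "\<exists>x\<in>A. norm x \<le> K * norm y \<and> norm (y - T x) \<le> norm y / 2" if y: "y \<in> Y" for y
  proof (cases "y = 0")
    case True then show ?thesis using subspace_0[OF A(1)] by (intro bexI[of _ 0]) auto
  next
    case False
    define c where "c = e / (2 * norm y)"
    have c: "c > 0" using False e by (simp add: c_def)
    define d where "d = c * norm y / 4"
    have d: "d > 0" using c False by (simp add: d_def)
    have nc: "norm (c *\<^sub>R y) = e/2" using False e by (simp add: c_def)
    have "y0 + c *\<^sub>R y \<in> Y" using y y0 subY by (auto intro: subspace_add subspace_scale)
    moreover have "y0 + c *\<^sub>R y \<in> ball y0 e" using nc e
      by (simp add: dist_norm) 
    ultimately have "y0 + c *\<^sub>R y \<in> D n" using e U by auto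
    then obtain a where a: "a \<in> A" "norm a \<le> real n" "dist (T a) (y0 + c *\<^sub>R y) < d"
      unfolding D_def closure_approachable using d by (auto simp: dist_norm)
    have "y0 \<in> D n" using U by auto
    then obtain b where b: "b \<in> A" "norm b \<le> real n" "dist (T b) y0 < d"
      unfolding D_def closure_approachable using d by (auto simp: dist_norm)
    define x where "x = (1/c) *\<^sub>R (a - b)"
    have xA: "x \<in> A" unfolding x_def using a b A by (auto intro: subspace_scale subspace_diff)
    have "norm (a - b) \<le> 2 * real n" using norm_triangle_ineq4[of a b] a b by linarith
    then have "norm x \<le> (1/c) * (2 * real n)"
      unfolding x_def using c by (simp add: divide_right_mono)
    also have "\<dots> \<le> K * norm y" unfolding K_def c_def using e False by (simp add: field_simps)
    finally have nx: "norm x \<le> K * norm y" .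
    have "c *\<^sub>R y - T (a - b) = (y0 + c *\<^sub>R y - T a) - (y0 - T b)"
      by (simp add: T.diff)
    then have "norm (c *\<^sub>R y - T (a-b)) \<le> norm (y0 + c *\<^sub>R y - T a) + norm (y0 - T b)"
      by (metis norm_triangle_ineq4)
    also have "\<dots> \<le> 2 * d" using a b by (simp add: dist_norm norm_minus_commute)
    finally have *: "norm (c *\<^sub>R y - T (a-b)) \<le> c * (norm y / 2)" by (simp add: d_def)
    have "y - T x = (1/c) *\<^sub>R (c *\<^sub>R y - T (a-b))"
      using c unfolding x_def T.scaleR by (simp add: scaleR_diff_right)
    then have "norm (y - T x) = (1/c) * norm (c *\<^sub>R y - T (a-b))" using c by simp
    also have "\<dots> \<le> (1/c) * (c * (norm y / 2))" using * c by (intro mult_left_mono) auto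
    finally have "norm (y - T x) \<le> norm y / 2" using c by simp
    then show ?thesis using nx xA by blast
  qed
  then obtain f where f: "\<And>y. y \<in> Y \<Longrightarrow> f y \<in> A" "\<And>y. y \<in> Y \<Longrightarrow> norm (f y) \<le> K * norm y"
     "\<And>y. y \<in> Y \<Longrightarrow> norm (y - T (f y)) \<le> norm y / 2" by metis
  have "\<exists>x\<in>A. T x = y \<and> norm x \<le> 2 * K * norm y" if y: "y \<in> Y" for y
  proof -
    \<comment> \<open>The residuals left by successive approximate preimages. They halve at each
      step, so the corrections sum to an exact preimage of norm at most K (1 + 1/2 + ...) norm
      y.\<close>
    define r where "r = rec_nat y (\<lambda>_ z. z - T (f z))"
    have r0: "r 0 = y" and rS: "\<And>k. r (Suc k) = r k - T (f (r k))" by (simp_all add: r_def)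
    have rY: "r k \<in> Y" for k
      by (induction k) (use y subY f in \<open>auto simp: r0 rS Y_def intro!: subspace_diff\<close>)
    have rn: "norm (r k) \<le> (1/2)^k * norm y" for k
    proof (induction k)
      case (Suc k)
      have "norm (r (Suc k)) \<le> norm (r k) / 2" using f(3)[OF rY] rS by simp
      then show ?case using Suc by simp
    qed (simp add: r0)
    have fn: "norm (f (r k)) \<le> K * norm y * (1/2)^k" for k
    proof -
      have "norm (f (r k)) \<le> K * norm (r k)" by (rule f(2)[OF rY])
      also have "\<dots> \<le> K * ((1/2)^k * norm y)" using rn K by (intro mult_left_mono) auto
      finally show ?thesis by (simp only: mult_ac)
    qed
    have s1: "summable (\<lambda>k. K * norm y * (1/2::real)^k)"
      by (intro summable_mult summable_geometric) auto
    have sn: "summable (\<lambda>k. norm (f (r k)))"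
      by (rule summable_comparison_test'[OF s1, of 0]) (use fn in auto)
    have s: "summable (\<lambda>k. f (r k))" using sn by (rule summable_norm_cancel)
    define x where "x = (\<Sum>k. f (r k))"
    have "norm x \<le> (\<Sum>k. norm (f (r k)))" unfolding x_def by (rule summable_norm[OF sn])
    also have "\<dots> \<le> (\<Sum>k. K * norm y * (1/2)^k)" by (rule suminf_le[OF fn sn s1])
    also have "\<dots> = 2 * K * norm y"
      using suminf_mult[OF summable_geometric[of "1/2::real"], of "K * norm y"] suminf_geometric[of "1/2::real"]
      by simp
    finally have nx: "norm x \<le> 2 * K * norm y" .
    have lim: "(\<lambda>n. \<Sum>k<n. f (r k)) \<longlonglongrightarrow> x"
      using s unfolding x_def by (rule summable_LIMSEQ)
    have xA: "x \<in> A"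
    proof (rule closed_sequentially[OF A(2) _ lim])
      show "(\<Sum>k<n. f (r k)) \<in> A" for n using f(1)[OF rY] by (intro subspace_sum[OF A(1)]) 
    qed
    have "T (\<Sum>k<n. f (r k)) = y - r n" for n
    proof (induction n)
      case (Suc n)
      then show ?case unfolding sum.lessThan_Suc T.add rS by simp
    qed (simp add: r0 T.zero)
    then have l1: "(\<lambda>n. y - r n) \<longlonglongrightarrow> T x" using T.tendsto[OF lim] by simp
    have "(\<lambda>n. (1/2)^n * norm y) \<longlonglongrightarrow> 0 * norm y"
      by (intro tendsto_intros) auto
    then have "(\<lambda>n. (1/2)^n * norm y) \<longlonglongrightarrow> 0" by simp
    then have "r \<longlonglongrightarrow> 0" 
      using Lim_null_comparison[of r "\<lambda>n. (1/2)^n * norm y" sequentially] rn by simp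
    then have "(\<lambda>n. y - r n) \<longlonglongrightarrow> y - 0" by (intro tendsto_intros)
    then have "T x = y" using LIMSEQ_unique[OF l1] by simp
    then show ?thesis using xA nx by blast
  qed
  then show ?thesis using that[of "2 * K"] K by (auto simp: Y_def)
qed

section \<open>Complex-linear structure and bounded operators\<close>

interpretation cvs: vector_space "scaleC :: complex \<Rightarrow> 'a::complex_banach \<Rightarrow> 'a"
  by unfold_locales (simp_all add: scaleC_add_right scaleC_add_left scaleC_scaleC scaleC_one)

interpretation scaleC: bounded_bilinear "scaleC :: complex \<Rightarrow> 'a::complex_banach \<Rightarrow> 'a"
proof
  fix a a' :: complex and b b' :: 'a and r :: real
  show "scaleC (r *\<^sub>R a) b = r *\<^sub>R scaleC a b"
    by (metis scaleC_of_real scaleC_scaleC scaleR_conv_of_real)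
  show "scaleC a (r *\<^sub>R b) = r *\<^sub>R scaleC a b"
    by (metis scaleC_of_real scaleC_scaleC mult.commute)
  show "\<exists>K. \<forall>a (b::'a). norm (scaleC a b) \<le> norm a * norm b * K"
    by (rule exI[of _ 1]) (simp add: norm_scaleC)
qed (simp_all add: scaleC_add_right scaleC_add_left)

lemma csubspace_eq: "csubspace M \<longleftrightarrow> cvs.subspace M"
  by (simp add: csubspace_def cvs.subspace_def)

lemma cspan_eq: "cspan B = cvs.span B"
  by (auto simp: cspan_def cvs.span_explicit)

lemma cvs_subspace_imp_subspace: "cvs.subspace M \<Longrightarrow> subspace M"
  unfolding cvs.subspace_def subspace_def by (metis scaleC_of_real)

lemma bounded_opD:
  assumes "bounded_op T"
  shows "T (x + y) = T x + T y" "T (scaleC c x) = scaleC c (T x)" "\<exists>K. \<forall>x. norm (T x) \<le> K * norm x"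
  using assms by (auto simp: bounded_op_def)

lemma bounded_op_linear: "bounded_op T \<Longrightarrow> module_hom scaleC scaleC T"
  by unfold_locales (simp_all add: bounded_opD)

lemma bounded_op_bounded_linear: "bounded_op T \<Longrightarrow> bounded_linear T"
  unfolding bounded_linear_def bounded_linear_axioms_def linear_iff
  by (metis bounded_op_def mult.commute scaleC_of_real)

lemma bounded_op_simps:
  assumes "bounded_op T"
  shows "T 0 = 0" "T (- x) = - T x" "T (x - y) = T x - T y" "T (sum g A) = (\<Sum>a\<in>A. T (g a))"
    "T (r *\<^sub>R x) = r *\<^sub>R T x"
  using bounded_op_bounded_linear[OF assms]
  by (simp_all add: bounded_linear.linear linear_0 linear_neg linear_diff linear_sum linear_scale)

lemma bounded_op_tendsto: "bounded_op T \<Longrightarrow> (f \<longlongrightarrow> a) F \<Longrightarrow> ((\<lambda>x. T (f x)) \<longlongrightarrow> T a) F"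
  by (rule bounded_linear.tendsto[OF bounded_op_bounded_linear])

lemma bounded_op_bound:
  assumes "bounded_op T" obtains K where "K > 0" "\<And>x. norm (T x) \<le> K * norm x"
  using bounded_linear.pos_bounded[OF bounded_op_bounded_linear[OF assms]] 
  by (metis mult.commute)

lemma bounded_opI:
  assumes "\<And>x y. T (x + y) = T x + T y" "\<And>c x. T (scaleC c x) = scaleC c (T x)"
    "\<And>x. norm (T x) \<le> K * norm x"
  shows "bounded_op T"
  using assms by (auto simp: bounded_op_def)

lemma bounded_op_id: "bounded_op (\<lambda>x. x)"
  by (rule bounded_opI[where K=1]) auto

lemma bounded_op_compose:
  assumes "bounded_op S" "bounded_op T" shows "bounded_op (\<lambda>x. S (T x))"
proof -
  obtain K where K: "K > 0" "\<And>x. norm (S x) \<le> K * norm x" using assms(1) bounded_op_bound by blast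
  obtain L where L: "L > 0" "\<And>x. norm (T x) \<le> L * norm x" using assms(2) bounded_op_bound by blast
  show ?thesis
  proof (rule bounded_opI[where K="K * L"])
    fix x
    show "norm (S (T x)) \<le> K * L * norm x"
      using K(2)[of "T x"] mult_left_mono[OF L(2)[of x], of K] K(1) by (simp only: mult.assoc) linarith
  qed (simp_all add: bounded_opD assms)
qed

lemma bounded_op_add:
  assumes "bounded_op S" "bounded_op T" shows "bounded_op (\<lambda>x. S x + T x)"
proof -
  obtain K where K: "K > 0" "\<And>x. norm (S x) \<le> K * norm x" using assms(1) bounded_op_bound by blast
  obtain L where L: "L > 0" "\<And>x. norm (T x) \<le> L * norm x" using assms(2) bounded_op_bound by blast
  show ?thesis
  proof (rule bounded_opI[where K="K + L"])
    fix x
    show "norm (S x + T x) \<le> (K + L) * norm x"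
      using K(2)[of x] L(2)[of x] norm_triangle_ineq[of "S x" "T x"] by (simp add: algebra_simps)
  qed (simp_all add: bounded_opD assms scaleC_add_right)
qed

lemma bounded_op_scaleC:
  assumes "bounded_op S" shows "bounded_op (\<lambda>x. scaleC c (S x))"
proof -
  obtain K where K: "K > 0" "\<And>x. norm (S x) \<le> K * norm x" using assms(1) bounded_op_bound by blast
  show ?thesis
  proof (rule bounded_opI[where K="cmod c * K"])
    fix x
    show "norm (scaleC c (S x)) \<le> cmod c * K * norm x"
      using mult_left_mono[OF K(2)[of x], of "cmod c"] by (simp add: norm_scaleC mult.assoc)
  qed (simp_all add: bounded_opD assms scaleC_add_right scaleC_scaleC mult.commute)
qed

lemma bounded_op_minus:
  assumes "bounded_op S" shows "bounded_op (\<lambda>x. - S x)"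
  using bounded_op_scaleC[OF assms, of "-1"] by (simp add: scaleC_one)

lemma bounded_op_diff:
  assumes "bounded_op S" "bounded_op T" shows "bounded_op (\<lambda>x. S x - T x)"
  using bounded_op_add[OF assms(1) bounded_op_minus[OF assms(2)]] by simp

lemma bounded_op_shift: "bounded_op T \<Longrightarrow> bounded_op (shift T \<mu>)"
  unfolding shift_def by (intro bounded_op_diff bounded_op_scaleC bounded_op_id)

lemma bounded_op_funpow: "bounded_op T \<Longrightarrow> bounded_op (T ^^ n)"
  by (induction n) (auto simp: bounded_op_id[folded id_def] o_def intro: bounded_op_compose)

lemma shift_shift: "shift (shift T a) b = shift T (a + b)"
  by (auto simp: shift_def scaleC_add_left)

lemma funpow_commute_op:
  assumes "\<And>x. T (S x) = S (T x)" shows "(T ^^ n) (S x) = S ((T ^^ n) x)"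
  by (induction n) (simp_all add: assms)

lemma shift_funpow_commute:
  assumes "bounded_op T" shows "shift T \<mu> ((T ^^ n) x) = (T ^^ n) (shift T \<mu> x)"
  using bounded_op_funpow[OF assms, of n]
  by (simp add: shift_def bounded_op_simps bounded_opD funpow_swap1)

section \<open>Finite dimension and closed ranges\<close>

text \<open>The definition wants the spanning set inside \<open>K\<close>. A basis extracted from
  \<open>K\<close> is such a set, and the exchange lemma bounds its size by that of any finite
  spanning set.\<close>

lemma cfin_dimI:
  assumes "finite B" "K \<subseteq> cvs.span B" shows "cfin_dim K"
proof -
  obtain C where C: "C \<subseteq> K" "cvs.independent C" "K \<subseteq> cvs.span C"
    using cvs.basis_exists[of K] by metis
  have "finite C" using cvs.independent_span_bound[OF assms(1) C(2)] C(1) assms(2) by blast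
  then show ?thesis using C by (auto simp: cfin_dim_def cspan_eq)
qed

lemma cfin_dimE:
  assumes "cfin_dim K" obtains B where "finite B" "B \<subseteq> K" "K \<subseteq> cvs.span B" "cvs.independent B"
proof -
  obtain D where D: "finite D" "K \<subseteq> cvs.span D" using assms by (auto simp: cfin_dim_def cspan_eq)
  obtain C where C: "C \<subseteq> K" "cvs.independent C" "K \<subseteq> cvs.span C"
    using cvs.basis_exists[of K] by metis
  have "finite C" using cvs.independent_span_bound[OF D(1) C(2)] C(1) D(2) by blast
  then show ?thesis using C that by auto
qed

lemma cfin_dim_subset: "cfin_dim W \<Longrightarrow> V \<subseteq> W \<Longrightarrow> cfin_dim V"
  by (meson cfin_dimE cfin_dimI subset_trans)

lemma cfin_dim_span: "finite B \<Longrightarrow> cfin_dim (cvs.span B)"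
  by (rule cfin_dimI) auto

lemma dim_mono_cfin_dim:
  assumes "cfin_dim W" "V \<subseteq> W" shows "cvs.dim V \<le> cvs.dim W"
proof -
  obtain B where B: "finite B" "B \<subseteq> W" "W \<subseteq> cvs.span B" "cvs.independent B"
    using cfin_dimE[OF assms(1)] .
  have "cvs.dim V \<le> card B" using B assms by (intro cvs.dim_le_card) auto
  then show ?thesis using cvs.basis_card_eq_dim[OF B(2,3,4)] by simp
qed

lemma subspace_eq_of_dim_eq:
  assumes "cfin_dim W" "cvs.subspace V" "V \<subseteq> W" "cvs.dim V = cvs.dim W"
  shows "V = W"
proof (rule ccontr)
  assume "V \<noteq> W"
  then obtain w where w: "w \<in> W" "w \<notin> V" using assms by auto
  obtain B where B: "finite B" "B \<subseteq> V" "V \<subseteq> cvs.span B" "cvs.independent B"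
    using cfin_dimE[OF cfin_dim_subset[OF assms(1,3)]] .
  obtain C where C: "finite C" "C \<subseteq> W" "W \<subseteq> cvs.span C" "cvs.independent C"
    using cfin_dimE[OF assms(1)] .
  have "cvs.span B \<subseteq> V" using B assms(2) by (intro cvs.span_minimal)
  then have "w \<notin> cvs.span B" using w by auto
  then have "cvs.independent (insert w B)" using B by (intro cvs.independent_insertI)
  then have "card (insert w B) \<le> card C"
    using cvs.independent_span_bound[OF C(1)] w B C assms by blast
  moreover have "w \<notin> B" using w B by auto
  ultimately have "card B < card C" using B by simp
  then show False using cvs.basis_card_eq_dim[OF B(2,3,4)] cvs.basis_card_eq_dim[OF C(2,3,4)] assms(4)
    by simp
qed

text \<open>A member of least dimension equals all later ones. This stops the chain N(S) \<inter>
  R(S^n) when the kernel is finite-dimensional.\<close>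

lemma decseq_subspaces_stationary:
  assumes "\<And>n. cvs.subspace (V n)" "\<And>n. V (Suc n) \<subseteq> V n" "cfin_dim (V 0)"
  obtains n where "\<And>m. m \<ge> n \<Longrightarrow> V m = V n"
proof -
  have mono: "V m \<subseteq> V n" if "n \<le> m" for n m using lift_Suc_antimono_le[of V, OF assms(2) that] .
  obtain n where n: "\<And>m. cvs.dim (V n) \<le> cvs.dim (V m)"
    using ex_has_least_nat[of "\<lambda>_. True" 0 "\<lambda>n. cvs.dim (V n)"] by auto
  have fd: "cfin_dim (V m)" for m using cfin_dim_subset[OF assms(3) mono[of 0 m]] by simp
  have "V m = V n" if "m \<ge> n" for m
    by (rule subspace_eq_of_dim_eq[OF fd assms(1) mono[OF that]])
       (intro antisym dim_mono_cfin_dim[OF fd mono[OF that]] n)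
  then show ?thesis using that by blast
qed

lemma incseq_subspaces_stationary:
  assumes "\<And>n. cvs.subspace (V n)" "\<And>n. V n \<subseteq> V (Suc n)" "\<And>n. V n \<subseteq> W" "cfin_dim W"
  obtains n where "\<And>m. m \<ge> n \<Longrightarrow> V m = V n"
proof -
  have mono: "V n \<subseteq> V m" if "n \<le> m" for n m using lift_Suc_mono_le[of V, OF assms(2) that] .
  have fd: "cfin_dim (V m)" for m using cfin_dim_subset[OF assms(4,3)] .
  obtain n where n: "\<And>m. cvs.dim (V m) \<le> cvs.dim (V n)"
    using ex_has_greatest_nat[of "\<lambda>_. True" 0 "\<lambda>n. cvs.dim (V n)" "Suc (cvs.dim W)"] 
      dim_mono_cfin_dim[OF assms(4,3)] by (auto simp: less_Suc_eq_le)
  have "V m = V n" if "m \<ge> n" for m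
    by (rule subspace_eq_of_dim_eq[OF fd assms(1) mono[OF that], symmetric])
       (intro antisym dim_mono_cfin_dim[OF fd mono[OF that]] n)
  then show ?thesis using that by blast
qed

text \<open>The positive distance d from b to V gives |c| d \<le> norm (v + c b), so the
  coefficients of a convergent sequence are Cauchy.\<close>

lemma closed_subspace_add_line:
  fixes b :: "'a::complex_banach"
  assumes V: "cvs.subspace V" "closed V" and b: "b \<notin> V"
  shows "closed {v + scaleC c b |v c. v \<in> V}"
proof -
  obtain d where d: "d > 0" "ball b d \<subseteq> - V" 
    using V(2) b by (meson ComplI open_Compl open_contains_ball)
  have lower: "cmod c * d \<le> norm (v + scaleC c b)" if "v \<in> V" for v c
  proof (cases "c = 0")
    case False
    define u where "u = - scaleC (1/c) v"
    have "u \<in> V" unfolding u_def using that V(1) by (intro cvs.subspace_neg cvs.subspace_scale)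
    then have "u \<notin> ball b d" using d by auto
    then have "d \<le> norm (b - u)" by (simp add: dist_norm)
    then have "cmod c * d \<le> norm (scaleC c (b - u))" by (simp add: norm_scaleC mult_left_mono)
    also have "scaleC c (b - u) = v + scaleC c b"
      using False by (simp add: u_def scaleC_add_right scaleC_scaleC scaleC_one)
    finally show ?thesis .
  qed simp
  show ?thesis unfolding closed_sequential_limits
  proof safe
    fix x l assume x: "\<forall>n. x n \<in> {v + scaleC c b |v c. v \<in> V}" and l: "x \<longlonglongrightarrow> l"
    from x have "\<forall>n. \<exists>v c. x n = v + scaleC c b \<and> v \<in> V" by blast
    then obtain v c where vc: "\<And>n. x n = v n + scaleC (c n) b" "\<And>n. v n \<in> V" by metis
    have le: "cmod (c m - c n) * d \<le> norm (x m - x n)" for m n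
    proof -
      have eq: "x m - x n = (v m - v n) + scaleC (c m - c n) b"
        by (simp add: vc cvs.scale_left_diff_distrib)
      show ?thesis unfolding eq using vc(2) V(1) by (intro lower cvs.subspace_diff)
    qed
    have cx: "Cauchy x" using l LIMSEQ_imp_Cauchy by blast
    have "Cauchy c" unfolding Cauchy_iff
    proof (intro allI impI)
      fix e :: real assume "e > 0"
      then obtain M where M: "\<And>m n. m \<ge> M \<Longrightarrow> n \<ge> M \<Longrightarrow> norm (x m - x n) < e * d"
        using cx d unfolding Cauchy_iff by (metis mult_pos_pos)
      have "norm (c m - c n) < e" if "m \<ge> M" "n \<ge> M" for m n
      proof -
        have "norm (c m - c n) * d < e * d" using M[OF that] le[of m n] by linarith
        then show ?thesis using d by simp
      qed
      then show "\<exists>M. \<forall>m\<ge>M. \<forall>n\<ge>M. norm (c m - c n) < e" by blast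
    qed
    then obtain c0 where c0: "c \<longlonglongrightarrow> c0" using Cauchy_convergent convergent_def by blast
    have "(\<lambda>n. x n - scaleC (c n) b) \<longlonglongrightarrow> l - scaleC c0 b"
      by (intro tendsto_diff l scaleC.tendsto c0 tendsto_const)
    moreover have "x n - scaleC (c n) b \<in> V" for n using vc by simp
    ultimately have "l - scaleC c0 b \<in> V" by (rule closed_sequentially[OF V(2), rotated])
    then show "\<exists>v c. l = v + scaleC c b \<and> v \<in> V"
      by (intro exI[of _ "l - scaleC c0 b"] exI[of _ c0]) simp
  qed
qed

lemma closed_subspace_add_span:
  fixes V :: "'a::complex_banach set"
  assumes "cvs.subspace V" "closed V" "finite B"
  shows "closed {v + f |v f. v \<in> V \<and> f \<in> cvs.span B}"
  using assms(3)
proof (induction B)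
  case empty
  then show ?case using assms by simp
next
  case (insert b B)
  define W where "W = {v + f |v f. v \<in> V \<and> f \<in> cvs.span B}"
  have W: "cvs.subspace W" unfolding W_def by (intro cvs.subspace_sums assms cvs.subspace_span)
  have eq: "{v + f |v f. v \<in> V \<and> f \<in> cvs.span (insert b B)} = {w + scaleC c b |w c. w \<in> W}"
  proof safe
    fix v f assume "v \<in> V" "f \<in> cvs.span (insert b B)"
    then obtain k where k: "f - scaleC k b \<in> cvs.span B" by (auto simp: cvs.span_insert)
    have "v + (f - scaleC k b) \<in> W" unfolding W_def using k \<open>v \<in> V\<close> by blast
    then show "\<exists>w c. v + f = w + scaleC c b \<and> w \<in> W"
      by (intro exI[of _ "v + (f - scaleC k b)"] exI[of _ k]) simp
  next
    fix w c assume "w \<in> W"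
    then obtain v f where "w = v + f" "v \<in> V" "f \<in> cvs.span B" by (auto simp: W_def)
    moreover then have "f + scaleC c b \<in> cvs.span (insert b B)"
      by (auto simp: cvs.span_insert intro: exI[of _ c])
    ultimately show "\<exists>v f. w + scaleC c b = v + f \<and> v \<in> V \<and> f \<in> cvs.span (insert b B)"
      by (metis add.assoc)
  qed
  show ?case
  proof (cases "b \<in> W")
    case True
    then have "{w + scaleC c b |w c. w \<in> W} = W"
      using W by (force intro: cvs.subspace_add cvs.subspace_scale exI[of _ 0])
    then show ?thesis using insert eq by (simp add: W_def)
  next
    case False
    then show ?thesis using closed_subspace_add_line[OF W _ False] insert eq by (simp add: W_def)
  qed
qed

text \<open>For S v_n converging to S x, the differences S v_n - S x have preimages w_n tending to 0
  by the open mapping constant. Then x + w_n differs from v_n by a kernel vector, hence lies in V,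
  and so does its limit x.\<close>

lemma closed_image_of_kernel_subset:
  fixes S :: "'a::complex_banach \<Rightarrow> 'a"
  assumes S: "bounded_op S" and M: "cvs.subspace M" "closed M" "closed (S ` M)"
    and V: "cvs.subspace V" "closed V" "V \<subseteq> M" "ker_on M S \<subseteq> V"
  shows "closed (S ` V)"
proof -
  obtain C where C: "C > 0" "\<And>y. y \<in> S ` M \<Longrightarrow> \<exists>x\<in>M. S x = y \<and> norm x \<le> C * norm y"
    using open_mapping_on_closed_subspace[OF bounded_op_bounded_linear[OF S]
        cvs_subspace_imp_subspace[OF M(1)] M(2,3)] by blast
  show ?thesis unfolding closed_sequential_limits
  proof safe
    fix y l assume y: "\<forall>n. y n \<in> S ` V" and l: "y \<longlonglongrightarrow> l"
    from y have "\<forall>n. \<exists>v. v \<in> V \<and> y n = S v" by blast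
    then obtain v where v: "\<And>n. v n \<in> V" "\<And>n. y n = S (v n)" by metis
    have "y n \<in> S ` M" for n using y V(3) by blast
    then have "l \<in> S ` M" using l by (rule closed_sequentially[OF M(3)])
    then obtain x where x: "x \<in> M" "l = S x" by auto
    have "y n - l \<in> S ` M" for n
    proof -
      have "y n - l = S (v n - x)" by (simp add: v x bounded_op_simps[OF S])
      moreover have "v n - x \<in> M" using v(1) V(3) x(1) by (intro cvs.subspace_diff M(1)) auto
      ultimately show ?thesis by blast
    qed
    then have "\<forall>n. \<exists>w. w \<in> M \<and> S w = y n - l \<and> norm w \<le> C * norm (y n - l)"
      using C(2) by blast
    then obtain w where w: "\<And>n. w n \<in> M" "\<And>n. S (w n) = y n - l" "\<And>n. norm (w n) \<le> C * norm (y n - l)"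
      by metis
    have "(\<lambda>n. C * norm (y n - l)) \<longlonglongrightarrow> C * 0"
      using l by (intro tendsto_mult tendsto_const tendsto_norm_zero) (simp add: LIM_zero)
    then have "w \<longlonglongrightarrow> 0"
      using Lim_null_comparison[of w "\<lambda>n. C * norm (y n - l)" sequentially] w(3) by simp
    then have "(\<lambda>n. x + w n) \<longlonglongrightarrow> x + 0" by (intro tendsto_intros)
    then have "(\<lambda>n. x + w n) \<longlonglongrightarrow> x" by simp
    moreover have "x + w n \<in> V" for n
    proof -
      have "x + w n - v n \<in> ker_on M S"
        using x w(1,2) v(1) V(3)
        by (auto simp: ker_on_def bounded_op_simps[OF S] bounded_opD[OF S] v(2)[symmetric]
            intro!: cvs.subspace_diff cvs.subspace_add M(1))
      then have "(x + w n - v n) + v n \<in> V" using v V by (intro cvs.subspace_add) auto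
      then show ?thesis by simp
    qed
    ultimately have "x \<in> V" by (rule closed_sequentially[OF V(2), rotated])
    then show "l \<in> S ` V" using x by auto
  qed
qed

section \<open>Finite codimension, closed ranges and compositions\<close>

lemma subspace_image_op: "bounded_op S \<Longrightarrow> cvs.subspace V \<Longrightarrow> cvs.subspace (S ` V)"
  by (rule module_hom.subspace_image[OF bounded_op_linear])

lemma subspace_range_op: "bounded_op S \<Longrightarrow> cvs.subspace (range S)"
  by (rule subspace_image_op) auto

lemma subspace_ker_on: "bounded_op S \<Longrightarrow> cvs.subspace M \<Longrightarrow> cvs.subspace (ker_on M S)"
  unfolding ker_on_def cvs.subspace_def by (auto simp: bounded_op_simps bounded_opD)

lemma closed_ker_on:
  assumes "bounded_op S" "closed M" shows "closed (ker_on M S)"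
proof -
  have "closed (S -` {0})"
    by (rule continuous_closed_vimage)
       (use assms in \<open>auto intro: linear_continuous_at bounded_op_bounded_linear\<close>)
  moreover have "ker_on M S = M \<inter> S -` {0}" by (auto simp: ker_on_def)
  ultimately show ?thesis using assms by auto
qed

lemma fin_codim_UNIV_iff:
  "fin_codim UNIV R \<longleftrightarrow> (\<exists>B. finite B \<and> (\<forall>x. \<exists>r\<in>R. \<exists>f\<in>cvs.span B. x = r + f))"
  by (auto simp: fin_codim_def cspan_eq subset_eq) metis+

text \<open>Greedy selection: a vector is kept only if it lies outside the sum of R and the span of
  those kept before.\<close>

lemma finite_algebraic_complement:
  assumes R: "cvs.subspace R" and "finite B"
  shows "\<exists>B'\<subseteq>B. R \<inter> cvs.span B' = {0} \<and>
    {r + f |r f. r \<in> R \<and> f \<in> cvs.span B} \<subseteq> {r + f |r f. r \<in> R \<and> f \<in> cvs.span B'}"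
  using assms(2)
proof (induction B)
  case empty
  then show ?case using cvs.subspace_0[OF R] by auto
next
  case (insert b B)
  then obtain B' where B': "B' \<subseteq> B" "R \<inter> cvs.span B' = {0}"
    "{r + f |r f. r \<in> R \<and> f \<in> cvs.span B} \<subseteq> {r + f |r f. r \<in> R \<and> f \<in> cvs.span B'}" by auto
  define W where "W = {r + f |r f. r \<in> R \<and> f \<in> cvs.span B'}"
  have W: "cvs.subspace W" unfolding W_def by (intro cvs.subspace_sums R cvs.subspace_span)
  have dec: "\<exists>k. r + f - scaleC k b \<in> W" if rf: "r \<in> R" "f \<in> cvs.span (insert b B)" for r f
  proof -
    obtain k where "f - scaleC k b \<in> cvs.span B" using rf by (auto simp: cvs.span_insert)
    then have "r + (f - scaleC k b) \<in> W" using B'(3) rf unfolding W_def by blast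
    then show ?thesis by (auto simp: algebra_simps)
  qed
  show ?case
  proof (cases "b \<in> W")
    case True
    have "r + f \<in> W" if rf: "r \<in> R" "f \<in> cvs.span (insert b B)" for r f
    proof -
      obtain k where "r + f - scaleC k b \<in> W" using dec rf by blast
      then have "(r + f - scaleC k b) + scaleC k b \<in> W"
        using True W by (intro cvs.subspace_add cvs.subspace_scale)
      then show ?thesis by simp
    qed
    then show ?thesis using B' unfolding W_def by (intro exI[of _ B']) blast
  next
    case False
    have "R \<inter> cvs.span (insert b B') \<subseteq> {0}"
    proof
      fix x assume x: "x \<in> R \<inter> cvs.span (insert b B')"
      then obtain k where k: "x - scaleC k b \<in> cvs.span B'" by (auto simp: cvs.span_insert)
      have "k = 0"
      proof (rule ccontr)
        assume "k \<noteq> 0"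
        have "scaleC (1/k) x + - scaleC (1/k) (x - scaleC k b) \<in> W"
          unfolding W_def using x k R
          by (blast intro: cvs.subspace_scale cvs.span_neg cvs.span_scale)
        moreover have "scaleC (1/k) x + - scaleC (1/k) (x - scaleC k b) = b"
          using \<open>k \<noteq> 0\<close> by (simp add: cvs.scale_right_diff_distrib scaleC_scaleC scaleC_one)
        ultimately show False using False by simp
      qed
      then show "x \<in> {0}" using k x B' by auto
    qed
    moreover have "0 \<in> R \<inter> cvs.span (insert b B')" using R by (simp add: cvs.subspace_0 cvs.span_zero)
    moreover have "r + f \<in> {r + f |r f. r \<in> R \<and> f \<in> cvs.span (insert b B')}"
      if rf: "r \<in> R" "f \<in> cvs.span (insert b B)" for r f
    proof -
      obtain k where "r + f - scaleC k b \<in> W" using dec rf by blast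
      then obtain r' f' where r': "r + f - scaleC k b = r' + f'" "r' \<in> R" "f' \<in> cvs.span B'"
        by (auto simp: W_def)
      then have "r + f = r' + (f' + scaleC k b)" by (simp add: algebra_simps)
      moreover have "f' + scaleC k b \<in> cvs.span (insert b B')"
        using r' by (auto simp: cvs.span_insert intro: exI[of _ k])
      ultimately show ?thesis using r' by blast
    qed
    ultimately show ?thesis using B' by (intro exI[of _ "insert b B'"]) auto
  qed
qed

text \<open>The definition of \<open>lower_fredholm_on\<close> does not mention closedness; this
  supplies it. The map (x, f) to S x + f from the product with a finite-dimensional complement is
  onto, and its open mapping constant bounds the complement component.\<close>

lemma closed_range_of_fin_codim:
  assumes S: "bounded_op S" and c: "fin_codim UNIV (range S)"
  shows "closed (range S)"
proof -
  obtain B0 where B0: "finite B0" "\<And>x. \<exists>r\<in>range S. \<exists>f\<in>cvs.span B0. x = r + f"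
    using c by (auto simp: fin_codim_UNIV_iff)
  obtain B where B: "B \<subseteq> B0" "range S \<inter> cvs.span B = {0}"
    "{r + f |r f. r \<in> range S \<and> f \<in> cvs.span B0} \<subseteq> {r + f |r f. r \<in> range S \<and> f \<in> cvs.span B}"
    using finite_algebraic_complement[OF subspace_range_op[OF S] B0(1)] by auto
  have "finite B" using B B0 finite_subset by blast
  define T where "T = (\<lambda>(x, f). S x + f)"
  define A where "A = (UNIV :: 'a set) \<times> cvs.span B"
  have T: "bounded_linear T" unfolding T_def case_prod_unfold
    by (intro bounded_linear_add bounded_linear_compose[OF bounded_op_bounded_linear[OF S]]
        bounded_linear_fst bounded_linear_snd)
  have "closed (cvs.span B)"
    using closed_subspace_add_span[of "{0}" B] \<open>finite B\<close> by simp
  then have A: "closed A" unfolding A_def by (intro closed_Times) auto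
  have sA: "subspace A" unfolding A_def 
    using cvs_subspace_imp_subspace[OF cvs.subspace_span, of B] by (intro subspace_Times) auto
  have TA: "T ` A = UNIV"
  proof -
    have "x \<in> T ` A" for x
    proof -
      have "x \<in> {r + f |r f. r \<in> range S \<and> f \<in> cvs.span B}" using B(3) B0(2)[of x] by blast
      then show ?thesis by (force simp: T_def A_def)
    qed
    then show ?thesis by auto
  qed
  obtain C where C: "C > 0" "\<And>y. y \<in> T ` A \<Longrightarrow> \<exists>x\<in>A. T x = y \<and> norm x \<le> C * norm y"
    using open_mapping_on_closed_subspace[OF T sA A] TA by auto
  show ?thesis unfolding closed_sequential_limits
  proof safe
    fix y l assume y: "\<forall>n. y n \<in> range S" and l: "y \<longlonglongrightarrow> l"
    have "l \<in> T ` A" using TA by simp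
    then obtain x f where xf: "l = S x + f" "f \<in> cvs.span B" by (auto simp: T_def A_def)
    have "\<exists>u g. S u + g = y n - l \<and> g \<in> cvs.span B \<and> norm g \<le> C * norm (y n - l)" for n
    proof -
      obtain p where p: "p \<in> A" "T p = y n - l" "norm p \<le> C * norm (y n - l)" using C(2) TA by blast
      have "norm (snd p) \<le> norm p" by (metis norm_snd_le prod.collapse)
      then have "norm (snd p) \<le> C * norm (y n - l)" using p(3) by linarith
      moreover have "S (fst p) + snd p = y n - l" using p(2) by (simp add: T_def case_prod_unfold)
      moreover have "snd p \<in> cvs.span B" using p(1) by (auto simp: A_def)
      ultimately show ?thesis by blast
    qed
    then obtain u g where ug: "\<And>n. S (u n) + g n = y n - l" "\<And>n. g n \<in> cvs.span B"
       "\<And>n. norm (g n) \<le> C * norm (y n - l)" by metis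
    \<comment> \<open>The vector f + g n lies both in the range and in its complement, hence
      vanishes. So the fixed f is dominated by norm (y n - l), which tends to 0.\<close>
    have "g n = - f" for n
    proof -
      obtain v where v: "y n = S v" using y by blast
      have "S (v - x - u n) = y n - S x - S (u n)" by (simp add: bounded_op_simps[OF S] v)
      moreover have "f + g n = y n - S x - S (u n)"
        using ug(1)[of n] xf(1) by (simp add: algebra_simps)
      ultimately have "f + g n = S (v - x - u n)" by simp
      then have "f + g n \<in> range S" by blast
      moreover have "f + g n \<in> cvs.span B" using xf(2) ug(2) by (rule cvs.span_add)
      ultimately have "f + g n \<in> range S \<inter> cvs.span B" by blast
      then show ?thesis using B(2) by (simp add: add_eq_0_iff)
    qed
    then have "norm f \<le> C * norm (y n - l)" for n using ug(3)[of n] by simp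
    moreover have "(\<lambda>n. C * norm (y n - l)) \<longlonglongrightarrow> C * 0"
      using l by (intro tendsto_mult tendsto_const tendsto_norm_zero) (simp add: LIM_zero)
    ultimately have "norm f \<le> C * 0"
      using LIMSEQ_le_const[of "\<lambda>n. C * norm (y n - l)"] by blast
    then show "l \<in> range S" using xf by simp
  qed
qed

lemma fin_codim_range_compose:
  assumes S: "bounded_op S" and c: "fin_codim UNIV (range S)" "fin_codim UNIV (range T)"
  shows "fin_codim UNIV (range (\<lambda>x. S (T x)))"
proof -
  obtain B where B: "finite B" "\<And>x. \<exists>r\<in>range S. \<exists>f\<in>cvs.span B. x = r + f"
    using c by (auto simp: fin_codim_UNIV_iff)
  obtain D where D: "finite D" "\<And>x. \<exists>r\<in>range T. \<exists>f\<in>cvs.span D. x = r + f"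
    using c by (auto simp: fin_codim_UNIV_iff)
  show ?thesis unfolding fin_codim_UNIV_iff
  proof (intro exI[of _ "B \<union> S ` D"] conjI allI)
    fix x
    obtain y f where y: "x = S y + f" "f \<in> cvs.span B" using B(2)[of x] by auto
    obtain z g where z: "y = T z + g" "g \<in> cvs.span D" using D(2)[of y] by auto
    have "S g \<in> cvs.span (S ` D)"
      using z(2) module_hom.span_image[OF bounded_op_linear[OF S], of D] by auto
    then have "S g + f \<in> cvs.span (B \<union> S ` D)"
      using y(2) by (meson cvs.span_add cvs.span_mono sup_ge1 sup_ge2 subsetD)
    moreover have "x = S (T z) + (S g + f)" using y z by (simp add: bounded_opD[OF S])
    ultimately show "\<exists>r\<in>range (\<lambda>x. S (T x)). \<exists>f\<in>cvs.span (B \<union> S ` D). x = r + f" by blast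
  qed (use B D in auto)
qed

text \<open>The kernel of S T is spanned by preimages of a basis of N(S) \<inter> R(T) together with
  a spanning set of N(T).\<close>

lemma cfin_dim_ker_compose:
  assumes T: "bounded_op T" and k: "cfin_dim (ker_on UNIV S)" "cfin_dim (ker_on UNIV T)"
  shows "cfin_dim (ker_on UNIV (\<lambda>x. S (T x)))"
proof -
  have "cfin_dim (ker_on UNIV S \<inter> range T)" using k(1) by (rule cfin_dim_subset) auto
  then obtain B where B: "finite B" "B \<subseteq> ker_on UNIV S \<inter> range T" "ker_on UNIV S \<inter> range T \<subseteq> cvs.span B"
    by (rule cfin_dimE)
  obtain D where D: "finite D" "ker_on UNIV T \<subseteq> cvs.span D" using k(2) by (rule cfin_dimE)
  obtain C where C: "finite C" "B = T ` C" 
    using finite_subset_image[OF B(1), of T UNIV] B(2) by auto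
  show ?thesis
  proof (rule cfin_dimI[of "C \<union> D"])
    show "ker_on UNIV (\<lambda>x. S (T x)) \<subseteq> cvs.span (C \<union> D)"
    proof
      fix x assume "x \<in> ker_on UNIV (\<lambda>x. S (T x))"
      then have "T x \<in> cvs.span B" using B(3) by (auto simp: ker_on_def)
      then obtain z where z: "z \<in> cvs.span C" "T x = T z"
        unfolding C module_hom.span_image[OF bounded_op_linear[OF T]] by auto
      have "x - z \<in> cvs.span D" using D(2) z by (auto simp: ker_on_def bounded_op_simps[OF T])
      then have "z + (x - z) \<in> cvs.span (C \<union> D)"
        using z(1) by (meson cvs.span_add cvs.span_mono sup_ge1 sup_ge2 subsetD)
      then show "x \<in> cvs.span (C \<union> D)" by simp
    qed
  qed (use C D in auto)
qed

section \<open>Perturbation of bijective and Kato operators\<close>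

lemma shift_diff: "bounded_op T \<Longrightarrow> shift T \<mu> (x - y) = shift T \<mu> x - shift T \<mu> y"
  using bounded_op_shift bounded_op_simps(3) by blast

lemma shift_in_subspace:
  assumes "cvs.subspace M" "S x \<in> M" "x \<in> M" shows "shift S \<mu> x \<in> M"
  unfolding shift_def using assms by (intro cvs.subspace_diff cvs.subspace_scale)

lemma bij_betw_lower_bound:
  assumes S: "bounded_op S" and M: "cvs.subspace M" "closed M" and bij: "bij_betw S M M"
  obtains C where "C > 0" "\<And>x. x \<in> M \<Longrightarrow> norm x \<le> C * norm (S x)"
proof -
  have SM: "S ` M = M" using bij by (simp add: bij_betw_def)
  obtain C where C: "C > 0" "\<And>y. y \<in> S ` M \<Longrightarrow> \<exists>x\<in>M. S x = y \<and> norm x \<le> C * norm y"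
    using open_mapping_on_closed_subspace[OF bounded_op_bounded_linear[OF S]
        cvs_subspace_imp_subspace[OF M(1)] M(2)] M(2) SM by metis
  have "norm x \<le> C * norm (S x)" if x: "x \<in> M" for x
  proof -
    obtain x' where "x' \<in> M" "S x' = S x" "norm x' \<le> C * norm (S x)" using C(2) x by blast
    then show ?thesis using bij x by (metis bij_betw_def inj_onD)
  qed
  then show ?thesis using C(1) that by blast
qed

lemma inj_on_subspace_iff:
  assumes "bounded_op S" "cvs.subspace M"
  shows "inj_on S M \<longleftrightarrow> ker_on M S = {0}"
proof
  assume i: "inj_on S M"
  have "x = 0" if "x \<in> ker_on M S" for x
    using inj_onD[OF i, of x 0] that assms cvs.subspace_0
    by (auto simp: ker_on_def bounded_op_simps)
  moreover have "0 \<in> ker_on M S" using assms cvs.subspace_0 by (auto simp: ker_on_def bounded_op_simps)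
  ultimately show "ker_on M S = {0}" by auto
next
  assume k: "ker_on M S = {0}"
  show "inj_on S M"
  proof (rule inj_onI)
    fix x y assume "x \<in> M" "y \<in> M" "S x = S y"
    then have "x - y \<in> ker_on M S"
      using assms by (auto simp: ker_on_def bounded_op_simps cvs.subspace_diff)
    then show "x = y" using k by simp
  qed
qed

text \<open>With g the inverse of S on M, the equation S x - \<mu> x = y is the fixed point equation
  x = g (y + \<mu> x), a contraction with factor C |\<mu>|.\<close>

lemma bij_betw_shift:
  assumes S: "bounded_op S" and M: "cvs.subspace M" "closed M" and bij: "bij_betw S M M"
  obtains \<epsilon> where "\<epsilon> > 0" "\<And>\<mu>. cmod \<mu> < \<epsilon> \<Longrightarrow> bij_betw (shift S \<mu>) M M"
proof -
  obtain C where C: "C > 0" "\<And>x. x \<in> M \<Longrightarrow> norm x \<le> C * norm (S x)"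
    using bij_betw_lower_bound[OF assms] by blast
  have SM: "S ` M = M" and inj: "inj_on S M" using bij by (auto simp: bij_betw_def)
  define g where "g = inv_into M S"
  have g: "g y \<in> M" "S (g y) = y" if "y \<in> M" for y
    using that SM unfolding g_def by (metis inv_into_into, metis f_inv_into_f)
  have "bij_betw (shift S \<mu>) M M" if mu: "cmod \<mu> < 1 / (2 * C)" for \<mu>
  proof -
    have c: "C * cmod \<mu> < 1" "0 \<le> C * cmod \<mu>" using mu C(1) by (auto simp: field_simps)
    have into: "shift S \<mu> x \<in> M" if "x \<in> M" for x
      using that SM M by (intro shift_in_subspace) auto
    have "x = 0" if "x \<in> M" "shift S \<mu> x = 0" for x
    proof -
      have "S x = scaleC \<mu> x" using that by (simp add: shift_def)
      then have "norm x \<le> C * cmod \<mu> * norm x" using C(2)[OF that(1)] by (simp add: norm_scaleC)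
      then have "(1 - C * cmod \<mu>) * norm x \<le> 0" by (simp add: algebra_simps)
      then show ?thesis using c by (simp add: mult_le_0_iff)
    qed
    then have "ker_on M (shift S \<mu>) = {0}" 
      using cvs.subspace_0[OF M(1)] bounded_op_simps(1)[OF bounded_op_shift[OF S]]
      by (auto simp: ker_on_def)
    then have "inj_on (shift S \<mu>) M" using inj_on_subspace_iff[OF bounded_op_shift[OF S] M(1)] by simp
    moreover have "y \<in> shift S \<mu> ` M" if y: "y \<in> M" for y
    proof -
      have yM: "y + scaleC \<mu> x \<in> M" if "x \<in> M" for x
        using y that M by (intro cvs.subspace_add cvs.subspace_scale)
      have "\<exists>!x\<in>M. g (y + scaleC \<mu> x) = x"
      proof (rule Banach_fix)
        show "complete M" using M by (simp add: complete_eq_closed)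
        show "M \<noteq> {}" using cvs.subspace_0[OF M(1)] by auto
        show "(\<lambda>x. g (y + scaleC \<mu> x)) ` M \<subseteq> M" using yM g by blast
        show "dist (g (y + scaleC \<mu> x)) (g (y + scaleC \<mu> x')) \<le> C * cmod \<mu> * dist x x'"
          if x: "x \<in> M" "x' \<in> M" for x x'
        proof -
          let ?d = "g (y + scaleC \<mu> x) - g (y + scaleC \<mu> x')"
          have "?d \<in> M" using x yM g M by (intro cvs.subspace_diff) auto
          moreover have "S ?d = scaleC \<mu> (x - x')"
            using x yM g by (simp add: bounded_op_simps[OF S] cvs.scale_right_diff_distrib)
          ultimately show ?thesis using C(2)[of ?d] by (simp add: dist_norm norm_scaleC)
        qed
      qed (use c in auto)
      then obtain x where x: "x \<in> M" "g (y + scaleC \<mu> x) = x" by blast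
      then have "S x = y + scaleC \<mu> x" using g(2)[OF yM] by metis
      then show ?thesis using x by (force simp: shift_def)
    qed
    ultimately show ?thesis using into by (auto simp: bij_betw_def)
  qed
  then show ?thesis using that[of "1 / (2 * C)"] C by auto
qed

text \<open>The equation T x - \<mu> x = y is the fixed point equation x = (T x - y) / \<mu>, a
  contraction with factor K / |\<mu>|.\<close>

lemma bij_shift_of_norm_less:
  assumes T: "bounded_op T" and K: "\<And>x. norm (T x) \<le> K * norm x" "0 \<le> K" "K < cmod \<mu>"
  shows "bij (shift T \<mu>)"
proof -
  have mu: "\<mu> \<noteq> 0" using K by auto
  have "\<exists>!x. shift T \<mu> x = y" for y
  proof -
    have "\<exists>!x. scaleC (1/\<mu>) (T x - y) = x"
    proof (rule banach_fix_type)
      show "0 \<le> K / cmod \<mu>" "K / cmod \<mu> < 1" using K(2,3) mu by (auto simp: divide_less_eq)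
      show "\<forall>x x'. dist (scaleC (1/\<mu>) (T x - y)) (scaleC (1/\<mu>) (T x' - y)) \<le> K / cmod \<mu> * dist x x'"
      proof (intro allI)
        fix x x'
        have "scaleC (1/\<mu>) (T x - y) - scaleC (1/\<mu>) (T x' - y) = scaleC (1/\<mu>) (T (x - x'))"
          by (simp add: bounded_op_simps[OF T] cvs.scale_right_diff_distrib)
        then have "dist (scaleC (1/\<mu>) (T x - y)) (scaleC (1/\<mu>) (T x' - y)) = norm (T (x - x')) / cmod \<mu>"
          by (simp add: dist_norm norm_scaleC norm_divide)
        also have "\<dots> \<le> K * norm (x - x') / cmod \<mu>" using K by (intro divide_right_mono) auto
        finally show "dist (scaleC (1/\<mu>) (T x - y)) (scaleC (1/\<mu>) (T x' - y)) \<le> K / cmod \<mu> * dist x x'"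
          by (simp add: dist_norm)
      qed
    qed
    moreover have "scaleC (1/\<mu>) (T x - y) = x \<longleftrightarrow> shift T \<mu> x = y" for x
    proof
      assume "scaleC (1/\<mu>) (T x - y) = x"
      then have "scaleC \<mu> (scaleC (1/\<mu>) (T x - y)) = scaleC \<mu> x" by simp
      then have "T x - y = scaleC \<mu> x" using mu by (simp add: scaleC_scaleC scaleC_one)
      then show "shift T \<mu> x = y" by (simp add: shift_def algebra_simps)
    next
      assume "shift T \<mu> x = y"
      then have "T x - y = scaleC \<mu> x" by (simp add: shift_def algebra_simps)
      then show "scaleC (1/\<mu>) (T x - y) = x" using mu by (simp add: scaleC_scaleC scaleC_one)
    qed
    ultimately show ?thesis by simp
  qed
  then show ?thesis by (simp add: bij_iff)
qed

text \<open>The Kato condition puts the kernel inside each S^n M, which is what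
  \<open>closed_image_of_kernel_subset\<close> needs to pass from S^n M to S^(n+1) M.\<close>

lemma kato_funpow_image:
  assumes S: "bounded_op S" and M: "cvs.subspace M" "closed M" "S ` M \<subseteq> M" and k: "kato_on M S"
  shows "closed ((S ^^ n) ` M) \<and> cvs.subspace ((S ^^ n) ` M) \<and> (S ^^ n) ` M \<subseteq> M"
proof (induction n)
  case 0
  then show ?case using M by simp
next
  case (Suc n)
  have eq: "(S ^^ Suc n) ` M = S ` ((S ^^ n) ` M)" by (simp add: image_comp)
  have "closed (S ` ((S ^^ n) ` M))"
  proof (rule closed_image_of_kernel_subset[OF S M(1,2)])
    show "closed (S ` M)" "ker_on M S \<subseteq> (S ^^ n) ` M" using k unfolding kato_on_def by blast+
  qed (use Suc in blast)+
  moreover have "cvs.subspace (S ` ((S ^^ n) ` M))" using Suc subspace_image_op[OF S] by simp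
  moreover have "S ` ((S ^^ n) ` M) \<subseteq> M" using Suc M(3) by (meson image_mono order_trans)
  ultimately show ?case unfolding eq by simp
qed

text \<open>The generalized range of a Kato operator is mapped onto itself with an open-mapping constant,
  so a kernel vector spreads to a power series of eigenvectors, and surjectivity of a small shift
  propagates back to the operator by successive approximation.\<close>

lemma kato_bij_of_shift_bij:
  assumes S: "bounded_op S" and M: "cvs.subspace M" "closed M" "S ` M \<subseteq> M" and k: "kato_on M S"
  obtains \<epsilon> where "\<epsilon> > 0" "\<And>\<mu>. cmod \<mu> < \<epsilon> \<Longrightarrow> bij_betw (shift S \<mu>) M M \<Longrightarrow> bij_betw S M M"
proof -
  define K where "K = (\<Inter>n. (S ^^ n) ` M)"
  note pow = kato_funpow_image[OF assms]
  have subK: "cvs.subspace K" unfolding K_def using pow by (intro cvs.subspace_Int) auto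
  have clK: "closed K" unfolding K_def using pow by auto
  have KM: "K \<subseteq> M" unfolding K_def by (rule INF_lower2[of 0]) auto
  have kerK: "ker_on M S \<subseteq> K" using k by (auto simp: K_def kato_on_def)
  have clSM: "closed (S ` M)" using k by (simp add: kato_on_def)
  \<comment> \<open>For surjectivity, any preimage in M of a point of \<open>K\<close> differs from
    a point of S^n M by a kernel vector. The kernel lies in \<open>K\<close>, so the preimage lies
    in every S^n M.\<close>
  have SK: "S ` K = K"
  proof
    have "S x \<in> (S ^^ n) ` M" if xK: "x \<in> K" for x n
    proof (cases n)
      case 0
      then show ?thesis using xK KM M(3) by auto
    next
      case (Suc m)
      have "x \<in> (S ^^ m) ` M" using xK unfolding K_def by blast
      then obtain u where "u \<in> M" "x = (S ^^ m) u" by blast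
      then show ?thesis using Suc by auto
    qed
    then show "S ` K \<subseteq> K" by (auto simp: K_def)
    show "K \<subseteq> S ` K"
    proof
      fix y assume y: "y \<in> K"
      then have "y \<in> (S ^^ 1) ` M" unfolding K_def by blast
      then obtain x where x: "x \<in> M" "y = S x" by auto
      have "x \<in> (S ^^ n) ` M" for n
      proof -
        have "y \<in> (S ^^ Suc n) ` M" using y unfolding K_def by blast
        then obtain u where u: "u \<in> M" "y = S ((S ^^ n) u)" by auto
        have uM: "(S ^^ n) u \<in> M" using pow[of n] u by blast
        have "x - (S ^^ n) u \<in> ker_on M S"
          using x u uM M(1) by (auto simp: ker_on_def bounded_op_simps[OF S] cvs.subspace_diff)
        then have "x - (S ^^ n) u \<in> (S ^^ n) ` M" using kerK by (auto simp: K_def)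
        then have "(x - (S ^^ n) u) + (S ^^ n) u \<in> (S ^^ n) ` M"
          using u pow[of n] by (intro cvs.subspace_add) auto
        then show ?thesis by simp
      qed
      then show "y \<in> S ` K" using x by (auto simp: K_def)
    qed
  qed
  obtain C0 where C0: "C0 > 0" "\<And>y. y \<in> S ` M \<Longrightarrow> \<exists>x\<in>M. S x = y \<and> norm x \<le> C0 * norm y"
    using open_mapping_on_closed_subspace[OF bounded_op_bounded_linear[OF S]
        cvs_subspace_imp_subspace[OF M(1)] M(2) clSM] by blast
  obtain C1 where C1: "C1 > 0" "\<And>y. y \<in> K \<Longrightarrow> \<exists>x\<in>K. S x = y \<and> norm x \<le> C1 * norm y"
    using open_mapping_on_closed_subspace[OF bounded_op_bounded_linear[OF S]
        cvs_subspace_imp_subspace[OF subK] clK] clK SK by metis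
  \<comment> \<open>The bound by 1/(4 C1) makes the eigenvector series decay with ratio 1/4, so its
    tail is at most a third of its head. The bound by 1/(8 C0) makes 4 C0 |\<mu>| \<le> 1/2, the
    contraction factor of the surjectivity argument.\<close>
  define \<epsilon> where "\<epsilon> = min (1 / (8 * C0)) (1 / (4 * C1))"
  have eps: "\<epsilon> > 0" using C0 C1 by (simp add: \<epsilon>_def)
  have "bij_betw S M M" if mu: "cmod \<mu> < \<epsilon>" and bij: "bij_betw (shift S \<mu>) M M" for \<mu>
  proof -
    have mu0: "8 * C0 * cmod \<mu> < 1" and mu1: "4 * (C1 * cmod \<mu>) < 1"
      using mu C0 C1 by (auto simp: \<epsilon>_def field_simps)
    have "x0 = 0" if x0: "x0 \<in> ker_on M S" for x0
    proof (rule ccontr)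
      assume nz: "x0 \<noteq> 0"
      obtain g where g: "\<And>y. y \<in> K \<Longrightarrow> g y \<in> K" "\<And>y. y \<in> K \<Longrightarrow> S (g y) = y"
        "\<And>y. y \<in> K \<Longrightarrow> norm (g y) \<le> C1 * norm y"
        using C1(2) by metis
      define x where "x n = (g ^^ n) x0" for n
      have xK: "x n \<in> K" for n by (induction n) (use x0 kerK g in \<open>auto simp: x_def\<close>)
      have xS: "S (x (Suc n)) = x n" for n using g(2)[OF xK[of n]] by (simp add: x_def)
      have xn: "norm (x n) \<le> C1 ^ n * norm x0" for n
      proof (induction n)
        case (Suc n)
        have "norm (x (Suc n)) \<le> C1 * norm (x n)" using g(3)[OF xK[of n]] by (simp add: x_def)
        also have "\<dots> \<le> C1 * (C1 ^ n * norm x0)" using Suc C1 by (intro mult_left_mono) auto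
        finally show ?case by simp
      qed (simp add: x_def)
      \<comment> \<open>Since S x_(n+1) = x_n and S x_0 = 0, the sum f of these terms satisfies S f
        = \<mu> f. Injectivity of S - \<mu> gives f = 0, although the head x_0 outweighs the
        tail.\<close>
      define t where "t n = scaleC (\<mu> ^ n) (x n)" for n
      have tn: "norm (t n) \<le> (1/4) ^ n * norm x0" for n
      proof -
        have "norm (t n) \<le> cmod \<mu> ^ n * (C1 ^ n * norm x0)"
          unfolding t_def norm_scaleC norm_power by (intro mult_left_mono xn) auto
        also have "\<dots> = (C1 * cmod \<mu>) ^ n * norm x0" by (simp add: power_mult_distrib)
        also have "\<dots> \<le> (1/4) ^ n * norm x0"
          using mu1 C1 by (intro mult_right_mono power_mono) auto
        finally show ?thesis .
      qed
      have sg: "summable (\<lambda>n. (1/4::real) ^ n * norm x0)" by (intro summable_mult2 summable_geometric) auto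
      have st: "summable t" 
        by (rule summable_comparison_test'[OF sg, of 0]) (use tn in simp)
      define f where "f = suminf t"
      have "t n \<in> K" for n unfolding t_def by (intro cvs.subspace_scale subK xK)
      then have "(\<Sum>i<n. t i) \<in> K" for n by (intro cvs.subspace_sum subK)
      then have fK: "f \<in> K" unfolding f_def by (rule closed_sequentially[OF clK _ summable_LIMSEQ[OF st]])
      have St0: "S (t 0) = 0" using x0 by (simp add: t_def x_def ker_on_def scaleC_one)
      have StS: "S (t (Suc n)) = scaleC \<mu> (t n)" for n
        unfolding t_def by (simp add: bounded_opD[OF S] xS scaleC_scaleC del: funpow.simps)
      have "S f = (\<Sum>n. S (t n))"
        unfolding f_def by (rule bounded_linear.suminf[OF bounded_op_bounded_linear[OF S] st])
      also have "\<dots> = (\<Sum>n. S (t (Suc n)))"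
        using suminf_split_head[of "\<lambda>n. S (t n)"] St0
          bounded_linear.summable[OF bounded_op_bounded_linear[OF S] st] by simp
      also have "\<dots> = scaleC \<mu> f"
        unfolding StS f_def
        by (rule bounded_linear.suminf[OF bounded_op_bounded_linear[OF bounded_op_scaleC[OF bounded_op_id]] st, symmetric])
      finally have "shift S \<mu> f = 0" by (simp add: shift_def)
      then have "f \<in> ker_on M (shift S \<mu>)" using fK KM by (auto simp: ker_on_def)
      then have "f = 0"
        using inj_on_subspace_iff[OF bounded_op_shift[OF S] M(1)] bij by (auto simp: bij_betw_def)
      have "f = t 0 + (\<Sum>n. t (Suc n))" unfolding f_def using suminf_split_head[OF st] by simp
      then have "norm x0 = norm (\<Sum>n. t (Suc n))"
        using \<open>f = 0\<close> by (simp add: t_def x_def scaleC_one add_eq_0_iff)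
      also have "\<dots> \<le> (\<Sum>n. (1/4) ^ (Suc n) * norm x0)"
      proof (rule norm_suminf_le)
        show "norm (t (Suc n)) \<le> (1/4) ^ (Suc n) * norm x0" for n by (rule tn)
        show "summable (\<lambda>n. (1/4::real) ^ (Suc n) * norm x0)" using sg by (rule summable_Suc_iff[THEN iffD2])
      qed
      also have "\<dots> = norm x0 / 3"
      proof -
        have "(\<lambda>n. (1/4::real) ^ n * (norm x0 / 4)) sums (1 / (1 - 1/4) * (norm x0 / 4))"
          by (intro sums_mult2 geometric_sums) auto
        then show ?thesis by (simp add: sums_iff mult_ac)
      qed
      finally show False using nz by simp
    qed
    then have "ker_on M S = {0}"
      using cvs.subspace_0[OF M(1)] bounded_op_simps(1)[OF S] by (auto simp: ker_on_def)
    then have inj: "inj_on S M" using inj_on_subspace_iff[OF S M(1)] by simp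
    \<comment> \<open>Write y = (S - \<mu>) x and choose k in \<open>K\<close> close to x. Then y =
      (S x - \<mu> k) - \<mu> (x - k), where \<mu> k lies in S M because S maps \<open>K\<close>
      onto itself, and the last term is small.\<close>
    have half: "\<exists>s\<in>S ` M. \<exists>y'\<in>M. y = s + y' \<and> norm y' \<le> norm y / 2" if y: "y \<in> M" for y
    proof -
      obtain x where x: "x \<in> M" "y = shift S \<mu> x" using y bij by (metis bij_betw_def imageE)
      have ne: "K \<noteq> {}" using cvs.subspace_0[OF subK] by auto
      define d where "d = infdist x K"
      have d0: "d \<ge> 0" by (simp add: d_def infdist_nonneg)
      have "\<exists>k\<in>K. norm (x - k) \<le> 4 * C0 * norm y"
      proof (cases "d = 0")
        case True
        then have "x \<in> K" using in_closed_iff_infdist_zero[OF clK ne] by (simp add: d_def)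
        then show ?thesis using C0 by (intro bexI[of _ x]) auto
      next
        case False
        then have "d < 2 * d" using d0 by simp
        then obtain k where kk: "k \<in> K" "dist x k < 2 * d"
          using ne unfolding d_def infdist_def by (auto simp: cINF_less_iff)
        have "S k - scaleC \<mu> k \<in> K" using SK kk subK by (intro cvs.subspace_diff cvs.subspace_scale) auto
        \<comment> \<open>Correcting x - k by k3 gives S (x - k + k3) = y + \<mu> (x - k). A short
          preimage z of this vector differs from x - k + k3 by a kernel vector, so x - z lies in
          \<open>K\<close> and d \<le> norm z. As norm (x - k) < 2 d, the term with \<mu> is
          absorbed into d.\<close>
        then obtain k3 where k3: "k3 \<in> K" "S k3 = S k - scaleC \<mu> k" using SK by (metis imageE)
        have w: "x - k + k3 \<in> M" using x kk k3 KM M by (intro cvs.subspace_add cvs.subspace_diff) auto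
        have Sw: "S (x - k + k3) = y + scaleC \<mu> (x - k)"
          using x k3 by (simp add: bounded_op_simps[OF S] bounded_opD[OF S] shift_def cvs.scale_right_diff_distrib)
        obtain z where z: "z \<in> M" "S z = S (x - k + k3)" "norm z \<le> C0 * norm (S (x - k + k3))"
          using C0(2) w by blast
        have "x - k + k3 - z \<in> K"
          using kerK w z M(1) by (auto simp: ker_on_def bounded_op_simps[OF S] bounded_opD[OF S] cvs.subspace_diff)
        then have "(x - k + k3 - z) + (k - k3) \<in> K"
          using cvs.subspace_add[OF subK _ cvs.subspace_diff[OF subK kk(1) k3(1)]] by blast
        then have "x - z \<in> K" by simp
        then have "d \<le> dist x (x - z)" unfolding d_def by (rule infdist_le)
        then have "d \<le> norm z" by (simp add: dist_norm)
        also have "\<dots> \<le> C0 * norm (y + scaleC \<mu> (x - k))" using z Sw by simp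
        also have "\<dots> \<le> C0 * (norm y + cmod \<mu> * (2 * d))"
        proof (intro mult_left_mono)
          have "norm (scaleC \<mu> (x - k)) \<le> cmod \<mu> * (2 * d)"
            using kk by (simp add: norm_scaleC dist_norm mult_left_mono)
          then show "norm (y + scaleC \<mu> (x - k)) \<le> norm y + cmod \<mu> * (2 * d)"
            using norm_triangle_ineq[of y "scaleC \<mu> (x - k)"] by linarith
        qed (use C0 in simp)
        also have "\<dots> = C0 * norm y + (2 * C0 * cmod \<mu>) * d" by (simp add: algebra_simps)
        also have "\<dots> \<le> C0 * norm y + (1/2) * d"
          using mu0 d0 by (intro add_left_mono mult_right_mono) auto
        finally have "2 * d \<le> 4 * C0 * norm y" by simp
        then have "norm (x - k) \<le> 4 * C0 * norm y" using kk by (simp add: dist_norm)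
        then show ?thesis using kk by blast
      qed
      then obtain k where kk: "k \<in> K" "norm (x - k) \<le> 4 * C0 * norm y" by blast
      have "scaleC \<mu> k \<in> K" using kk subK by (intro cvs.subspace_scale)
      then have muk: "scaleC \<mu> k \<in> S ` M" using SK KM by blast
      let ?y' = "- scaleC \<mu> (x - k)"
      have "y = (S x - scaleC \<mu> k) + ?y'" using x by (simp add: shift_def cvs.scale_right_diff_distrib)
      moreover have "S x - scaleC \<mu> k \<in> S ` M"
        using muk x subspace_image_op[OF S M(1)] by (intro cvs.subspace_diff) auto
      moreover have "?y' \<in> M" using x kk KM M by (intro cvs.subspace_neg cvs.subspace_scale cvs.subspace_diff) auto
      moreover have "norm ?y' \<le> norm y / 2"
      proof -
        have "norm ?y' \<le> cmod \<mu> * (4 * C0 * norm y)"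
          using kk by (simp add: norm_scaleC mult_left_mono)
        also have "\<dots> = (4 * C0 * cmod \<mu>) * norm y" by simp
        also have "\<dots> \<le> (1/2) * norm y" using mu0 by (intro mult_right_mono) auto
        finally show ?thesis by simp
      qed
      ultimately show ?thesis by blast
    qed
    have approx: "\<exists>s\<in>S ` M. \<exists>y'\<in>M. y = s + y' \<and> norm y' \<le> (1/2) ^ n * norm y" if y: "y \<in> M" for y n
    proof (induction n)
      case 0
      have "0 \<in> S ` M" using subspace_image_op[OF S M(1)] by (rule cvs.subspace_0)
      then show ?case using y by (intro bexI[of _ 0] bexI[of _ y]) auto
    next
      case (Suc n)
      then obtain s y' where a: "s \<in> S ` M" "y' \<in> M" "y = s + y'" "norm y' \<le> (1/2) ^ n * norm y" by blast
      obtain s2 y2 where b: "s2 \<in> S ` M" "y2 \<in> M" "y' = s2 + y2" "norm y2 \<le> norm y' / 2"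
        using half[OF a(2)] by blast
      have "s + s2 \<in> S ` M" using a b subspace_image_op[OF S M(1)] by (intro cvs.subspace_add)
      moreover have "y = (s + s2) + y2" using a b by simp
      moreover have "norm y2 \<le> (1/2) ^ Suc n * norm y" using a b by simp
      ultimately show ?case using b(2) by blast
    qed
    have "y \<in> S ` M" if y: "y \<in> M" for y
    proof -
      have "\<exists>s. s \<in> S ` M \<and> norm (y - s) \<le> (1/2) ^ n * norm y" for n
        using approx[OF y, of n] by (metis add_diff_cancel_left')
      then obtain s where s: "\<And>n. s n \<in> S ` M" "\<And>n. norm (y - s n) \<le> (1/2) ^ n * norm y" by metis
      have "(\<lambda>n. (1/2::real) ^ n * norm y) \<longlonglongrightarrow> 0 * norm y" by (intro tendsto_intros) auto
      then have "(\<lambda>n. y - s n) \<longlonglongrightarrow> 0"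
        using Lim_null_comparison[of "\<lambda>n. y - s n" "\<lambda>n. (1/2) ^ n * norm y" sequentially] s(2) by simp
      then have "(\<lambda>n. y - (y - s n)) \<longlonglongrightarrow> y - 0" by (intro tendsto_diff tendsto_const)
      then have "s \<longlonglongrightarrow> y" by simp
      then show ?thesis by (rule closed_sequentially[OF clSM s(1)])
    qed
    then show ?thesis using inj M(3) by (auto simp: bij_betw_def)
  qed
  then show ?thesis using that eps by blast
qed

text \<open>If A (m + n) lies in M, then A n lies in M \<inter> N and vanishes, so m alone is
  already a preimage.\<close>

lemma bij_betw_summand:
  assumes A: "bounded_op A" and bij: "bij A" and M: "cvs.subspace M" "A ` M \<subseteq> M"
    and N: "A ` N \<subseteq> N" and d: "direct_sum M N"
  shows "bij_betw A M M"
proof -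
  have "y \<in> A ` M" if y: "y \<in> M" for y
  proof -
    obtain x where x: "y = A x" using bij by (metis bij_def surjD)
    obtain m n where mn: "m \<in> M" "n \<in> N" "x = m + n" using d unfolding direct_sum_def by blast
    have "A n = y - A m" using x mn by (simp add: bounded_opD[OF A])
    moreover have "y - A m \<in> M" using y mn M by (intro cvs.subspace_diff) auto
    ultimately have "A n \<in> M \<inter> N" using mn N by auto
    then have "A n = 0" using d by (auto simp: direct_sum_def)
    then show ?thesis using x mn by (auto simp: bounded_opD[OF A])
  qed
  moreover have "inj_on A M" using bij by (meson bij_def inj_on_subset subset_UNIV)
  ultimately show ?thesis using M by (auto simp: bij_betw_def)
qed

lemma bij_betw_range_funpow:
  assumes S: "bounded_op S" and bij: "bij (shift S \<mu>)"
  shows "bij_betw (shift S \<mu>) (range (S ^^ n)) (range (S ^^ n))"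
proof -
  have "shift S \<mu> ` range (S ^^ n) = (S ^^ n) ` range (shift S \<mu>)"
    by (simp add: image_image shift_funpow_commute[OF S])
  also have "range (shift S \<mu>) = UNIV" using bij by (simp add: bij_def)
  finally have "shift S \<mu> ` range (S ^^ n) = range (S ^^ n)" .
  moreover have "inj_on (shift S \<mu>) (range (S ^^ n))" using bij by (meson bij_def inj_on_subset subset_UNIV)
  ultimately show ?thesis by (simp add: bij_betw_def)
qed

section \<open>Browder operators near the resolvent set\<close>

text \<open>The space splits as R(S^n) and N(S^n), with S invertible on the former and nilpotent on
  the finite-dimensional latter. For bounded S this is \<open>Browder\<close> in a form that can be
  restricted and perturbed.\<close>

definition core_nilpotent :: "('a::complex_banach \<Rightarrow> 'a) \<Rightarrow> bool" where
  "core_nilpotent S \<longleftrightarrow> (\<exists>n. bij_betw S (range (S ^^ n)) (range (S ^^ n)) \<and> cfin_dim (ker_on UNIV (S ^^ n)))"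

definition resolvent :: "('a::complex_banach \<Rightarrow> 'a) \<Rightarrow> complex set" where
  "resolvent T = {\<mu>. bij (shift T \<mu>)}"

text \<open>A common consequence of membership in any of the nine classes whose spectra appear in
  (v).\<close>

definition semi_fredholm_like :: "('a::complex_banach \<Rightarrow> 'a) \<Rightarrow> bool" where
  "semi_fredholm_like S \<longleftrightarrow> Phi_plus S \<or> Phi_minus S \<or> essentially_kato S"

lemma range_funpow_Suc: "range (S ^^ Suc n) = S ` range (S ^^ n)"
  by (simp add: image_comp)

text \<open>S^n is bijective on its own range, so S^n x = S^n r for some r in the range, and x - r
  lies in the kernel.\<close>

lemma direct_sum_range_ker:
  assumes S: "bounded_op S" and bij: "bij_betw S (range (S ^^ n)) (range (S ^^ n))"
  shows "direct_sum (range (S ^^ n)) (ker_on UNIV (S ^^ n))"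
proof -
  note Sn = bounded_op_funpow[OF S, of n]
  have b: "bij_betw (S ^^ n) (range (S ^^ n)) (range (S ^^ n))" using bij by (rule bij_betw_funpow)
  have "range (S ^^ n) \<inter> ker_on UNIV (S ^^ n) = ker_on (range (S ^^ n)) (S ^^ n)" by (auto simp: ker_on_def)
  also have "\<dots> = {0}"
    using inj_on_subspace_iff[OF Sn subspace_range_op[OF Sn]] b by (auto simp: bij_betw_def)
  finally have "range (S ^^ n) \<inter> ker_on UNIV (S ^^ n) = {0}" .
  moreover have "\<exists>r\<in>range (S ^^ n). \<exists>k\<in>ker_on UNIV (S ^^ n). x = r + k" for x
  proof -
    have "(S ^^ n) x \<in> (S ^^ n) ` range (S ^^ n)" using b by (simp add: bij_betw_def)
    then obtain r where r: "r \<in> range (S ^^ n)" "(S ^^ n) x = (S ^^ n) r" by blast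
    then have "x - r \<in> ker_on UNIV (S ^^ n)" by (simp add: ker_on_def bounded_op_simps[OF Sn])
    then show ?thesis using r by (intro bexI[of _ r] bexI[of _ "x - r"]) auto
  qed
  ultimately show ?thesis by (auto simp: direct_sum_def)
qed

lemma fin_codim_of_direct_sum:
  assumes "direct_sum R N" "cfin_dim N" shows "fin_codim UNIV R"
proof -
  obtain B where B: "finite B" "N \<subseteq> cvs.span B" using assms(2) by (rule cfin_dimE)
  have "\<exists>r\<in>R. \<exists>f\<in>cvs.span B. x = r + f" for x
    using assms(1) B(2) unfolding direct_sum_def by blast
  then show ?thesis using B(1) by (auto simp: fin_codim_UNIV_iff)
qed

lemma core_nilpotent_imp_Browder:
  assumes S: "bounded_op S" and c: "core_nilpotent S" shows "Browder S"
proof -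
  obtain n where n: "bij_betw S (range (S ^^ n)) (range (S ^^ n))" "cfin_dim (ker_on UNIV (S ^^ n))"
    using c by (auto simp: core_nilpotent_def)
  have Rn: "S ` range (S ^^ n) = range (S ^^ n)" using n by (simp add: bij_betw_def)
  have z: "(S ^^ m) 0 = 0" for m using bounded_op_simps(1)[OF bounded_op_funpow[OF S]] .
  have "fin_codim UNIV (range (S ^^ n))"
    by (rule fin_codim_of_direct_sum[OF direct_sum_range_ker[OF S n(1)] n(2)])
  moreover have "range (S ^^ n) \<subseteq> range S" using Rn by blast
  ultimately have fc: "fin_codim UNIV (range S)" unfolding fin_codim_UNIV_iff by (meson subsetD)
  have asc: "x \<in> ker_on UNIV (S ^^ n)" if "x \<in> ker_on UNIV (S ^^ Suc n)" for x
  proof -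
    have "S ((S ^^ n) x) = S ((S ^^ n) 0)" using that by (simp add: ker_on_def z bounded_op_simps[OF S])
    then have "(S ^^ n) x = (S ^^ n) 0" using n(1) by (meson bij_betw_def inj_onD rangeI)
    then show ?thesis by (simp add: ker_on_def z)
  qed
  have "ker_on UNIV (S ^^ n) \<subseteq> ker_on UNIV (S ^^ Suc n)" by (auto simp: ker_on_def bounded_op_simps[OF S])
  then have fa: "finite_ascent S" using asc unfolding finite_ascent_def by blast
  have fd: "finite_descent S" using Rn unfolding finite_descent_def range_funpow_Suc by metis
  have "ker_on UNIV S \<subseteq> ker_on UNIV (S ^^ Suc n)"
    by (auto simp: ker_on_def funpow_swap1 z)
  then have "ker_on UNIV S \<subseteq> ker_on UNIV (S ^^ n)" using asc by blast
  then have "cfin_dim (ker_on UNIV S)" using n(2) cfin_dim_subset by blast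
  then show ?thesis
    using fa fd fc closed_range_of_fin_codim[OF S fc]
    by (simp add: Browder_def Phi_def Phi_plus_def Phi_minus_def upper_fredholm_on_def lower_fredholm_on_def)
qed

lemma cfin_dim_ker_funpow:
  assumes S: "bounded_op S" and k: "cfin_dim (ker_on UNIV S)"
  shows "cfin_dim (ker_on UNIV (S ^^ n))"
proof (induction n)
  case 0
  show ?case by (rule cfin_dimI[of "{}"]) (auto simp: ker_on_def)
next
  case (Suc n)
  show ?case using cfin_dim_ker_compose[OF bounded_op_funpow[OF S] k Suc] by (simp add: o_def)
qed

lemma Browder_imp_core_nilpotent:
  assumes S: "bounded_op S" and B: "Browder S" shows "core_nilpotent S"
proof -
  obtain p where p: "ker_on UNIV (S ^^ p) = ker_on UNIV (S ^^ Suc p)"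
    using B by (auto simp: Browder_def finite_ascent_def)
  obtain q where q: "range (S ^^ q) = range (S ^^ Suc q)"
    using B by (auto simp: Browder_def finite_descent_def)
  \<comment> \<open>The sum is convenient because S^p applied to the descent equation at q
    stabilizes the range, while S^q u is a vector to which the ascent equation at p applies.\<close>
  define n where "n = p + q"
  have "S ` range (S ^^ n) = range (S ^^ n)"
  proof -
    have "range (S ^^ (p + k)) = (S ^^ p) ` range (S ^^ k)" for k by (simp add: funpow_add image_comp)
    then have "range (S ^^ (p + Suc q)) = range (S ^^ n)" unfolding n_def using q by metis
    then show ?thesis unfolding n_def range_funpow_Suc[symmetric] by simp
  qed
  moreover have "inj_on S (range (S ^^ n))"
  proof -
    have "x = 0" if x: "x \<in> ker_on (range (S ^^ n)) S" for x
    proof -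
      obtain u where u: "x = (S ^^ n) u" "S ((S ^^ n) u) = 0" using x by (auto simp: ker_on_def)
      then have "(S ^^ q) u \<in> ker_on UNIV (S ^^ Suc p)" by (simp add: ker_on_def n_def funpow_add)
      then have "(S ^^ q) u \<in> ker_on UNIV (S ^^ p)" using p by simp
      then show ?thesis using u by (simp add: ker_on_def n_def funpow_add)
    qed
    moreover have "0 \<in> ker_on (range (S ^^ n)) S"
      using cvs.subspace_0[OF subspace_ker_on[OF S subspace_range_op[OF bounded_op_funpow[OF S]]]] .
    ultimately show ?thesis
      using inj_on_subspace_iff[OF S subspace_range_op[OF bounded_op_funpow[OF S]], of n] by blast
  qed
  moreover have "cfin_dim (ker_on UNIV (S ^^ n))"
    using B by (intro cfin_dim_ker_funpow S) (simp add: Browder_def Phi_def Phi_plus_def upper_fredholm_on_def)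
  ultimately show ?thesis unfolding core_nilpotent_def bij_betw_def by blast
qed

lemma bij_of_summands:
  assumes A: "bounded_op A" and d: "direct_sum M N" and M: "cvs.subspace M" and N: "cvs.subspace N"
    and b: "bij_betw A M M" "bij_betw A N N"
  shows "bij A"
proof -
  have "x = 0" if x: "A x = 0" for x
  proof -
    obtain m n where mn: "m \<in> M" "n \<in> N" "x = m + n" using d unfolding direct_sum_def by blast
    have Amn: "A m \<in> M" "A n \<in> N" using b mn by (auto simp: bij_betw_def)
    have "A m = - A n" using x mn by (simp add: bounded_opD[OF A] eq_neg_iff_add_eq_0)
    then have "A m \<in> M \<inter> N" using Amn N cvs.subspace_neg by simp
    then have "A m = 0" using d unfolding direct_sum_def by blast
    moreover have "A n = 0" using \<open>A m = - A n\<close> \<open>A m = 0\<close> by simp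
    ultimately have "m \<in> ker_on M A" "n \<in> ker_on N A" using mn by (auto simp: ker_on_def)
    then show ?thesis
      using inj_on_subspace_iff[OF A M] inj_on_subspace_iff[OF A N] b mn by (auto simp: bij_betw_def)
  qed
  then have "ker_on UNIV A = {0}" using bounded_op_simps(1)[OF A] by (auto simp: ker_on_def)
  then have "inj A" using inj_on_subspace_iff[OF A cvs.subspace_UNIV] by simp
  moreover have "y \<in> range A" for y
  proof -
    obtain m n where mn: "m \<in> M" "n \<in> N" "y = m + n" using d unfolding direct_sum_def by blast
    have "m \<in> A ` M" "n \<in> A ` N" using b mn by (auto simp: bij_betw_def)
    then obtain m' n' where "m = A m'" "n = A n'" by blast
    then have "y = A (m' + n')" using mn by (simp add: bounded_opD[OF A])
    then show ?thesis by blast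
  qed
  ultimately show ?thesis by (auto simp: bij_def)
qed

text \<open>S is nilpotent on N(S^n), so a nonzero shift is invertible there. Surjectivity goes by
  induction on n.\<close>

lemma bij_betw_shift_ker_funpow:
  assumes S: "bounded_op S" and mu: "\<mu> \<noteq> 0"
  shows "bij_betw (shift S \<mu>) (ker_on UNIV (S ^^ n)) (ker_on UNIV (S ^^ n))"
proof -
  let ?N = "\<lambda>n. ker_on UNIV (S ^^ n)"
  have subN: "cvs.subspace (?N n)" for n by (intro subspace_ker_on bounded_op_funpow S) simp
  have SN: "S x \<in> ?N n" if "x \<in> ?N (Suc n)" for x n using that by (simp add: ker_on_def funpow_swap1)
  have mono: "?N n \<subseteq> ?N (Suc n)" for n by (auto simp: ker_on_def bounded_op_simps[OF S])
  have into: "shift S \<mu> x \<in> ?N n" if "x \<in> ?N n" for x n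
    using shift_in_subspace[OF subN[of n], of S x \<mu>] SN[of x n] mono[of n] that by blast
  have "x = 0" if x: "x \<in> ker_on (?N n) (shift S \<mu>)" for x
  proof -
    have "S x = scaleC \<mu> x" using x by (simp add: ker_on_def shift_def)
    then have "(S ^^ k) x = scaleC (\<mu> ^ k) x" for k
      by (induction k) (simp_all add: scaleC_one bounded_opD[OF S] scaleC_scaleC mult.commute)
    then have "scaleC (\<mu> ^ n) x = 0" using x by (simp add: ker_on_def)
    then show ?thesis using mu by simp
  qed
  then have "ker_on (?N n) (shift S \<mu>) = {0}"
    using cvs.subspace_0[OF subspace_ker_on[OF bounded_op_shift[OF S] subN]] by blast
  then have "inj_on (shift S \<mu>) (?N n)" using inj_on_subspace_iff[OF bounded_op_shift[OF S] subN] by blast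
  moreover have "\<exists>z\<in>?N n. shift S \<mu> z = x" if "x \<in> ?N n" for x
    using that
  proof (induction n arbitrary: x)
    case 0
    then show ?case using bounded_op_simps(1)[OF bounded_op_shift[OF S]] by (auto simp: ker_on_def)
  next
    case (Suc n)
    \<comment> \<open>S x lies one kernel lower. From (S - \<mu>) z = S x follows (S - \<mu>) (z -
      x) = \<mu> x.\<close>
    obtain z where z: "z \<in> ?N n" "shift S \<mu> z = S x" using Suc.IH[OF SN[OF Suc.prems]] by blast
    have zx: "scaleC (1/\<mu>) (z - x) \<in> ?N (Suc n)"
      by (intro cvs.subspace_scale cvs.subspace_diff subN) (use z(1) mono[of n] Suc.prems in blast)+
    have "shift S \<mu> (z - x) = scaleC \<mu> x"
      using z(2) by (simp add: shift_diff[OF S]) (simp add: shift_def)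
    then have "shift S \<mu> (scaleC (1/\<mu>) (z - x)) = x"
      using mu by (simp add: bounded_opD[OF bounded_op_shift[OF S]] scaleC_scaleC scaleC_one)
    then show ?case using zx by blast
  qed
  ultimately show ?thesis using into by (auto simp: bij_betw_def)
qed

text \<open>Smallness of \<mu> keeps the shift bijective on the range summand, and \<mu> \<noteq> 0
  makes it bijective on the nilpotent summand.\<close>

lemma core_nilpotent_punctured:
  assumes S: "bounded_op S" and c: "core_nilpotent S"
  obtains \<epsilon> where "\<epsilon> > 0" "\<And>\<mu>. \<mu> \<noteq> 0 \<Longrightarrow> cmod \<mu> < \<epsilon> \<Longrightarrow> bij (shift S \<mu>)"
proof -
  obtain n where n: "bij_betw S (range (S ^^ n)) (range (S ^^ n))" "cfin_dim (ker_on UNIV (S ^^ n))"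
    using c by (auto simp: core_nilpotent_def)
  note Sn = bounded_op_funpow[OF S, of n]
  note d = direct_sum_range_ker[OF S n(1)]
  have "closed (range (S ^^ n))"
    by (rule closed_range_of_fin_codim[OF Sn fin_codim_of_direct_sum[OF d n(2)]])
  then obtain \<epsilon> where e: "\<epsilon> > 0"
    "\<And>\<mu>. cmod \<mu> < \<epsilon> \<Longrightarrow> bij_betw (shift S \<mu>) (range (S ^^ n)) (range (S ^^ n))"
    using bij_betw_shift[OF S subspace_range_op[OF Sn] _ n(1)] by blast
  have "bij (shift S \<mu>)" if "\<mu> \<noteq> 0" "cmod \<mu> < \<epsilon>" for \<mu>
    using bij_of_summands[OF bounded_op_shift[OF S] d subspace_range_op[OF Sn]
        subspace_ker_on[OF Sn cvs.subspace_UNIV] e(2)[OF that(2)] bij_betw_shift_ker_funpow[OF S that(1)]] .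
  then show ?thesis using that e(1) by blast
qed

text \<open>The assumption \<open>stable\<close> says that the kernel of S restricted to R(S^n) lies
  in the ranges of all powers of that restriction, so the restriction is Kato; \<open>near\<close>
  supplies the bijective small shifts.\<close>

lemma bij_betw_range_of_kato:
  assumes S: "bounded_op S" and near: "\<And>\<epsilon>. \<epsilon> > 0 \<Longrightarrow> \<exists>\<mu>. cmod \<mu> < \<epsilon> \<and> bij (shift S \<mu>)"
    and cl: "closed (range (S ^^ n))" "closed (range (S ^^ Suc n))"
    and stable: "\<And>m. m \<ge> n \<Longrightarrow> ker_on UNIV S \<inter> range (S ^^ n) \<subseteq> range (S ^^ m)"
  shows "bij_betw S (range (S ^^ n)) (range (S ^^ n))"
proof -
  let ?R = "range (S ^^ n)"
  have "S ` ?R \<subseteq> ?R" by (auto simp: funpow_swap1)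
  moreover have "kato_on ?R S"
  proof -
    have "ker_on ?R S \<subseteq> (S ^^ k) ` ?R" for k
    proof -
      have "ker_on ?R S \<subseteq> ker_on UNIV S \<inter> ?R" by (auto simp: ker_on_def)
      also have "\<dots> \<subseteq> range (S ^^ (k + n))" by (rule stable) simp
      also have "\<dots> = (S ^^ k) ` ?R" by (simp add: funpow_add image_comp)
      finally show ?thesis .
    qed
    then show ?thesis using cl(2) unfolding kato_on_def range_funpow_Suc by blast
  qed
  ultimately obtain \<epsilon> where e: "\<epsilon> > 0"
    "\<And>\<mu>. cmod \<mu> < \<epsilon> \<Longrightarrow> bij_betw (shift S \<mu>) ?R ?R \<Longrightarrow> bij_betw S ?R ?R"
    using kato_bij_of_shift_bij[OF S subspace_range_op[OF bounded_op_funpow[OF S]] cl(1)] by metis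
  obtain \<mu> where "cmod \<mu> < \<epsilon>" "bij (shift S \<mu>)" using near[OF e(1)] by blast
  then show ?thesis using e(2) bij_betw_range_funpow[OF S] by blast
qed

text \<open>The spaces N(S) \<inter> R(S^n) decrease inside the finite-dimensional kernel, so they
  become stationary; this is the stability required of the restriction to R(S^n).\<close>

lemma core_nilpotent_of_Phi_plus:
  assumes S: "bounded_op S" and near: "\<And>\<epsilon>. \<epsilon> > 0 \<Longrightarrow> \<exists>\<mu>. cmod \<mu> < \<epsilon> \<and> bij (shift S \<mu>)"
    and P: "Phi_plus S"
  shows "core_nilpotent S"
proof -
  have k: "cfin_dim (ker_on UNIV S)" and cl1: "closed (range S)"
    using P by (auto simp: Phi_plus_def upper_fredholm_on_def)
  obtain B where B: "finite B" "B \<subseteq> ker_on UNIV S" "ker_on UNIV S \<subseteq> cvs.span B" using k by (rule cfin_dimE)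
  have spB: "cvs.span B \<subseteq> ker_on UNIV S" using B(2) subspace_ker_on[OF S cvs.subspace_UNIV] by (rule cvs.span_minimal)
  have cl: "closed (range (S ^^ n))" for n
  proof (induction n)
    case (Suc n)
    define V where "V = range (S ^^ n)"
    \<comment> \<open>Adding the finite-dimensional kernel keeps R(S^n) closed and does not change
      its image under S, but makes \<open>closed_image_of_kernel_subset\<close> applicable.\<close>
    define W where "W = {v + f |v f. v \<in> V \<and> f \<in> cvs.span B}"
    have V: "cvs.subspace V" "closed V" unfolding V_def using Suc subspace_range_op[OF bounded_op_funpow[OF S]] by auto
    have "cvs.subspace W" unfolding W_def by (intro cvs.subspace_sums V cvs.subspace_span)
    moreover have "closed W" unfolding W_def by (rule closed_subspace_add_span[OF V B(1)])
    moreover have "ker_on UNIV S \<subseteq> W"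
      unfolding W_def using B(3) cvs.subspace_0[OF V(1)] by force
    ultimately have "closed (S ` W)"
      using closed_image_of_kernel_subset[OF S cvs.subspace_UNIV _ cl1] by simp
    moreover have "S ` W = S ` V"
    proof
      show "S ` W \<subseteq> S ` V" using spB by (force simp: W_def ker_on_def bounded_opD[OF S])
      have "V \<subseteq> W" unfolding W_def using cvs.span_zero[of B] by force
      then show "S ` V \<subseteq> S ` W" by blast
    qed
    ultimately show ?case unfolding range_funpow_Suc V_def by simp
  qed simp
  obtain n where n: "\<And>m. m \<ge> n \<Longrightarrow> ker_on UNIV S \<inter> range (S ^^ m) = ker_on UNIV S \<inter> range (S ^^ n)"
  proof (rule decseq_subspaces_stationary)
    show "cvs.subspace (ker_on UNIV S \<inter> range (S ^^ n))" for n
      by (intro cvs.subspace_inter subspace_ker_on subspace_range_op bounded_op_funpow S cvs.subspace_UNIV)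
    show "ker_on UNIV S \<inter> range (S ^^ Suc n) \<subseteq> ker_on UNIV S \<inter> range (S ^^ n)" for n
      by (auto simp: funpow_swap1)
    show "cfin_dim (ker_on UNIV S \<inter> range (S ^^ 0))" using k by simp
  qed blast
  have "bij_betw S (range (S ^^ n)) (range (S ^^ n))"
    by (rule bij_betw_range_of_kato[OF S near cl cl]) (use n in blast)+
  then show ?thesis unfolding core_nilpotent_def using cfin_dim_ker_funpow[OF S k] by blast
qed

text \<open>The N-components, along R, of a finite set that spans modulo R span N.\<close>

lemma cfin_dim_of_direct_sum:
  assumes d: "direct_sum R N" and R: "cvs.subspace R" and N: "cvs.subspace N" and c: "fin_codim UNIV R"
  shows "cfin_dim N"
proof -
  obtain B where B: "finite B" "\<And>x. \<exists>r\<in>R. \<exists>f\<in>cvs.span B. x = r + f"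
    using c by (auto simp: fin_codim_UNIV_iff)
  have "\<exists>n. n \<in> N \<and> b - n \<in> R" for b
    using d unfolding direct_sum_def by (metis add_diff_cancel_right')
  then obtain \<pi> where pi: "\<And>b. \<pi> b \<in> N" "\<And>b. b - \<pi> b \<in> R" by metis
  show ?thesis
  proof (rule cfin_dimI[of "\<pi> ` B"])
    show "N \<subseteq> cvs.span (\<pi> ` B)"
    proof
      fix x assume x: "x \<in> N"
      obtain r f where rf: "r \<in> R" "f \<in> cvs.span B" "x = r + f" using B(2) by blast
      obtain c where c: "f = (\<Sum>b\<in>B. scaleC (c b) b)" using rf(2) unfolding cvs.span_finite[OF B(1)] by auto
      define y where "y = (\<Sum>b\<in>B. scaleC (c b) (\<pi> b))"
      have y: "y \<in> cvs.span (\<pi> ` B)"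
        unfolding y_def by (intro cvs.span_sum cvs.span_scale cvs.span_base) auto
      have yN: "y \<in> N" unfolding y_def by (intro cvs.subspace_sum N cvs.subspace_scale pi)
      have "x - y = r + (\<Sum>b\<in>B. scaleC (c b) (b - \<pi> b))"
        by (simp add: rf c y_def cvs.scale_right_diff_distrib sum_subtractf)
      also have "\<dots> \<in> R" by (intro cvs.subspace_add R rf cvs.subspace_sum cvs.subspace_scale pi)
      finally have "x - y \<in> R \<inter> N" using x yN N by (simp add: cvs.subspace_diff)
      then have "x - y = 0" using d unfolding direct_sum_def by blast
      then have "x = y" by simp
      then show "x \<in> cvs.span (\<pi> ` B)" using y by simp
    qed
  qed (use B in simp)
qed

lemma fin_codim_range_funpow:
  assumes S: "bounded_op S" and c: "fin_codim UNIV (range S)"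
  shows "fin_codim UNIV (range (S ^^ n))"
proof (induction n)
  case 0
  show ?case unfolding fin_codim_UNIV_iff by (rule exI[of _ "{}"]) auto
next
  case (Suc n)
  show ?case using fin_codim_range_compose[OF S c Suc] by (simp add: o_def)
qed

text \<open>The kernel may a priori be infinite-dimensional, so stability is read off the increasing
  spaces R(S) + N(S^n), which finite codimension of R(S) makes stationary. Finite dimension of
  N(S^n) comes out only at the end, from the splitting.\<close>

lemma core_nilpotent_of_Phi_minus:
  assumes S: "bounded_op S" and near: "\<And>\<epsilon>. \<epsilon> > 0 \<Longrightarrow> \<exists>\<mu>. cmod \<mu> < \<epsilon> \<and> bij (shift S \<mu>)"
    and P: "Phi_minus S"
  shows "core_nilpotent S"
proof -
  have c: "fin_codim UNIV (range S)" using P by (simp add: Phi_minus_def lower_fredholm_on_def)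
  note cn = fin_codim_range_funpow[OF S c]
  have cl: "closed (range (S ^^ n))" for n by (rule closed_range_of_fin_codim[OF bounded_op_funpow[OF S] cn])
  obtain B where B: "finite B" "\<And>x. \<exists>r\<in>range S. \<exists>f\<in>cvs.span B. x = r + f"
    using c by (auto simp: fin_codim_UNIV_iff)
  note sR = subspace_range_op[OF S]
  define W where "W n = {r + k |r k. r \<in> range S \<and> k \<in> ker_on UNIV (S ^^ n)}" for n
  have subN: "cvs.subspace (ker_on UNIV (S ^^ n))" for n by (intro subspace_ker_on bounded_op_funpow S cvs.subspace_UNIV)
  have subW: "cvs.subspace (W n)" for n unfolding W_def by (intro cvs.subspace_sums sR subN)
  have RW: "range S \<subseteq> W n" for n unfolding W_def using cvs.subspace_0[OF subN[of n]] by force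
  have NW: "ker_on UNIV (S ^^ n) \<subseteq> W n" for n unfolding W_def using cvs.subspace_0[OF sR] by force
  have "ker_on UNIV (S ^^ n) \<subseteq> ker_on UNIV (S ^^ Suc n)" for n by (auto simp: ker_on_def bounded_op_simps[OF S])
  then have monoW: "W n \<subseteq> W (Suc n)" for n unfolding W_def by blast
  \<comment> \<open>Each \<open>W m\<close> contains the range of S, and \<open>B\<close> spans the
    space modulo that range, so \<open>W m\<close> is determined by its trace on the
    finite-dimensional span of \<open>B\<close>.\<close>
  obtain n where n: "\<And>m. m \<ge> n \<Longrightarrow> W m \<inter> cvs.span B = W n \<inter> cvs.span B"
  proof (rule incseq_subspaces_stationary)
    show "cvs.subspace (W n \<inter> cvs.span B)" for n by (intro cvs.subspace_inter subW cvs.subspace_span)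
    show "W n \<inter> cvs.span B \<subseteq> W (Suc n) \<inter> cvs.span B" for n using monoW by blast
    show "W n \<inter> cvs.span B \<subseteq> cvs.span B" for n by blast
    show "cfin_dim (cvs.span B)" by (rule cfin_dim_span[OF B(1)])
  qed blast
  have Wn: "W m \<subseteq> W n" if m: "m \<ge> n" for m
  proof
    fix x assume x: "x \<in> W m"
    obtain r f where rf: "r \<in> range S" "f \<in> cvs.span B" "x = r + f" using B(2) by blast
    have "x - r \<in> W m" using x rf RW by (intro cvs.subspace_diff[OF subW]) auto
    then have "f \<in> W m \<inter> cvs.span B" using rf by simp
    then have "f \<in> W n" using n[OF m] by blast
    then show "x \<in> W n" using rf RW by (auto intro: cvs.subspace_add[OF subW])
  qed
  \<comment> \<open>If y = S^m x and S y = 0, then x lies in \<open>W (Suc m)\<close>, hence in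
    \<open>W m\<close>. So x = S z + u with S^m u = 0, and y = S^(m+1) z.\<close>
  have step: "ker_on UNIV S \<inter> range (S ^^ m) \<subseteq> range (S ^^ Suc m)" if m: "m \<ge> n" for m
  proof
    fix y assume y: "y \<in> ker_on UNIV S \<inter> range (S ^^ m)"
    then obtain x where x: "y = (S ^^ m) x" "S ((S ^^ m) x) = 0" by (auto simp: ker_on_def)
    then have "x \<in> W (Suc m)" using NW[of "Suc m"] by (auto simp: ker_on_def)
    moreover have "W n \<subseteq> W m" using lift_Suc_mono_le[of W, OF monoW m] .
    ultimately have "x \<in> W m" using Wn[of "Suc m"] m by auto
    then obtain z u where "x = S z + u" "(S ^^ m) u = 0" by (auto simp: W_def ker_on_def)
    then have "y = (S ^^ Suc m) z" using x by (simp add: bounded_opD[OF bounded_op_funpow[OF S]] funpow_swap1)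
    then show "y \<in> range (S ^^ Suc m)" by blast
  qed
  have stable: "ker_on UNIV S \<inter> range (S ^^ n) \<subseteq> range (S ^^ m)" if "m \<ge> n" for m
    using that by (induction m rule: dec_induct) (use step in blast)+
  have bij: "bij_betw S (range (S ^^ n)) (range (S ^^ n))"
    by (rule bij_betw_range_of_kato[OF S near cl cl]) (use stable in blast)+
  have "cfin_dim (ker_on UNIV (S ^^ n))"
    by (rule cfin_dim_of_direct_sum[OF direct_sum_range_ker[OF S bij]
        subspace_range_op[OF bounded_op_funpow[OF S]] subN cn])
  then show ?thesis unfolding core_nilpotent_def using bij by blast
qed

text \<open>Bijective shifts of S on the whole space restrict to bijections of the invariant summand
  M. Both the essentially Kato and the gKR decomposition pass through this.\<close>

lemma kato_summand_bij:
  assumes S: "bounded_op S" and near: "\<And>\<epsilon>. \<epsilon> > 0 \<Longrightarrow> \<exists>\<mu>. cmod \<mu> < \<epsilon> \<and> bij (shift S \<mu>)"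
    and M: "cvs.subspace M" "closed M" "S ` M \<subseteq> M" and N: "cvs.subspace N" "S ` N \<subseteq> N"
    and d: "direct_sum M N" and k: "kato_on M S"
  shows "bij_betw S M M"
proof -
  obtain \<epsilon> where e: "\<epsilon> > 0" "\<And>\<mu>. cmod \<mu> < \<epsilon> \<Longrightarrow> bij_betw (shift S \<mu>) M M \<Longrightarrow> bij_betw S M M"
    using kato_bij_of_shift_bij[OF S M k] by blast
  obtain \<mu> where mu: "cmod \<mu> < \<epsilon>" "bij (shift S \<mu>)" using near[OF e(1)] by blast
  have "shift S \<mu> ` V \<subseteq> V" if "cvs.subspace V" "S ` V \<subseteq> V" for V
    using that by (auto intro!: shift_in_subspace)
  then have "bij_betw (shift S \<mu>) M M"
    using M N d by (intro bij_betw_summand[OF bounded_op_shift[OF S] mu(2)]) auto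
  then show ?thesis using e(2)[OF mu(1)] by blast
qed

text \<open>With n the nilpotency exponent on N and S bijective on M, the range of S^n is exactly M
  and its kernel lies in N.\<close>

lemma core_nilpotent_of_essentially_kato:
  assumes S: "bounded_op S" and near: "\<And>\<epsilon>. \<epsilon> > 0 \<Longrightarrow> \<exists>\<mu>. cmod \<mu> < \<epsilon> \<and> bij (shift S \<mu>)"
    and P: "essentially_kato S"
  shows "core_nilpotent S"
proof -
  obtain M N where MN: "cvs.subspace M" "cvs.subspace N" "closed M" "closed N" "S ` M \<subseteq> M" "S ` N \<subseteq> N"
    "direct_sum M N" "cfin_dim N" "kato_on M S" "nilpotent_on N S"
    using P unfolding essentially_kato_def csubspace_eq invariant_def by blast
  obtain n where n: "\<And>x. x \<in> N \<Longrightarrow> (S ^^ n) x = 0" using MN(10) unfolding nilpotent_on_def by blast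
  have bij: "bij_betw S M M" by (rule kato_summand_bij[OF S near MN(1,3,5,2,6,7,9)])
  have bn: "bij_betw (S ^^ n) M M" using bij by (rule bij_betw_funpow)
  note Sn = bounded_op_funpow[OF S, of n]
  have dec: "\<exists>m\<in>M. \<exists>k\<in>N. x = m + k \<and> (S ^^ n) x = (S ^^ n) m" for x
  proof -
    obtain m k where "m \<in> M" "k \<in> N" "x = m + k" using MN(7) unfolding direct_sum_def by blast
    then show ?thesis using n by (intro bexI[of _ m] bexI[of _ k]) (auto simp: bounded_opD[OF Sn])
  qed
  have R: "range (S ^^ n) = M"
  proof
    show "range (S ^^ n) \<subseteq> M"
    proof
      fix y assume "y \<in> range (S ^^ n)"
      then obtain x where x: "y = (S ^^ n) x" by blast
      obtain m where "m \<in> M" "(S ^^ n) x = (S ^^ n) m" using dec by blast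
      then show "y \<in> M" using bn x unfolding bij_betw_def by blast
    qed
    show "M \<subseteq> range (S ^^ n)" using bn unfolding bij_betw_def by blast
  qed
  have "ker_on UNIV (S ^^ n) \<subseteq> N"
  proof
    fix x assume x: "x \<in> ker_on UNIV (S ^^ n)"
    obtain m k where mk: "m \<in> M" "k \<in> N" "x = m + k" "(S ^^ n) x = (S ^^ n) m" using dec by blast
    then have "m \<in> ker_on M (S ^^ n)" using x by (simp add: ker_on_def)
    then have "m = 0" using inj_on_subspace_iff[OF Sn MN(1)] bn by (auto simp: bij_betw_def)
    then show "x \<in> N" using mk by simp
  qed
  then have "cfin_dim (ker_on UNIV (S ^^ n))" using MN(8) cfin_dim_subset by blast
  then show ?thesis unfolding core_nilpotent_def using bij R by blast
qed

lemma core_nilpotent_of_semi_fredholm_like: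
  assumes "bounded_op S" "\<And>\<epsilon>. \<epsilon> > 0 \<Longrightarrow> \<exists>\<mu>. cmod \<mu> < \<epsilon> \<and> bij (shift S \<mu>)" "semi_fredholm_like S"
  shows "core_nilpotent S"
  using assms core_nilpotent_of_Phi_plus core_nilpotent_of_Phi_minus core_nilpotent_of_essentially_kato
  unfolding semi_fredholm_like_def by blast

lemma Browder_imp_essentially_kato:
  assumes S: "bounded_op S" and B: "Browder S" shows "essentially_kato S"
proof -
  obtain n where n: "bij_betw S (range (S ^^ n)) (range (S ^^ n))" "cfin_dim (ker_on UNIV (S ^^ n))"
    using Browder_imp_core_nilpotent[OF assms] by (auto simp: core_nilpotent_def)
  let ?M = "range (S ^^ n)" and ?N = "ker_on UNIV (S ^^ n)"
  note Sn = bounded_op_funpow[OF S, of n]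
  note d = direct_sum_range_ker[OF S n(1)]
  have clM: "closed ?M" by (rule closed_range_of_fin_codim[OF Sn fin_codim_of_direct_sum[OF d n(2)]])
  have SM: "S ` ?M = ?M" using n by (simp add: bij_betw_def)
  have "ker_on ?M S = {0}"
    using inj_on_subspace_iff[OF S subspace_range_op[OF Sn]] n by (auto simp: bij_betw_def)
  then have "kato_on ?M S"
    using clM SM cvs.subspace_0[OF subspace_image_op[OF bounded_op_funpow[OF S] subspace_range_op[OF Sn]]]
    unfolding kato_on_def by simp
  moreover have "nilpotent_on ?N S" unfolding nilpotent_on_def by (rule exI[of _ n]) (auto simp: ker_on_def)
  moreover have "S ` ?N \<subseteq> ?N"
  proof -
    have "(S ^^ n) (S x) = S ((S ^^ n) x)" for x by (simp add: funpow_swap1)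
    then show ?thesis by (auto simp: ker_on_def bounded_op_simps[OF S])
  qed
  ultimately show ?thesis
    unfolding essentially_kato_def csubspace_eq invariant_def
    using d n clM SM subspace_range_op[OF Sn] subspace_ker_on[OF Sn cvs.subspace_UNIV] closed_ker_on[OF Sn closed_UNIV]
    by blast
qed

section \<open>The Browder spectrum\<close>

lemma bij_imp_core_nilpotent:
  assumes "bounded_op S" "bij S" shows "core_nilpotent S"
proof -
  have "cfin_dim (ker_on UNIV (S ^^ 0))" by (rule cfin_dimI[of "{}"]) (auto simp: ker_on_def)
  then show ?thesis using assms(2) unfolding core_nilpotent_def by (intro exI[of _ 0]) auto
qed

lemma open_resolvent:
  assumes T: "bounded_op T" shows "open (resolvent T)"
proof (subst open_contains_ball, intro ballI)
  fix \<kappa> assume "\<kappa> \<in> resolvent T"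
  then obtain \<epsilon> where e: "\<epsilon> > 0" "\<And>\<mu>. cmod \<mu> < \<epsilon> \<Longrightarrow> bij (shift (shift T \<kappa>) \<mu>)"
    using bij_betw_shift[OF bounded_op_shift[OF T] cvs.subspace_UNIV closed_UNIV] unfolding resolvent_def by blast
  have "\<mu> \<in> resolvent T" if "\<mu> \<in> ball \<kappa> \<epsilon>" for \<mu>
    using e(2)[of "\<mu> - \<kappa>"] that by (simp add: shift_shift resolvent_def dist_norm norm_minus_commute)
  then show "\<exists>\<epsilon>>0. ball \<kappa> \<epsilon> \<subseteq> resolvent T" using e(1) by blast
qed

lemma resolvent_large:
  assumes T: "bounded_op T"
  obtains K where "K > 0" "\<And>\<mu>. cmod \<mu> > K \<Longrightarrow> \<mu> \<in> resolvent T"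
proof -
  obtain K where K: "K > 0" "\<And>x. norm (T x) \<le> K * norm x" using bounded_op_bound[OF T] by blast
  then have "\<mu> \<in> resolvent T" if "cmod \<mu> > K" for \<mu>
    using that bij_shift_of_norm_less[OF T K(2)] by (simp add: resolvent_def)
  then show ?thesis using K(1) that by blast
qed

lemma closure_resolventD:
  assumes "\<kappa> \<in> closure (resolvent T)" "\<epsilon> > 0"
  shows "\<exists>\<mu>. cmod \<mu> < \<epsilon> \<and> bij (shift (shift T \<kappa>) \<mu>)"
proof -
  obtain \<mu> where "\<mu> \<in> resolvent T" "dist \<mu> \<kappa> < \<epsilon>" using assms unfolding closure_approachable by blast
  then show ?thesis by (intro exI[of _ "\<mu> - \<kappa>"]) (simp add: shift_shift resolvent_def dist_norm)
qed

lemma core_nilpotent_isolated: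
  assumes T: "bounded_op T" and c: "core_nilpotent (shift T \<kappa>)"
  obtains \<epsilon> where "\<epsilon> > 0" "ball \<kappa> \<epsilon> - {\<kappa>} \<subseteq> resolvent T"
proof -
  obtain \<epsilon> where e: "\<epsilon> > 0" "\<And>\<mu>. \<mu> \<noteq> 0 \<Longrightarrow> cmod \<mu> < \<epsilon> \<Longrightarrow> bij (shift (shift T \<kappa>) \<mu>)"
    using core_nilpotent_punctured[OF bounded_op_shift[OF T] c] by blast
  have "\<mu> \<in> resolvent T" if "\<mu> \<in> ball \<kappa> \<epsilon> - {\<kappa>}" for \<mu>
    using e(2)[of "\<mu> - \<kappa>"] that by (simp add: shift_shift resolvent_def dist_norm norm_minus_commute)
  then show ?thesis using e(1) that by blast
qed

lemma core_nilpotent_on_connected: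
  assumes T: "bounded_op T" and U: "open U" "connected U" "\<And>\<kappa>. \<kappa> \<in> U \<Longrightarrow> semi_fredholm_like (shift T \<kappa>)"
    and meet: "U \<inter> closure (resolvent T) \<noteq> {}"
  shows "U \<subseteq> closure (resolvent T)" "\<And>\<kappa>. \<kappa> \<in> U \<Longrightarrow> core_nilpotent (shift T \<kappa>)"
proof -
  let ?G = "closure (resolvent T)"
  have c: "core_nilpotent (shift T \<kappa>)" if "\<kappa> \<in> U" "\<kappa> \<in> ?G" for \<kappa>
    by (rule core_nilpotent_of_semi_fredholm_like[OF bounded_op_shift[OF T] closure_resolventD U(3)]) (use that in auto)
  \<comment> \<open>A point of this set is core nilpotent, so the punctured disc around it lies in
    the resolvent set and the full disc in the closure.\<close>
  have "open (U \<inter> ?G)" unfolding open_contains_ball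
  proof
    fix \<kappa> assume l: "\<kappa> \<in> U \<inter> ?G"
    obtain \<epsilon> where e: "\<epsilon> > 0" "ball \<kappa> \<epsilon> - {\<kappa>} \<subseteq> resolvent T"
      using core_nilpotent_isolated[OF T c] l by blast
    obtain \<delta> where d: "\<delta> > 0" "ball \<kappa> \<delta> \<subseteq> U" using U(1) l by (meson IntD1 openE)
    have "ball \<kappa> (min \<epsilon> \<delta>) \<subseteq> U \<inter> ?G"
    proof
      fix \<mu> assume m: "\<mu> \<in> ball \<kappa> (min \<epsilon> \<delta>)"
      then have "\<mu> = \<kappa> \<or> \<mu> \<in> resolvent T" using e(2) by auto
      then show "\<mu> \<in> U \<inter> ?G" using l m d closure_subset by auto
    qed
    then show "\<exists>e>0. ball \<kappa> e \<subseteq> U \<inter> ?G" using e(1) d(1) by (intro exI[of _ "min \<epsilon> \<delta>"]) auto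
  qed
  then have "openin (top_of_set U) (U \<inter> ?G)" using U(1) by (simp add: openin_open_eq)
  moreover have "closedin (top_of_set U) (U \<inter> ?G)" by (simp add: closedin_closed_Int)
  ultimately have "U \<inter> ?G = U" using U(2) meet by (metis connected_clopen)
  then show "U \<subseteq> ?G" by blast
  then show "core_nilpotent (shift T \<kappa>)" if "\<kappa> \<in> U" for \<kappa> using c that by blast
qed

lemma finite_spec_Browder_of_semi_fredholm_like:
  assumes T: "bounded_op T" and fin: "finite {\<kappa>. \<not> semi_fredholm_like (shift T \<kappa>)}"
  shows "finite (spec Browder T)"
proof -
  define U where "U = UNIV - {\<kappa>. \<not> semi_fredholm_like (shift T \<kappa>)}"
  have o: "open U" unfolding U_def using fin by (intro open_Diff finite_imp_closed) auto
  have con: "connected U" unfolding U_def using fin by (intro connected_open_delete_finite) auto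
  obtain K where K: "K > 0" "\<And>\<mu>. cmod \<mu> > K \<Longrightarrow> \<mu> \<in> resolvent T" using resolvent_large[OF T] by blast
  have m: "complex_of_real (K + 1) \<in> resolvent T"
  proof (rule K(2))
    show "cmod (complex_of_real (K + 1)) > K" using K(1) unfolding norm_of_real by simp
  qed
  have "resolvent T \<subseteq> U"
  proof
    fix \<mu> assume "\<mu> \<in> resolvent T"
    then have "core_nilpotent (shift T \<mu>)"
      using bij_imp_core_nilpotent[OF bounded_op_shift[OF T]] by (simp add: resolvent_def)
    then have "Browder (shift T \<mu>)" by (rule core_nilpotent_imp_Browder[OF bounded_op_shift[OF T]])
    then show "\<mu> \<in> U" by (simp add: U_def semi_fredholm_like_def Browder_def Phi_def)
  qed
  then have meet: "U \<inter> closure (resolvent T) \<noteq> {}" using m closure_subset by blast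
  have "\<kappa> \<notin> spec Browder T" if "\<kappa> \<in> U" for \<kappa>
    using core_nilpotent_imp_Browder[OF bounded_op_shift[OF T]
        core_nilpotent_on_connected(2)[OF T o con _ meet that]] 
    by (simp add: spec_def U_def)
  then have "spec Browder T \<subseteq> {\<kappa>. \<not> semi_fredholm_like (shift T \<kappa>)}" by (auto simp: U_def)
  then show ?thesis using fin finite_subset by blast
qed

text \<open>M is covered by its own image, so the finite set that completes A N to N completes the
  range of A to the whole space. This places the off-centre shifts of a gKR decomposition among the
  semi-Fredholm operators.\<close>

lemma Phi_minus_of_summands:
  assumes A: "bounded_op A" and d: "direct_sum M N" and M: "A ` M = M" and N: "fin_codim N (A ` N)"
  shows "Phi_minus A"
proof -
  obtain B where B: "finite B" "\<And>n. n \<in> N \<Longrightarrow> \<exists>r\<in>A ` N. \<exists>f\<in>cvs.span B. n = r + f"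
    using N unfolding fin_codim_def cspan_eq by blast
  have "\<exists>r\<in>range A. \<exists>f\<in>cvs.span B. x = r + f" for x
  proof -
    obtain m n where mn: "m \<in> M" "n \<in> N" "x = m + n" using d unfolding direct_sum_def by blast
    obtain m' where m': "m = A m'" using M mn(1) by blast
    obtain n' f where n': "f \<in> cvs.span B" "n = A n' + f" using B(2)[OF mn(2)] by blast
    have "x = A (m' + n') + f" using mn(3) m' n'(2) by (simp add: bounded_opD[OF A])
    then show ?thesis using n'(1) by blast
  qed
  then show ?thesis using B(1) unfolding Phi_minus_def lower_fredholm_on_def fin_codim_UNIV_iff by blast
qed

lemma finite_spec_Browder_of_gKR:
  assumes T: "bounded_op T" and g: "sigma_gKR T = {}"
  shows "finite (spec Browder T)"
proof -
  let ?G = "closure (resolvent T)"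
  \<comment> \<open>Near \<kappa> the Kato summand stays bijective, and the Riesz summand is
    Fredholm away from the centre. The centre itself may fail to be Browder, since N can be
    infinite-dimensional; hence the punctured disc.\<close>
  have loc: "\<exists>\<epsilon>>0. ball \<kappa> \<epsilon> - {\<kappa>} \<subseteq> ?G \<and> (\<forall>\<mu>\<in>ball \<kappa> \<epsilon> - {\<kappa>}. core_nilpotent (shift T \<mu>))"
    if l: "\<kappa> \<in> ?G" for \<kappa>
  proof -
    define S where "S = shift T \<kappa>"
    have S: "bounded_op S" unfolding S_def by (rule bounded_op_shift[OF T])
    have "gKR_decomposable S" using g by (auto simp: sigma_gKR_def spec_def S_def)
    then obtain M N where MN: "cvs.subspace M" "cvs.subspace N" "closed M" "closed N" "S ` M \<subseteq> M" "S ` N \<subseteq> N"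
      "direct_sum M N" "kato_on M S" "riesz_on N S"
      unfolding gKR_decomposable_def csubspace_eq invariant_def by blast
    have "bij_betw S M M"
      by (rule kato_summand_bij[OF S closure_resolventD[OF l, folded S_def] MN(1,3,5,2,6,7,8)])
    then obtain \<epsilon> where e: "\<epsilon> > 0" "\<And>\<mu>. cmod \<mu> < \<epsilon> \<Longrightarrow> bij_betw (shift S \<mu>) M M"
      using bij_betw_shift[OF S MN(1,3)] by blast
    have U: "open (ball \<kappa> \<epsilon> - {\<kappa>})" "connected (ball \<kappa> \<epsilon> - {\<kappa>})"
      by (auto intro: connected_punctured_ball)
    have semi: "semi_fredholm_like (shift T \<mu>)" if m: "\<mu> \<in> ball \<kappa> \<epsilon> - {\<kappa>}" for \<mu>
    proof -
      have eq: "shift S (\<mu> - \<kappa>) = shift T \<mu>" by (simp add: S_def shift_shift)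
      have "shift S (\<mu> - \<kappa>) ` M = M"
        using e(2)[of "\<mu> - \<kappa>"] m by (simp add: bij_betw_def dist_norm norm_minus_commute)
      moreover have "fin_codim N (shift S (\<mu> - \<kappa>) ` N)"
        using MN(9) m by (simp add: riesz_on_def fredholm_on_def lower_fredholm_on_def)
      ultimately have "Phi_minus (shift S (\<mu> - \<kappa>))"
        by (rule Phi_minus_of_summands[OF bounded_op_shift[OF S] MN(7)])
      then show ?thesis by (simp add: semi_fredholm_like_def eq)
    qed
    \<comment> \<open>The disc meets the resolvent set in a nonempty open set, and such a set is not
      contained in the single point \<kappa>.\<close>
    have "(ball \<kappa> \<epsilon> - {\<kappa>}) \<inter> ?G \<noteq> {}"
    proof -
      have "ball \<kappa> \<epsilon> \<inter> resolvent T \<noteq> {}"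
      proof -
        have "\<kappa> \<in> ball \<kappa> \<epsilon> \<inter> ?G" using l e(1) by simp
        then show ?thesis using open_Int_closure_eq_empty[OF open_ball, of \<kappa> \<epsilon> "resolvent T"] by blast
      qed
      moreover have "open (ball \<kappa> \<epsilon> \<inter> resolvent T)" using open_resolvent[OF T] by blast
      ultimately have "\<not> ball \<kappa> \<epsilon> \<inter> resolvent T \<subseteq> {\<kappa>}"
        by (metis not_open_singleton subset_singletonD)
      then show ?thesis using closure_subset by blast
    qed
    then show ?thesis
      using core_nilpotent_on_connected[OF T U semi] e(1) by blast
  qed
  have "open ?G" unfolding open_contains_ball
  proof
    fix \<kappa> assume l: "\<kappa> \<in> ?G"
    then obtain \<epsilon> where "\<epsilon> > 0" "ball \<kappa> \<epsilon> - {\<kappa>} \<subseteq> ?G" using loc by blast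
    then show "\<exists>e>0. ball \<kappa> e \<subseteq> ?G" using l by blast
  qed
  moreover obtain K where K: "K > 0" "\<And>\<mu>. cmod \<mu> > K \<Longrightarrow> \<mu> \<in> resolvent T" using resolvent_large[OF T] by blast
  have "complex_of_real (K + 1) \<in> resolvent T"
  proof (rule K(2))
    show "cmod (complex_of_real (K + 1)) > K" using K(1) unfolding norm_of_real by simp
  qed
  then have "?G \<noteq> {}" by auto
  ultimately have G: "?G = UNIV" using clopen[of ?G] by auto
  have core: "\<mu> \<notin> spec Browder T" if "core_nilpotent (shift T \<mu>)" for \<mu>
    using core_nilpotent_imp_Browder[OF bounded_op_shift[OF T] that] by (simp add: spec_def)
  have sub: "spec Browder T \<subseteq> cball 0 K"
  proof
    fix \<mu> assume "\<mu> \<in> spec Browder T"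
    then have "\<not> bij (shift T \<mu>)" using core bij_imp_core_nilpotent[OF bounded_op_shift[OF T]] by blast
    then have "\<not> cmod \<mu> > K" using K(2)[of \<mu>] by (auto simp: resolvent_def)
    then show "\<mu> \<in> cball 0 K" by simp
  qed
  show ?thesis
  proof (rule ccontr)
    assume "infinite (spec Browder T)"
    then obtain \<kappa> where l: "\<kappa> islimpt spec Browder T"
      using compact_eq_Bolzano_Weierstrass[of "cball (0::complex) K"] sub by auto
    \<comment> \<open>Around the limit point only the centre can belong to the Browder
      spectrum.\<close>
    obtain \<epsilon> where e: "\<epsilon> > 0" "\<forall>\<mu>\<in>ball \<kappa> \<epsilon> - {\<kappa>}. core_nilpotent (shift T \<mu>)"
      using loc G by blast
    obtain \<mu> where "\<mu> \<in> spec Browder T" "\<mu> \<noteq> \<kappa>" "dist \<mu> \<kappa> < \<epsilon>"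
      using l e(1) unfolding islimpt_approachable by blast
    then show False using e(2) core by (auto simp: dist_commute)
  qed
qed

section \<open>Polynomials in an operator and the polynomially Riesz condition\<close>

lemma op_poly_eq_sum:
  assumes "degree p \<le> n" shows "op_poly p T x = (\<Sum>i\<le>n. scaleC (coeff p i) ((T ^^ i) x))"
  unfolding op_poly_def using assms by (intro sum.mono_neutral_left) (auto simp: coeff_eq_0)

lemma op_poly_pCons:
  assumes T: "bounded_op T"
  shows "op_poly (pCons a p) T x = scaleC a x + T (op_poly p T x)"
proof -
  have "op_poly (pCons a p) T x = (\<Sum>i\<le>Suc (degree p). scaleC (coeff (pCons a p) i) ((T ^^ i) x))"
    by (rule op_poly_eq_sum) (rule degree_pCons_le)
  also have "\<dots> = scaleC a x + (\<Sum>i\<le>degree p. scaleC (coeff p i) (T ((T ^^ i) x)))"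
    by (simp add: sum.atMost_Suc_shift del: sum.atMost_Suc)
  also have "(\<Sum>i\<le>degree p. scaleC (coeff p i) (T ((T ^^ i) x))) = T (op_poly p T x)"
    by (simp add: op_poly_def bounded_op_simps[OF T] bounded_opD[OF T])
  finally show ?thesis .
qed

lemma op_poly_0: "op_poly 0 T x = 0"
  by (simp add: op_poly_def)

lemma bounded_op_op_poly:
  assumes T: "bounded_op T" shows "bounded_op (op_poly p T)"
proof (induction p)
  case 0
  show ?case by (rule bounded_opI[where K=0]) (auto simp: op_poly_0)
next
  case (pCons a p)
  have "op_poly (pCons a p) T = (\<lambda>x. scaleC a x + T (op_poly p T x))" using op_poly_pCons[OF T] by blast
  then show ?case
    using bounded_op_add[OF bounded_op_scaleC[OF bounded_op_id] bounded_op_compose[OF T pCons(2)]] by simp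
qed

lemma op_poly_add: "op_poly (p + q) T x = op_poly p T x + op_poly q T x"
proof -
  let ?n = "max (degree p) (degree q)"
  have "op_poly (p + q) T x = (\<Sum>i\<le>?n. scaleC (coeff (p + q) i) ((T ^^ i) x))"
    by (rule op_poly_eq_sum) (rule degree_add_le_max)
  moreover have "op_poly p T x = (\<Sum>i\<le>?n. scaleC (coeff p i) ((T ^^ i) x))"
    "op_poly q T x = (\<Sum>i\<le>?n. scaleC (coeff q i) ((T ^^ i) x))" by (rule op_poly_eq_sum, simp)+
  ultimately show ?thesis by (simp add: scaleC_add_left sum.distrib)
qed

lemma op_poly_smult: "op_poly (smult c p) T x = scaleC c (op_poly p T x)"
proof -
  have "op_poly (smult c p) T x = (\<Sum>i\<le>degree p. scaleC (coeff (smult c p) i) ((T ^^ i) x))"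
    by (rule op_poly_eq_sum) (rule degree_smult_le)
  then show ?thesis by (simp add: op_poly_def cvs.scale_sum_right scaleC_scaleC)
qed

lemma op_poly_linear_factor:
  assumes T: "bounded_op T"
  shows "op_poly ([:- r, 1:] * q) T x = shift T r (op_poly q T x)"
proof -
  have eq: "[:- r, 1:] * q = smult (- r) q + pCons 0 q" by (simp add: mult_pCons_left)
  show ?thesis
    unfolding eq op_poly_add op_poly_smult op_poly_pCons[OF T] by (simp add: shift_def)
qed

lemma shift_op_poly:
  assumes T: "bounded_op T"
  shows "shift (op_poly p T) c = op_poly (p - [:c:]) T"
proof
  fix x
  have "op_poly (p - [:c:]) T x = op_poly (p + [:- c:]) T x" by (simp add: diff_conv_add_uminus)
  also have "\<dots> = op_poly p T x + scaleC (- c) x"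
    using bounded_op_simps(1)[OF T] by (simp only: op_poly_add op_poly_pCons[OF T] op_poly_0) simp
  finally show "shift (op_poly p T) c x = op_poly (p - [:c:]) T x" by (simp add: shift_def)
qed

lemma finite_spec_Browder_of_polynomially_riesz:
  assumes T: "bounded_op T" and p: "polynomially_riesz T"
  shows "finite (spec Browder T)"
proof -
  obtain p where p: "p \<noteq> 0" "is_riesz (op_poly p T)" using p by (auto simp: polynomially_riesz_def)
  have "semi_fredholm_like (shift T \<kappa>)" if l: "poly p \<kappa> \<noteq> 0" for \<kappa>
  proof -
    have "poly (p - [:poly p \<kappa>:]) \<kappa> = 0" by simp
    then obtain q where q: "p - [:poly p \<kappa>:] = [:- \<kappa>, 1:] * q" unfolding poly_eq_0_iff_dvd by (elim dvdE)
    \<comment> \<open>T - \<kappa> is the left factor, so its range contains that of p(T) -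
      p(\<kappa>) and inherits finite codimension.\<close>
    have "range (shift (op_poly p T) (poly p \<kappa>)) \<subseteq> range (shift T \<kappa>)"
      unfolding shift_op_poly[OF T] q op_poly_linear_factor[OF T] by auto
    moreover have "fin_codim UNIV (range (shift (op_poly p T) (poly p \<kappa>)))"
      using p(2) l by (simp add: is_riesz_def riesz_on_def fredholm_on_def lower_fredholm_on_def)
    ultimately have "fin_codim UNIV (range (shift T \<kappa>))" unfolding fin_codim_UNIV_iff by (meson subsetD)
    then show ?thesis by (simp add: semi_fredholm_like_def Phi_minus_def lower_fredholm_on_def)
  qed
  then have "{\<kappa>. \<not> semi_fredholm_like (shift T \<kappa>)} \<subseteq> {\<kappa>. poly p \<kappa> = 0}" by blast
  then have "finite {\<kappa>. \<not> semi_fredholm_like (shift T \<kappa>)}" using poly_roots_finite[OF p(1)] finite_subset by blast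
  then show ?thesis by (rule finite_spec_Browder_of_semi_fredholm_like[OF T])
qed

lemma Phi_iff:
  assumes "bounded_op S"
  shows "Phi S \<longleftrightarrow> cfin_dim (ker_on UNIV S) \<and> fin_codim UNIV (range S)"
  using closed_range_of_fin_codim[OF assms]
  by (auto simp: Phi_def Phi_plus_def Phi_minus_def upper_fredholm_on_def lower_fredholm_on_def)

lemma fredholm_on_UNIV_iff: "fredholm_on UNIV S \<longleftrightarrow> Phi S"
  by (simp add: fredholm_on_def Phi_def Phi_plus_def Phi_minus_def)

lemma Phi_compose:
  assumes S: "bounded_op S" and T: "bounded_op T" and "Phi S" "Phi T"
  shows "Phi (\<lambda>x. S (T x))"
  using assms(3,4) cfin_dim_ker_compose[OF T] fin_codim_range_compose[OF S]
  unfolding Phi_iff[OF S] Phi_iff[OF T] Phi_iff[OF bounded_op_compose[OF S T]] by blast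

lemma bij_imp_Phi:
  assumes "bounded_op S" "bij S" shows "Phi S"
  using core_nilpotent_imp_Browder[OF assms(1) bij_imp_core_nilpotent[OF assms]] by (simp add: Browder_def)

lemma Phi_op_poly:
  assumes T: "bounded_op T" and "q \<noteq> 0" and "\<And>r. poly q r = 0 \<Longrightarrow> Phi (shift T r)"
  shows "Phi (op_poly q T)"
  using assms(2,3)
proof (induction "degree q" arbitrary: q)
  case 0
  then obtain c where c: "q = [:c:]" using degree_eq_zeroE by metis
  then have c0: "c \<noteq> 0" using 0 by simp
  have "op_poly q T x = scaleC c x" for x
    using bounded_op_simps(1)[OF T] by (simp add: c op_poly_pCons[OF T] op_poly_0)
  then have eq: "op_poly q T = (\<lambda>x. scaleC c x)" by blast
  have "bij (\<lambda>x::'a. scaleC c x)"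
    by (rule bij_betw_byWitness[where f'="scaleC (1/c)"]) (use c0 in \<open>auto simp: scaleC_scaleC scaleC_one\<close>)
  then show ?case unfolding eq by (intro bij_imp_Phi bounded_op_scaleC bounded_op_id)
next
  case (Suc n)
  then have "\<not> constant (poly q)" using constant_degree[of q] by simp
  then obtain r where r: "poly q r = 0" using fundamental_theorem_of_algebra by blast
  then obtain q' where q': "q = [:- r, 1:] * q'" unfolding poly_eq_0_iff_dvd by (elim dvdE)
  then have q'0: "q' \<noteq> 0" using Suc.prems by auto
  have "degree q = Suc (degree q')" unfolding q' using q'0 by (subst degree_mult_eq) auto
  then have "n = degree q'" using Suc by simp
  moreover have "Phi (shift T s)" if "poly q' s = 0" for s using that Suc.prems(2)[of s] q' by simp
  ultimately have "Phi (op_poly q' T)" using Suc.hyps(1) q'0 by blast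
  moreover have "op_poly q T = (\<lambda>x. shift T r (op_poly q' T x))" unfolding q' using op_poly_linear_factor[OF T] by blast
  ultimately show ?case
    using Phi_compose[OF bounded_op_shift[OF T] bounded_op_op_poly[OF T]] Suc.prems(2)[OF r] by simp
qed

lemma polynomially_riesz_of_finite_spec_Browder:
  assumes T: "bounded_op T" and fin: "finite (spec Browder T)"
  shows "polynomially_riesz T"
proof -
  \<comment> \<open>Vanishing on the Browder spectrum keeps the roots of p - \<mu> off it. The
    additional factor X gives p(0) = 0, so p - \<mu> is a nonzero polynomial for every \<mu>
    \<noteq> 0 even if the Browder spectrum is empty.\<close>
  define p :: "complex poly" where "p = [:0, 1:] * (\<Prod>\<kappa>\<in>spec Browder T. [:- \<kappa>, 1:])"
  have p0: "p \<noteq> 0" unfolding p_def using fin by (simp add: prod_zero_iff)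
  have "Phi (shift (op_poly p T) \<mu>)" if m: "\<mu> \<noteq> 0" for \<mu>
    unfolding shift_op_poly[OF T]
  proof (rule Phi_op_poly[OF T])
    have "poly (p - [:\<mu>:]) 0 \<noteq> 0" using m by (simp add: p_def)
    then show "p - [:\<mu>:] \<noteq> 0" by (metis poly_0)
    fix r assume "poly (p - [:\<mu>:]) r = 0"
    then have "poly p r \<noteq> 0" using m by simp
    then have "r \<notin> spec Browder T" using fin by (auto simp: p_def poly_prod prod_zero_iff)
    then show "Phi (shift T r)" by (simp add: spec_def Browder_def)
  qed
  then show ?thesis
    unfolding polynomially_riesz_def is_riesz_def riesz_on_def fredholm_on_UNIV_iff using p0 by blast
qed

section \<open>The index of a Browder operator\<close>

lemma cdim_eq_card:
  assumes "finite C" "cvs.independent C" "C \<subseteq> K" "K \<subseteq> cvs.span C"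
  shows "cdim K = card C"
  unfolding cdim_def cspan_eq
proof (rule Least_equality)
  show "\<exists>B. finite B \<and> card B = card C \<and> B \<subseteq> K \<and> K \<subseteq> cvs.span B" using assms by blast
  fix n assume "\<exists>B. finite B \<and> card B = n \<and> B \<subseteq> K \<and> K \<subseteq> cvs.span B"
  then obtain B where "finite B" "card B = n" "K \<subseteq> cvs.span B" by blast
  then show "card C \<le> n" using cvs.independent_span_bound[of B C] assms by auto
qed

text \<open>A kernel vector in the span of L lies in the span of C as well, and independence of the
  union forces it to be 0. In the application C is a basis of the kernel and L extends it.\<close>

lemma independent_image_complement_kernel:
  assumes S: "bounded_op S" and ind: "cvs.independent (C \<union> L)" "finite C" "finite L" "C \<inter> L = {}"
    and ker: "\<And>x. x \<in> cvs.span L \<Longrightarrow> S x = 0 \<Longrightarrow> x \<in> cvs.span C"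
  shows "inj_on S (cvs.span L)" "cvs.independent (S ` L)"
proof -
  have zero: "x = 0" if x: "x \<in> cvs.span L" "S x = 0" for x
  proof -
    obtain u where u: "x = (\<Sum>l\<in>L. scaleC (u l) l)" using x(1) unfolding cvs.span_finite[OF ind(3)] by auto
    obtain v where v: "x = (\<Sum>c\<in>C. scaleC (v c) c)"
      using ker[OF x] unfolding cvs.span_finite[OF ind(2)] by auto
    define w where "w z = (if z \<in> C then - v z else u z)" for z
    have "(\<Sum>z\<in>C \<union> L. scaleC (w z) z) = (\<Sum>c\<in>C. scaleC (w c) c) + (\<Sum>l\<in>L. scaleC (w l) l)"
      by (rule sum.union_disjoint[OF ind(2-4)])
    also have "(\<Sum>c\<in>C. scaleC (w c) c) = - x" by (simp add: v w_def sum_negf)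
    also have "(\<Sum>l\<in>L. scaleC (w l) l) = x"
      unfolding u using ind(4) by (intro sum.cong) (auto simp: w_def)
    finally have z: "(\<Sum>z\<in>C \<union> L. scaleC (w z) z) = 0" by simp
    have "u l = 0" if l: "l \<in> L" for l
    proof -
      have "w l = 0" by (rule cvs.independentD[OF ind(1) _ subset_refl z]) (use ind l in auto)
      moreover have "l \<notin> C" using l ind(4) by blast
      ultimately show ?thesis by (simp add: w_def)
    qed
    then show ?thesis by (simp add: u)
  qed
  have "ker_on (cvs.span L) S = {0}"
    using zero cvs.span_zero bounded_op_simps(1)[OF S] by (auto simp: ker_on_def)
  then show inj: "inj_on S (cvs.span L)" using inj_on_subspace_iff[OF S cvs.subspace_span] by blast
  have "cvs.independent L" using ind(1) cvs.independent_mono by blast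
  then show "cvs.independent (S ` L)"
    using module_hom.independent_injective_image[OF bounded_op_linear[OF S]] inj by blast
qed

text \<open>S is bijective on R(S^n), so kernel and cokernel both live in the finite-dimensional
  N(S^n), where rank plus nullity makes their dimensions equal.\<close>

lemma Browder_op_index:
  assumes S: "bounded_op S" and B: "Browder S"
  shows "op_index UNIV S = 0"
proof -
  obtain n where n: "bij_betw S (range (S ^^ n)) (range (S ^^ n))" "cfin_dim (ker_on UNIV (S ^^ n))"
    using Browder_imp_core_nilpotent[OF assms] by (auto simp: core_nilpotent_def)
  define R where "R = range (S ^^ n)"
  define N where "N = ker_on UNIV (S ^^ n)"
  note Sn = bounded_op_funpow[OF S, of n]
  have d: "direct_sum R N" unfolding R_def N_def by (rule direct_sum_range_ker[OF S n(1)])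
  have R: "cvs.subspace R" "S ` R = R" unfolding R_def using subspace_range_op[OF Sn] n by (auto simp: bij_betw_def)
  have N: "cvs.subspace N" unfolding N_def by (rule subspace_ker_on[OF Sn cvs.subspace_UNIV])
  have SN: "S ` N \<subseteq> N" unfolding N_def
  proof -
    have "(S ^^ n) (S x) = S ((S ^^ n) x)" for x by (simp add: funpow_swap1)
    then show "S ` ker_on UNIV (S ^^ n) \<subseteq> ker_on UNIV (S ^^ n)" by (auto simp: ker_on_def bounded_op_simps[OF S])
  qed
  define K where "K = ker_on UNIV S"
  have KN: "K \<subseteq> N"
  proof
    fix x assume "x \<in> K"
    then have x: "S x = 0" by (simp add: K_def ker_on_def)
    obtain r k where rk: "r \<in> R" "k \<in> N" "x = r + k" using d unfolding direct_sum_def by blast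
    have "S r = - S k" using x rk by (simp add: bounded_opD[OF S] eq_neg_iff_add_eq_0)
    moreover have "- S k \<in> N" using SN rk(2) by (intro cvs.subspace_neg[OF N]) auto
    moreover have "S r \<in> R" using rk(1) R(2) by blast
    ultimately have "S r \<in> R \<inter> N" by simp
    then have "S r = 0" using d unfolding direct_sum_def by blast
    then have "r \<in> ker_on R S" using rk by (simp add: ker_on_def)
    then have "r = 0" using inj_on_subspace_iff[OF S R(1)] n(1) by (auto simp: R_def bij_betw_def)
    then show "x \<in> N" using rk by simp
  qed
  have finN: "cfin_dim N" using n(2) by (simp add: N_def)
  obtain C where C: "finite C" "C \<subseteq> K" "K \<subseteq> cvs.span C" "cvs.independent C"
    using cfin_dimE[OF cfin_dim_subset[OF finN KN]] .
  obtain D where D: "C \<subseteq> D" "D \<subseteq> N" "cvs.independent D" "N \<subseteq> cvs.span D"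
    using cvs.maximal_independent_subset_extend[of C N] C KN by blast
  obtain D0 where D0: "finite D0" "N \<subseteq> cvs.span D0" using finN by (rule cfin_dimE)
  have finD: "finite D" using cvs.independent_span_bound[OF D0(1) D(3)] D D0 by blast
  \<comment> \<open>\<open>C\<close> is a basis of the kernel and \<open>D\<close> extends it to a
    basis of \<open>N\<close>; S carries \<open>L\<close> to a basis of S N.\<close>
  define L where "L = D - C"
  have L: "finite L" "C \<inter> L = {}" "C \<union> L = D" using finD D(1) by (auto simp: L_def)
  have spD: "cvs.span D = N" using D(2) D(4) cvs.span_minimal[OF D(2) N] by blast
  have LN: "cvs.span L \<subseteq> N" using spD cvs.span_mono[of L D] L(3) by blast
  have ker: "x \<in> cvs.span C" if "x \<in> cvs.span L" "S x = 0" for x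
    using that C(3) by (auto simp: K_def ker_on_def)
  have indSL: "cvs.independent (S ` L)" and injSL: "inj_on S (cvs.span L)"
    using independent_image_complement_kernel[OF S _ C(1) L(1) L(2)] D(3) L(3) ker by auto
  have cardSL: "card (S ` L) = card L"
    by (rule card_image[OF inj_on_subset[OF injSL cvs.span_superset]])
  have cardD: "card D = card C + card L"
    using card_Un_disjoint[OF C(1) L(1) L(2)] L(3) by simp
  have SNsp: "S x \<in> cvs.span (S ` L)" if "x \<in> N" for x
  proof -
    have "x \<in> cvs.span (C \<union> L)" using that spD L(3) by simp
    then obtain c l where cl: "x = c + l" "c \<in> cvs.span C" "l \<in> cvs.span L" unfolding cvs.span_Un by blast
    have "cvs.span C \<subseteq> K" using C(2) subspace_ker_on[OF S cvs.subspace_UNIV] unfolding K_def by (rule cvs.span_minimal)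
    then have "S c = 0" using cl(2) by (auto simp: K_def ker_on_def)
    then have "S x = S l" using cl by (simp add: bounded_opD[OF S])
    then show ?thesis using cl(3) module_hom.span_image[OF bounded_op_linear[OF S], of L] by auto
  qed
  have "S ` L \<subseteq> N" using SN LN cvs.span_superset[of L] by blast
  then obtain E where E: "S ` L \<subseteq> E" "E \<subseteq> N" "cvs.independent E" "N \<subseteq> cvs.span E"
    using cvs.maximal_independent_subset_extend[of "S ` L" N] indSL by blast
  have finE: "finite E" using cvs.independent_span_bound[OF D0(1) E(3)] E D0 by blast
  have "card E = card D"
    using cvs.basis_card_eq_dim[OF E(2,4,3)] cvs.basis_card_eq_dim[OF D(2,4,3)] by simp
  \<comment> \<open>Rank plus nullity: the vectors completing S L to a basis of \<open>N\<close> are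
    as many as those in the kernel basis.\<close>
  then have cardF: "card (E - S ` L) = card C"
    using card_Diff_subset[OF _ E(1)] L(1) cardSL cardD by simp
  have codim: "ccodim UNIV (range S) = card C"
    unfolding ccodim_def cspan_eq
  proof (rule Least_equality)
    have "x \<in> {r + f |r f. r \<in> range S \<and> f \<in> cvs.span (E - S ` L)}" for x
    proof -
      obtain r k where rk: "r \<in> R" "k \<in> N" "x = r + k" using d unfolding direct_sum_def by blast
      have "k \<in> cvs.span (S ` L \<union> (E - S ` L))" using rk(2) E(1,4) by (simp add: Un_absorb1 subsetD)
      then obtain g f where gf: "k = g + f" "g \<in> cvs.span (S ` L)" "f \<in> cvs.span (E - S ` L)"
        unfolding cvs.span_Un by blast
      have "g \<in> range S" using gf(2) module_hom.span_image[OF bounded_op_linear[OF S], of L] by auto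
      moreover have "r \<in> range S" using rk(1) R(2) by blast
      ultimately have "r + g \<in> range S" by (intro cvs.subspace_add subspace_range_op S)
      moreover have "x = (r + g) + f" using rk gf by (simp add: add.assoc)
      ultimately show ?thesis using gf(3) by blast
    qed
    then show "\<exists>B. finite B \<and> card B = card C \<and> B \<subseteq> UNIV \<and> UNIV \<subseteq> {r + f |r f. r \<in> range S \<and> f \<in> cvs.span B}"
      using finE cardF by (intro exI[of _ "E - S ` L"] conjI subsetI) simp_all
    fix m assume "\<exists>B. finite B \<and> card B = m \<and> B \<subseteq> UNIV \<and> UNIV \<subseteq> {r + f |r f. r \<in> range S \<and> f \<in> cvs.span B}"
    then obtain B where Bm: "finite B" "card B = m"
      and cov: "UNIV \<subseteq> {r + f |r f. r \<in> range S \<and> f \<in> cvs.span B}" by (elim exE conjE)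
    have "\<exists>r\<in>range S. \<exists>f\<in>cvs.span B. x = r + f" for x using subsetD[OF cov UNIV_I, of x] by blast
    note B = Bm this
    have "\<exists>k. k \<in> N \<and> b - k \<in> R" for b
      using d unfolding direct_sum_def by (metis add_diff_cancel_right')
    then obtain \<pi> where pi: "\<And>b. \<pi> b \<in> N" "\<And>b. b - \<pi> b \<in> R" by metis
    \<comment> \<open>Projecting an arbitrary supplement \<open>B\<close> of the range onto
      \<open>N\<close> along \<open>R\<close> gives a supplement of S N within \<open>N\<close>.
      Comparing sizes with the basis \<open>D\<close> shows that \<open>B\<close> has at least
      \<open>card C\<close> elements.\<close>
    have "N \<subseteq> cvs.span (S ` L \<union> \<pi> ` B)"
    proof
      fix x assume x: "x \<in> N"
      obtain u f where uf: "f \<in> cvs.span B" "x = S u + f" using B(3) by blast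
      obtain c where c: "f = (\<Sum>b\<in>B. scaleC (c b) b)" using uf(1) unfolding cvs.span_finite[OF B(1)] by auto
      obtain ur un where u: "ur \<in> R" "un \<in> N" "u = ur + un" using d unfolding direct_sum_def by blast
      define y where "y = (\<Sum>b\<in>B. scaleC (c b) (\<pi> b))"
      have y: "y \<in> cvs.span (\<pi> ` B)"
        unfolding y_def by (intro cvs.span_sum cvs.span_scale cvs.span_base) auto
      have yN: "y \<in> N" unfolding y_def by (intro cvs.subspace_sum N cvs.subspace_scale pi)
      have "x - S un - y = S ur + (\<Sum>b\<in>B. scaleC (c b) (b - \<pi> b))"
        by (simp add: uf c u y_def cvs.scale_right_diff_distrib sum_subtractf bounded_opD[OF S])
      also have "\<dots> \<in> R"
      proof (intro cvs.subspace_add R(1) cvs.subspace_sum cvs.subspace_scale pi)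
        show "S ur \<in> R" using u R(2) by blast
      qed
      finally have "x - S un - y \<in> R" .
      moreover have "x - S un - y \<in> N" using x u(2) yN SN by (intro cvs.subspace_diff N) auto
      ultimately have "x - S un - y = 0" using d unfolding direct_sum_def by blast
      then have "x = S un + y" by (simp add: algebra_simps)
      then show "x \<in> cvs.span (S ` L \<union> \<pi> ` B)" using SNsp[OF u(2)] y unfolding cvs.span_Un by blast
    qed
    then have "card D \<le> card (S ` L \<union> \<pi> ` B)"
      using cvs.independent_span_bound[OF _ D(3), of "S ` L \<union> \<pi> ` B"] D(2) L(1) B(1) by auto
    also have "\<dots> \<le> card L + m"
      using card_Un_le[of "S ` L" "\<pi> ` B"] card_image_le[OF L(1), of S] card_image_le[OF B(1), of \<pi>] B(2) by linarith
    finally show "card C \<le> m" using cardD by simp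
  qed
  have dim: "cdim (ker_on UNIV S) = card C" using cdim_eq_card[OF C(1,4,2,3)] by (simp add: K_def)
  have "Phi S" using B by (simp add: Browder_def)
  then have "cfin_dim (ker_on UNIV S)" "fin_codim UNIV (range S)" by (auto simp: Phi_iff[OF S])
  then show ?thesis by (simp add: op_index_def dim codim zero_ereal_def)
qed

section \<open>The Riesz projection of a circle\<close>

text \<open>Each coarse node k/n, counted m times, is compared with the m fine nodes of [k/n,
  (k+1)/n); every pair is at distance at most 1/n.\<close>

lemma riemann_mean_refine:
  fixes g :: "real \<Rightarrow> 'b::real_normed_vector"
  assumes Lip: "\<And>s t. norm (g s - g t) \<le> K * \<bar>s - t\<bar>" and n: "n > 0" and m: "m > 0"
  shows "norm ((1 / real n) *\<^sub>R (\<Sum>k<n. g (real k / real n)) -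
    (1 / real (n * m)) *\<^sub>R (\<Sum>i<n * m. g (real i / real (n * m)))) \<le> K / real n"
proof -
  have K: "K \<ge> 0" using order_trans[OF norm_ge_zero Lip[of 1 0]] by simp
  have "(1 / real n) *\<^sub>R (\<Sum>k<n. g (real k / real n)) =
      (1 / real (n * m)) *\<^sub>R (\<Sum>k<n. \<Sum>i\<in>{k * m..<k * m + m}. g (real k / real n))"
    using n m by (simp add: scaleR_sum_right[symmetric] sum_constant_scaleR)
  moreover have "(\<Sum>i<n * m. g (real i / real (n * m))) =
      (\<Sum>k<n. \<Sum>i\<in>{k * m..<k * m + m}. g (real i / real (n * m)))"
    by (rule sum.nat_group[symmetric])
  ultimately have "(1 / real n) *\<^sub>R (\<Sum>k<n. g (real k / real n)) -
    (1 / real (n * m)) *\<^sub>R (\<Sum>i<n * m. g (real i / real (n * m))) =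
    (1 / real (n * m)) *\<^sub>R (\<Sum>k<n. \<Sum>i\<in>{k * m..<k * m + m}. g (real k / real n) - g (real i / real (n * m)))"
    by (simp only: scaleR_diff_right[symmetric] sum_subtractf)
  also have "norm \<dots> \<le> (1 / real (n * m)) * (real n * (real m * (K / real n)))"
  proof -
    have le: "norm (g (real k / real n) - g (real i / real (n * m))) \<le> K / real n"
      if i: "i \<in> {k * m..<k * m + m}" for k i
    proof -
      have "real k * real m \<le> real i" "real i \<le> real k * real m + real m"
        using i by (simp_all flip: of_nat_mult of_nat_add)
      then have "\<bar>real k * real m - real i\<bar> \<le> real m" by linarith
      then have "\<bar>real k * real m - real i\<bar> / (real n * real m) \<le> real m / (real n * real m)"
        by (rule divide_right_mono) simp
      moreover have "real k / real n - real i / real (n * m) = (real k * real m - real i) / (real n * real m)"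
        using n m by (simp add: diff_divide_distrib)
      ultimately have "\<bar>real k / real n - real i / real (n * m)\<bar> \<le> 1 / real n"
        using n m by simp
      then have "K * \<bar>real k / real n - real i / real (n * m)\<bar> \<le> K * (1 / real n)"
        using K by (rule mult_left_mono)
      then show ?thesis using Lip[of "real k / real n" "real i / real (n * m)"] by simp
    qed
    have "norm (\<Sum>k<n. \<Sum>i\<in>{k * m..<k * m + m}. g (real k / real n) - g (real i / real (n * m)))
        \<le> (\<Sum>k<n. real m * (K / real n))"
    proof (rule sum_norm_le)
      fix k assume "k \<in> {..<n}"
      have "norm (\<Sum>i\<in>{k * m..<k * m + m}. g (real k / real n) - g (real i / real (n * m)))
          \<le> (\<Sum>i\<in>{k * m..<k * m + m}. K / real n)"
        by (rule sum_norm_le) (rule le)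
      then show "norm (\<Sum>i\<in>{k * m..<k * m + m}. g (real k / real n) - g (real i / real (n * m)))
          \<le> real m * (K / real n)" by simp
    qed
    then show ?thesis by (simp add: mult_left_mono divide_right_mono)
  qed
  also have "\<dots> = K / real n" using n m by simp
  finally show ?thesis .
qed

text \<open>The means of orders n and m are both compared with the one of order n m. Letting m grow
  in the resulting bound K/n + K/m leaves K/n for the limit.\<close>

lemma riemann_means_converge:
  fixes g :: "real \<Rightarrow> 'b::banach"
  assumes Lip: "\<And>s t. norm (g s - g t) \<le> K * \<bar>s - t\<bar>"
  obtains l where "\<And>n. n > 0 \<Longrightarrow> norm ((1 / real n) *\<^sub>R (\<Sum>k<n. g (real k / real n)) - l) \<le> K / real n"
proof -
  define M where "M n = (1 / real n) *\<^sub>R (\<Sum>k<n. g (real k / real n))" for n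
  have K: "K \<ge> 0" using order_trans[OF norm_ge_zero Lip[of 1 0]] by simp
  have diff: "norm (M n - M m) \<le> K / real n + K / real m" if nm: "n > 0" "m > 0" for n m
  proof -
    have 1: "norm (M n - M (n * m)) \<le> K / real n"
      unfolding M_def using riemann_mean_refine[OF Lip nm] .
    have 2: "norm (M m - M (n * m)) \<le> K / real m"
      unfolding M_def using riemann_mean_refine[OF Lip nm(2,1)] by (simp only: mult.commute)
    have "M n - M m = (M n - M (n * m)) - (M m - M (n * m))" by simp
    then have "norm (M n - M m) \<le> norm (M n - M (n * m)) + norm (M m - M (n * m))"
      by (metis norm_triangle_ineq4)
    then show ?thesis using 1 2 by linarith
  qed
  have lim0: "(\<lambda>n. K / real n) \<longlonglongrightarrow> 0" by (rule lim_const_over_n)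
  have "Cauchy M" unfolding Cauchy_iff
  proof (intro allI impI)
    fix e :: real assume "e > 0"
    then have "eventually (\<lambda>n. K / real n < e / 2) sequentially"
      by (intro order_tendstoD(2)[OF lim0]) simp
    then obtain N where N: "\<And>n. n \<ge> N \<Longrightarrow> K / real n < e / 2" by (auto simp: eventually_sequentially)
    have "norm (M m - M n) < e" if "m \<ge> Suc N" "n \<ge> Suc N" for m n
    proof -
      have "norm (M m - M n) \<le> K / real m + K / real n" using that by (intro diff) auto
      moreover have "K / real m < e / 2" "K / real n < e / 2" using that N by auto
      ultimately show ?thesis by linarith
    qed
    then show "\<exists>N. \<forall>m\<ge>N. \<forall>n\<ge>N. norm (M m - M n) < e" by blast
  qed
  then obtain l where l: "M \<longlonglongrightarrow> l" using Cauchy_convergent convergent_def by blast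
  have "norm (M n - l) \<le> K / real n" if n: "n > 0" for n
  proof (rule tendsto_le[OF trivial_limit_sequentially])
    show "(\<lambda>m. K / real n + K / real m) \<longlonglongrightarrow> K / real n"
      using tendsto_add[OF tendsto_const lim0, of "K / real n"] by simp
    show "(\<lambda>m. norm (M n - M m)) \<longlonglongrightarrow> norm (M n - l)" by (intro tendsto_intros l)
    show "eventually (\<lambda>m. norm (M n - M m) \<le> K / real n + K / real m) sequentially"
      using eventually_gt_at_top[of 0] by eventually_elim (use diff n in blast)
  qed
  then show ?thesis using that unfolding M_def by blast
qed

section \<open>Roots of unity and estimates for the resolvent\<close>

lemma cmod_cis_diff_le: "cmod (cis s - cis t) \<le> \<bar>s - t\<bar>"
proof -
  have "cis s - cis t = cis t * (cis (s - t) - 1)" by (simp add: algebra_simps cis_mult)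
  then have "cmod (cis s - cis t) = cmod (cis (s - t) - 1)" by (simp add: norm_mult)
  also have "\<dots> = 2 * \<bar>sin ((s - t) / 2)\<bar>"
    unfolding cis_conv_exp by (rule dist_exp_i_1)
  also have "\<dots> \<le> \<bar>s - t\<bar>" using abs_sin_x_le_abs_x[of "(s - t) / 2"] by simp
  finally show ?thesis .
qed

text \<open>A geometric sum in w = exp (2 pi i m / n): w^n = 1, while w = 1 only if n divides m,
  which for 0 < m \<le> n means m = n.\<close>

lemma sum_circle_powers:
  assumes n: "n > 0" and m: "0 < m" "m \<le> n"
  shows "(\<Sum>k<n. (of_real r * cis (2 * pi * (real k / real n))) ^ m) = (if m = n then of_nat n * of_real r ^ n else 0)"
proof -
  define w where "w = cis (2 * pi * (real m / real n))"
  have pw: "(of_real r * cis (2 * pi * (real k / real n))) ^ m = of_real r ^ m * w ^ k" for k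
  proof -
    have "real m * (2 * pi * (real k / real n)) = real k * (2 * pi * (real m / real n))" by simp
    then have "cis (2 * pi * (real k / real n)) ^ m = w ^ k" by (simp only: w_def Complex.DeMoivre)
    then show ?thesis by (simp add: power_mult_distrib)
  qed
  have wn: "w ^ n = 1"
  proof -
    have "real n * (2 * pi * (real m / real n)) = 2 * pi * real m" using n by simp
    then have "w ^ n = cis (2 * pi * real m)" unfolding w_def Complex.DeMoivre by simp
    then show ?thesis using cis_multiple_2pi[of "real m"] by simp
  qed
  show ?thesis
  proof (cases "m = n")
    case True
    then have "w = 1" using n by (simp add: w_def)
    then show ?thesis unfolding pw using True by simp
  next
    case False
    have "w \<noteq> 1"
    proof
      assume "w = 1"
      have "w = exp (2 * of_real pi * \<i> * of_nat m / of_nat n)"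
        unfolding w_def cis_conv_exp by (simp add: mult_ac)
      then have "n dvd m" using \<open>w = 1\<close> complex_root_unity_eq_1[of n m] n by simp
      then show False using m False by (auto dest: dvd_imp_le)
    qed
    then have "(\<Sum>k<n. w ^ k) = 0" using power_diff_1_eq[of w n] wn by simp
    then show ?thesis unfolding pw using False by (simp add: sum_distrib_left[symmetric])
  qed
qed

text \<open>Points violating ever larger bounds would accumulate at some z0 in the compact set,
  where the lower bound for A - z0 survives small changes of z.\<close>

lemma resolvent_uniform_bound:
  assumes A: "bounded_op A" and W: "compact W" "W \<subseteq> resolvent A"
  obtains C where "C > 0" "\<And>z x. z \<in> W \<Longrightarrow> norm x \<le> C * norm (shift A z x)"
proof (rule ccontr)
  assume "\<not> thesis"
  then have "\<And>C. C > 0 \<Longrightarrow> \<exists>z x. z \<in> W \<and> norm x > C * norm (shift A z x)"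
    using that by (meson not_le)
  then have "\<forall>n. \<exists>z x. z \<in> W \<and> norm x > real (Suc n) * norm (shift A z x)" by simp
  then obtain z x where zx: "\<And>n. z n \<in> W" "\<And>n. norm (x n) > real (Suc n) * norm (shift A (z n) (x n))"
    by metis
  obtain z0 \<rho> where z0: "z0 \<in> W" "strict_mono \<rho>" "(z \<circ> \<rho>) \<longlonglongrightarrow> z0"
    using W(1) zx(1) unfolding compact_def by blast
  have b: "bij_betw (shift A z0) UNIV UNIV" using z0(1) W(2) by (auto simp: resolvent_def)
  obtain C where C0: "C > 0" "\<And>x. x \<in> UNIV \<Longrightarrow> norm x \<le> C * norm (shift A z0 x)"
    using bij_betw_lower_bound[OF bounded_op_shift[OF A] cvs.subspace_UNIV closed_UNIV b] by blast
  note C = C0(1) C0(2)[OF UNIV_I]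
  have ev: "1 \<le> C * (1 / real (Suc (\<rho> n)) + cmod (z (\<rho> n) - z0))" for n
  proof -
    let ?x = "x (\<rho> n)" and ?z = "z (\<rho> n)" and ?k = "real (Suc (\<rho> n))"
    have pos: "norm ?x > 0"
    proof -
      have "0 \<le> ?k * norm (shift A ?z ?x)" by simp
      then show ?thesis using zx(2)[of "\<rho> n"] by linarith
    qed
    have "norm (shift A ?z ?x) * ?k \<le> norm ?x" using zx(2)[of "\<rho> n"] by (simp add: mult.commute)
    then have 1: "norm (shift A ?z ?x) \<le> norm ?x / ?k" by (subst pos_le_divide_eq) auto
    have "shift A z0 ?x = shift A ?z ?x + scaleC (?z - z0) ?x"
      by (simp add: shift_def cvs.scale_left_diff_distrib)
    then have "norm (shift A z0 ?x) \<le> norm (shift A ?z ?x) + cmod (?z - z0) * norm ?x"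
      by (metis norm_triangle_ineq norm_scaleC)
    also have "\<dots> \<le> (1 / ?k + cmod (?z - z0)) * norm ?x"
      using 1 by (simp add: distrib_right)
    finally have "C * norm (shift A z0 ?x) \<le> C * ((1 / ?k + cmod (?z - z0)) * norm ?x)"
      using C(1) by (intro mult_left_mono) auto
    then have "1 * norm ?x \<le> (C * (1 / ?k + cmod (?z - z0))) * norm ?x"
      using C(2)[of ?x] by (simp only: mult.assoc)
    then show ?thesis using pos by (simp only: mult_le_cancel_right_pos)
  qed
  have "(\<lambda>n. C * (1 / real (Suc (\<rho> n)) + cmod (z (\<rho> n) - z0))) \<longlonglongrightarrow> C * (0 + cmod (z0 - z0))"
  proof (intro tendsto_intros)
    show "(\<lambda>n. 1 / real (Suc (\<rho> n))) \<longlonglongrightarrow> 0"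
      using LIMSEQ_subseq_LIMSEQ[OF LIMSEQ_inverse_real_of_nat z0(2)] by (simp add: o_def inverse_eq_divide)
    show "(\<lambda>n. z (\<rho> n)) \<longlonglongrightarrow> z0" using z0(3) by (simp add: o_def)
  qed
  then have "1 \<le> C * (0 + cmod (z0 - z0))" using LIMSEQ_le_const ev by blast
  then show False by simp
qed

text \<open>The resolvent (z - A)^(-1), whereas \<open>shift A z\<close> is A - z; hence the
  sign.\<close>

definition res_op :: "('a::complex_banach \<Rightarrow> 'a) \<Rightarrow> complex \<Rightarrow> 'a \<Rightarrow> 'a" where
  "res_op A z x = - inv (shift A z) x"

lemma res_op_eq:
  assumes A: "bounded_op A" and z: "bij (shift A z)"
  shows "scaleC z (res_op A z x) = x + A (res_op A z x)" "shift A z y = - x \<Longrightarrow> res_op A z x = y"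
proof -
  have "shift A z (- inv (shift A z) x) = - x"
    using z by (simp add: bounded_op_simps[OF bounded_op_shift[OF A]] bij_def surj_f_inv_f)
  then have s: "shift A z (res_op A z x) = - x" by (simp add: res_op_def)
  then show "scaleC z (res_op A z x) = x + A (res_op A z x)" by (simp add: shift_def algebra_simps)
  assume "shift A z y = - x"
  then show "res_op A z x = y" using s z by (metis bij_def injD)
qed

lemma shift_res_op:
  assumes A: "bounded_op A" and z: "bij (shift A z)"
  shows "shift A z (res_op A z x) = - x"
  using res_op_eq(1)[OF assms, of x] by (simp add: shift_def algebra_simps)

lemma res_op_linear:
  assumes A: "bounded_op A" and z: "bij (shift A z)"
  shows "res_op A z (x + y) = res_op A z x + res_op A z y"
    "res_op A z (scaleC c x) = scaleC c (res_op A z x)"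
    "A (res_op A z x) = res_op A z (A x)"
proof -
  note s = shift_res_op[OF assms]
  note l = bounded_opD[OF bounded_op_shift[OF A]]
  show "res_op A z (x + y) = res_op A z x + res_op A z y"
    by (rule res_op_eq(2)[OF assms]) (simp add: l s)
  show "res_op A z (scaleC c x) = scaleC c (res_op A z x)"
    by (rule res_op_eq(2)[OF assms]) (simp add: l s)
  have "shift A z (A u) = A (shift A z u)" for u by (simp add: shift_def bounded_opD[OF A] bounded_op_simps[OF A])
  then show "A (res_op A z x) = res_op A z (A x)"
    by (intro res_op_eq(2)[OF assms, symmetric]) (simp add: s bounded_op_simps[OF A])
qed

lemma res_op_lipschitz:
  assumes A: "bounded_op A" and z: "bij (shift A z)" "bij (shift A w)"
    and C: "\<And>x. norm x \<le> C * norm (shift A z x)" "\<And>x. norm x \<le> C * norm (shift A w x)" "C > 0"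
  shows "norm (res_op A z x - res_op A w x) \<le> C * C * cmod (z - w) * norm x"
proof -
  let ?y = "res_op A z x - res_op A w x"
  have "shift A w (res_op A z x) = shift A z (res_op A z x) + scaleC (z - w) (res_op A z x)"
    by (simp add: shift_def cvs.scale_left_diff_distrib)
  then have "shift A w ?y = scaleC (z - w) (res_op A z x)"
    by (simp add: shift_diff[OF A] shift_res_op[OF A] z)
  then have "norm ?y \<le> C * (cmod (z - w) * norm (res_op A z x))"
    using C(2)[of ?y] by (simp add: norm_scaleC)
  also have "norm (res_op A z x) \<le> C * norm x"
    using C(1)[of "res_op A z x"] by (simp add: shift_res_op[OF A z(1)])
  then have "C * (cmod (z - w) * norm (res_op A z x)) \<le> C * (cmod (z - w) * (C * norm x))"
    using C(3) by (intro mult_left_mono) auto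
  finally show ?thesis by (simp add: mult_ac)
qed

text \<open>The telescoping identity (z^n - A^n) (z - A)^(-1) = \<Sum> z^(n-1-j) A^j over j < n,
  multiplied by z.\<close>

lemma res_op_power:
  assumes A: "bounded_op A" and z: "bij (shift A z)"
  shows "scaleC (z ^ n) (scaleC z (res_op A z x)) - (A ^^ n) (scaleC z (res_op A z x)) =
    (\<Sum>j<n. scaleC (z ^ (n - j)) ((A ^^ j) x))"
proof (induction n)
  case (Suc n)
  let ?y = "scaleC z (res_op A z x)"
  have An: "(A ^^ n) (scaleC z u) = scaleC z ((A ^^ n) u)" for u
    using bounded_opD[OF bounded_op_funpow[OF A]] by blast
  have 1: "A ?y = scaleC z ?y - scaleC z x"
  proof -
    have "A (res_op A z x) = scaleC z (res_op A z x) - x" using res_op_eq(1)[OF assms, of x] by simp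
    then show ?thesis unfolding bounded_opD(2)[OF A] by (simp add: cvs.scale_right_diff_distrib)
  qed
  have "(A ^^ Suc n) ?y = (A ^^ n) (A ?y)" by (simp add: funpow_swap1)
  also have "\<dots> = scaleC z ((A ^^ n) ?y) - scaleC z ((A ^^ n) x)"
    unfolding 1 by (simp only: bounded_op_simps(3)[OF bounded_op_funpow[OF A]] An)
  finally have "scaleC (z ^ Suc n) ?y - (A ^^ Suc n) ?y =
      scaleC z (scaleC (z ^ n) ?y - (A ^^ n) ?y) + scaleC z ((A ^^ n) x)"
    by (simp add: cvs.scale_right_diff_distrib scaleC_scaleC)
  also have "\<dots> = (\<Sum>j<n. scaleC (z ^ (Suc n - j)) ((A ^^ j) x)) + scaleC z ((A ^^ n) x)"
    unfolding Suc.IH by (simp add: cvs.scale_sum_right scaleC_scaleC Suc_diff_le)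
  also have "\<dots> = (\<Sum>j<Suc n. scaleC (z ^ (Suc n - j)) ((A ^^ j) x))" by simp
  finally show ?case .
qed simp

text \<open>The projection belongs to the circle of radius a. The room up to b accommodates the
  second radius a 2^(1/n) used to show that it is idempotent.\<close>

locale resolvent_annulus =
  fixes A :: "'a::complex_banach \<Rightarrow> 'a" and a b C :: real
  assumes A: "bounded_op A" and a_pos: "0 < a" and a_less_b: "a < b" and C_pos: "0 < C"
    and res: "\<And>z. a \<le> cmod z \<Longrightarrow> cmod z \<le> b \<Longrightarrow> bij (shift A z)"
    and bound: "\<And>z x. a \<le> cmod z \<Longrightarrow> cmod z \<le> b \<Longrightarrow> norm x \<le> C * norm (shift A z x)"
begin

definition pt :: "real \<Rightarrow> real \<Rightarrow> complex" where
  "pt r t = of_real r * cis (2 * pi * t)"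

text \<open>A Riemann sum for (1 / (2 pi i)) times the integral of (z - A)^(-1) / z dz; the
  parametrization by [0, 1] turns dz / (2 pi i z) into dt.\<close>

definition mean :: "nat \<Rightarrow> real \<Rightarrow> 'a \<Rightarrow> 'a" where
  "mean n r x = (1 / real n) *\<^sub>R (\<Sum>k<n. res_op A (pt r (real k / real n)) x)"

text \<open>Because z (z - A)^(-1) = 1 + A (z - A)^(-1), this is a Riemann sum for the Riesz
  projection. In this form the limit is visibly I + A V with V the limit of
  \<open>mean\<close>.\<close>

definition proj :: "nat \<Rightarrow> real \<Rightarrow> 'a \<Rightarrow> 'a" where
  "proj n r x = x + A (mean n r x)"

lemma cmod_pt: "a \<le> r \<Longrightarrow> cmod (pt r t) = r"
  using a_pos by (simp add: pt_def norm_mult)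

lemma bij_pt: "a \<le> r \<Longrightarrow> r \<le> b \<Longrightarrow> bij (shift A (pt r t))"
  by (rule res) (simp_all add: cmod_pt)

lemma bound_pt: "a \<le> r \<Longrightarrow> r \<le> b \<Longrightarrow> norm x \<le> C * norm (shift A (pt r t) x)"
  by (rule bound) (simp_all add: cmod_pt)

lemma norm_res_op: "a \<le> r \<Longrightarrow> r \<le> b \<Longrightarrow> norm (res_op A (pt r t) x) \<le> C * norm x"
  using bound_pt[of r "res_op A (pt r t) x" t] by (simp add: shift_res_op[OF A bij_pt])

lemma mean_linear:
  assumes r: "a \<le> r" "r \<le> b"
  shows "mean n r (x + y) = mean n r x + mean n r y" "mean n r (scaleC c x) = scaleC c (mean n r x)"
    "A (mean n r x) = mean n r (A x)"
  unfolding mean_def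
  by (simp_all add: res_op_linear[OF A bij_pt[OF r]] sum.distrib scaleR_add_right bounded_op_simps[OF A]
      scaleC.scaleR_right cvs.scale_sum_right)

lemma norm_mean:
  assumes r: "a \<le> r" "r \<le> b" and n: "n > 0"
  shows "norm (mean n r x) \<le> C * norm x"
proof -
  have "norm (\<Sum>k<n. res_op A (pt r (real k / real n)) x) \<le> (\<Sum>k<n. C * norm x)"
    by (rule sum_norm_le) (rule norm_res_op[OF r])
  then show ?thesis using n unfolding mean_def by (simp add: pos_divide_le_eq mult.commute)
qed

text \<open>The bound does not depend on n, so the radius may vary with n without changing the limit
  of the means.\<close>

lemma mean_radius:
  assumes r: "a \<le> r" "r \<le> b" and s: "a \<le> s" "s \<le> b" and n: "n > 0"
  shows "norm (mean n r x - mean n s x) \<le> C * C * \<bar>r - s\<bar> * norm x"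
proof -
  let ?R = "\<lambda>r k. res_op A (pt r (real k / real n)) x"
  have le: "norm (?R r k - ?R s k) \<le> C * C * \<bar>r - s\<bar> * norm x" for k
  proof -
    have "pt r t - pt s t = of_real (r - s) * cis (2 * pi * t)" for t by (simp add: pt_def algebra_simps)
    then have "cmod (pt r t - pt s t) = \<bar>r - s\<bar>" for t by (simp only: norm_mult norm_of_real norm_cis) simp
    moreover have "norm (?R r k - ?R s k) \<le> C * C * cmod (pt r (real k / real n) - pt s (real k / real n)) * norm x"
      by (rule res_op_lipschitz[OF A bij_pt[OF r] bij_pt[OF s] bound_pt[OF r] bound_pt[OF s] C_pos])
    ultimately show ?thesis by simp
  qed
  have "mean n r x - mean n s x = (1 / real n) *\<^sub>R (\<Sum>k<n. ?R r k - ?R s k)"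
    by (simp add: mean_def sum_subtractf scaleR_diff_right)
  moreover have "norm (\<Sum>k<n. ?R r k - ?R s k) \<le> (\<Sum>k<n. C * C * \<bar>r - s\<bar> * norm x)"
    by (rule sum_norm_le) (rule le)
  ultimately show ?thesis using n by (simp add: pos_divide_le_eq mult.commute)
qed

text \<open>Up to the factor \<open>norm x\<close>, the Lipschitz constant of the resolvent along
  the circle: \<open>C * C\<close> from its dependence on z, and 2 pi a for the speed of the
  parametrization.\<close>

definition rate :: real where "rate = C * C * a * (2 * pi)"

lemma mean_limit: "\<exists>l. \<forall>n>0. norm (mean n a x - l) \<le> rate * norm x / real n"
proof -
  have ab: "a \<le> a" "a \<le> b" using a_less_b by auto
  have Lip: "norm (res_op A (pt a s) x - res_op A (pt a t) x) \<le> (rate * norm x) * \<bar>s - t\<bar>" for s t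
  proof -
    have "pt a s - pt a t = of_real a * (cis (2 * pi * s) - cis (2 * pi * t))"
      by (simp add: pt_def algebra_simps)
    then have "cmod (pt a s - pt a t) = a * cmod (cis (2 * pi * s) - cis (2 * pi * t))"
      using a_pos by (simp add: norm_mult)
    also have "\<dots> \<le> a * \<bar>2 * pi * s - 2 * pi * t\<bar>"
      using a_pos by (intro mult_left_mono cmod_cis_diff_le) auto
    also have "2 * pi * s - 2 * pi * t = (2 * pi) * (s - t)" by (simp add: algebra_simps)
    finally have d: "cmod (pt a s - pt a t) \<le> a * (2 * pi) * \<bar>s - t\<bar>" by (simp add: abs_mult)
    have "norm (res_op A (pt a s) x - res_op A (pt a t) x) \<le> C * C * cmod (pt a s - pt a t) * norm x"
      by (rule res_op_lipschitz[OF A bij_pt[OF ab] bij_pt[OF ab] bound_pt[OF ab] bound_pt[OF ab] C_pos])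
    also have "\<dots> \<le> C * C * (a * (2 * pi) * \<bar>s - t\<bar>) * norm x"
      using d C_pos by (intro mult_right_mono mult_left_mono) auto
    finally show ?thesis by (simp add: rate_def mult_ac)
  qed
  obtain l where "\<And>n. n > 0 \<Longrightarrow>
      norm ((1 / real n) *\<^sub>R (\<Sum>k<n. res_op A (pt a (real k / real n)) x) - l) \<le> rate * norm x / real n"
    using riemann_means_converge[of "\<lambda>t. res_op A (pt a t) x", OF Lip] by blast
  then show ?thesis unfolding mean_def by blast
qed

lemma proj_linear:
  assumes r: "a \<le> r" "r \<le> b"
  shows "proj n r (x + y) = proj n r x + proj n r y" "proj n r (scaleC c x) = scaleC c (proj n r x)"
    "A (proj n r x) = proj n r (A x)"
  unfolding proj_def
  by (simp_all add: mean_linear(1,2)[OF r] mean_linear(3)[OF r, symmetric] bounded_opD[OF A] scaleC_add_right)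

lemma proj_diff: "a \<le> r \<Longrightarrow> r \<le> b \<Longrightarrow> proj n r (x - y) = proj n r x - proj n r y"
  using proj_linear(1)[of r n "x - y" y] by simp

lemma proj_funpow: "a \<le> r \<Longrightarrow> r \<le> b \<Longrightarrow> (A ^^ m) (proj n r x) = proj n r ((A ^^ m) x)"
  by (induction m) (simp_all add: proj_linear)

text \<open>The average of the functions z / (z - w) over the vertices z of a regular n-gon of radius r
  is 1 / (1 - (w/r)^n), so the operator below is the inverse of 1 - (A/r)^n.\<close>

lemma funpow_proj:
  assumes r: "a \<le> r" "r \<le> b" and n: "n > 0"
  shows "(A ^^ n) (proj n r x) = scaleC (of_real r ^ n) (proj n r x - x)"
proof -
  let ?z = "\<lambda>k. pt r (real k / real n)"
  let ?Y = "\<lambda>k. scaleC (?z k) (res_op A (?z k) x)"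
  note An = bounded_op_funpow[OF A, of n]
  have Y: "?Y k = x + A (res_op A (?z k) x)" for k using res_op_eq(1)[OF A bij_pt[OF r]] .
  have P: "proj n r x = (1 / real n) *\<^sub>R (\<Sum>k<n. ?Y k)"
    unfolding proj_def mean_def Y using n
    by (simp add: sum.distrib scaleR_add_right bounded_op_simps[OF A] sum_constant_scaleR)
  have zn: "?z k ^ n = of_real r ^ n" for k
  proof -
    have e: "real n * (2 * pi * (real k / real n)) = 2 * pi * real k" using n by simp
    have "cis (2 * pi * (real k / real n)) ^ n = 1" by (subst Complex.DeMoivre, subst e) simp
    then show ?thesis by (simp add: pt_def power_mult_distrib)
  qed
  have "scaleC (of_real r ^ n) (\<Sum>k<n. ?Y k) - (A ^^ n) (\<Sum>k<n. ?Y k)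
     = (\<Sum>k<n. scaleC (?z k ^ n) (?Y k) - (A ^^ n) (?Y k))"
    by (simp only: zn bounded_op_simps(4)[OF An] cvs.scale_sum_right sum_subtractf)
  also have "\<dots> = (\<Sum>k<n. \<Sum>j<n. scaleC (?z k ^ (n - j)) ((A ^^ j) x))"
    by (simp only: res_op_power[OF A bij_pt[OF r]])
  also have "\<dots> = (\<Sum>j<n. scaleC (\<Sum>k<n. ?z k ^ (n - j)) ((A ^^ j) x))"
    by (subst sum.swap) (simp only: cvs.scale_sum_left)
  \<comment> \<open>The power sums over the nodes vanish unless the exponent n - j equals n.\<close>
  also have "\<dots> = (\<Sum>j<n. if j = 0 then scaleC (of_nat n * of_real r ^ n) x else 0)"
  proof (rule sum.cong)
    fix j assume j: "j \<in> {..<n}"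
    have e: "n - j = n \<longleftrightarrow> j = 0" using n by linarith
    have "(\<Sum>k<n. ?z k ^ (n - j)) = (if n - j = n then of_nat n * of_real r ^ n else 0)"
      unfolding pt_def by (rule sum_circle_powers) (use j in auto)
    then show "scaleC (\<Sum>k<n. ?z k ^ (n - j)) ((A ^^ j) x) =
        (if j = 0 then scaleC (of_nat n * of_real r ^ n) x else 0)"
      unfolding e by simp
  qed simp
  also have "\<dots> = scaleC (of_nat n * of_real r ^ n) x" using n by simp
  finally have "(1 / real n) *\<^sub>R (scaleC (of_real r ^ n) (\<Sum>k<n. ?Y k) - (A ^^ n) (\<Sum>k<n. ?Y k)) =
      (1 / real n) *\<^sub>R scaleC (of_nat n * of_real r ^ n) x" by (rule arg_cong)
  moreover have "(1 / real n) *\<^sub>R scaleC (of_nat n * of_real r ^ n) x = scaleC (of_real r ^ n) x"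
    using n by (simp add: scaleC_of_real[symmetric] scaleC_scaleC)
  ultimately have "scaleC (of_real r ^ n) (proj n r x) - (A ^^ n) (proj n r x) = scaleC (of_real r ^ n) x"
    unfolding P by (simp only: scaleR_diff_right scaleC.scaleR_right bounded_op_simps(5)[OF An])
  then show ?thesis by (simp add: cvs.scale_right_diff_distrib algebra_simps)
qed

text \<open>With u = (A/r)^n this is the partial fraction identity for 1/(1-u) and 1/(1-u/2). It is
  obtained by evaluating A^n on the product in two ways and cancelling r^n. When both radii tend to
  a, it becomes P P = 2 P - P.\<close>

lemma proj_mult:
  assumes r: "a \<le> r" "r \<le> b" and s: "a \<le> s" "s \<le> b" and n: "n > 0" and rs: "s ^ n = 2 * r ^ n"
  shows "proj n r (proj n s x) = scaleC 2 (proj n r x) - proj n s x"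
proof -
  have s2: "scaleC (of_real s ^ n) u = scaleC (of_real r ^ n) (scaleC 2 u)" for u :: 'a
  proof -
    have "(of_real s :: complex) ^ n = of_real r ^ n * 2"
      by (simp only: of_real_power[symmetric] rs) simp
    then show ?thesis by (simp only: scaleC_scaleC)
  qed
  have "(A ^^ n) (proj n r (proj n s x)) = scaleC (of_real r ^ n) (proj n r (proj n s x) - proj n s x)"
    by (rule funpow_proj[OF r n])
  moreover have "(A ^^ n) (proj n r (proj n s x)) = proj n r (scaleC (of_real s ^ n) (proj n s x - x))"
    by (simp only: proj_funpow[OF r] funpow_proj[OF s n])
  moreover have "\<dots> = scaleC (of_real r ^ n) (scaleC 2 (proj n r (proj n s x) - proj n r x))"
    by (simp only: proj_linear(2)[OF r] proj_diff[OF r] s2)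
  ultimately have "scaleC (of_real r ^ n) (proj n r (proj n s x) - proj n s x) =
      scaleC (of_real r ^ n) (scaleC 2 (proj n r (proj n s x) - proj n r x))" by simp
  moreover have "(of_real r :: complex) ^ n \<noteq> 0" using r a_pos by simp
  ultimately have eq: "proj n r (proj n s x) - proj n s x = scaleC 2 (proj n r (proj n s x) - proj n r x)"
    by (simp only: cvs.scale_cancel_left) simp
  have two: "scaleC 2 u = u + u" for u :: 'a
    using scaleC_add_left[of 1 1 u] by (simp add: scaleC_one)
  show ?thesis using eq unfolding two by (simp add: algebra_simps)
qed


text \<open>With P = I + A V, the vanishing of A V P expresses that P is idempotent. The bound on
  A^n P does the work of a spectral radius estimate for A on the range of P.\<close>

lemma spectral_projection:
  obtains V n where "bounded_op V" "\<And>x. A (V x) = V (A x)"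
    "\<And>x. A (V (x + A (V x))) = 0 \<and> V (A (x + A (V x))) = 0"
    "n > 0" "\<And>x. norm ((A ^^ n) (x + A (V x))) \<le> a ^ n / 2 * norm x"
proof -
  have ra: "a \<le> a" "a \<le> b" using a_less_b by auto
  obtain V where V: "\<And>x n. n > 0 \<Longrightarrow> norm (mean n a x - V x) \<le> rate * norm x / real n"
    using mean_limit by metis
  obtain K where K: "K > 0" "\<And>x. norm (A x) \<le> K * norm x" using bounded_op_bound[OF A] by blast
  have limV: "(\<lambda>n. mean n a x) \<longlonglongrightarrow> V x" for x
  proof -
    have "(\<lambda>n. mean n a x - V x) \<longlonglongrightarrow> 0"
    proof (rule Lim_null_comparison[OF _ lim_const_over_n[of "rate * norm x"]])
      show "eventually (\<lambda>n. norm (mean n a x - V x) \<le> rate * norm x / real n) sequentially"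
        using eventually_gt_at_top[of 0] by eventually_elim (rule V)
    qed
    then show ?thesis by (simp add: LIM_zero_iff)
  qed
  have V_add: "V (x + y) = V x + V y" for x y
    using LIMSEQ_unique[OF limV[of "x + y"], of "V x + V y"] tendsto_add[OF limV[of x] limV[of y]]
    by (simp add: mean_linear(1)[OF ra])
  have V_scale: "V (scaleC c x) = scaleC c (V x)" for c x
    using LIMSEQ_unique[OF limV[of "scaleC c x"], of "scaleC c (V x)"]
      scaleC.tendsto[OF tendsto_const limV[of x], of c]
    by (simp add: mean_linear(2)[OF ra])
  have AV: "A (V x) = V (A x)" for x
    using LIMSEQ_unique[OF limV[of "A x"], of "A (V x)"] bounded_op_tendsto[OF A limV[of x]]
    by (simp add: mean_linear(3)[OF ra])
  have "norm (V x) \<le> (C + rate) * norm x" for x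
  proof -
    have "norm (V x) \<le> norm (mean 1 a x) + norm (mean 1 a x - V x)"
      using norm_triangle_ineq4[of "mean 1 a x" "mean 1 a x - V x"] by simp
    then show ?thesis using norm_mean[OF ra, of 1 x] V[of 1 x] by (simp add: distrib_right)
  qed
  then have bV: "bounded_op V" by (intro bounded_opI V_add V_scale)
  define P where "P x = x + A (V x)" for x
  have bP: "bounded_op P"
    unfolding P_def by (intro bounded_op_add bounded_op_id bounded_op_compose[OF A bV])
  have AP: "A (P x) = P (A x)" for x by (simp add: P_def bounded_opD[OF A] AV)
  have projP: "norm (proj n a x - P x) \<le> K * rate / real n * norm x" if "n > 0" for n x
  proof -
    have "proj n a x - P x = A (mean n a x - V x)" by (simp add: proj_def P_def bounded_op_simps[OF A])
    then have "norm (proj n a x - P x) \<le> K * norm (mean n a x - V x)" using K(2) by simp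
    also have "\<dots> \<le> K * (rate * norm x / real n)" using V[OF that] K(1) by (intro mult_left_mono) auto
    finally show ?thesis by simp
  qed
  have limP: "(\<lambda>n. proj n a x) \<longlonglongrightarrow> P x" for x
    unfolding proj_def P_def by (intro tendsto_intros bounded_op_tendsto[OF A] limV)
  have norm_proj: "norm (proj n a x) \<le> (1 + K * C) * norm x" if "n > 0" for n x
  proof -
    have "norm (A (mean n a x)) \<le> K * (C * norm x)"
      using K(2)[of "mean n a x"] mult_left_mono[OF norm_mean[OF ra that, of x], of K] K(1) by linarith
    then show ?thesis
      unfolding proj_def using norm_triangle_ineq[of x "A (mean n a x)"] by (simp add: algebra_simps)
  qed
  \<comment> \<open>The radius with s^n = 2 a^n required by \<open>proj_mult\<close>; it tends to a,
    hence eventually lies in the annulus.\<close>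
  define s where "s n = a * root n 2" for n :: nat
  have lims: "s \<longlonglongrightarrow> a"
  proof -
    have "(\<lambda>n. a * root n 2) \<longlonglongrightarrow> a * 1" by (intro tendsto_intros LIMSEQ_root_const) auto
    then show ?thesis unfolding s_def by simp
  qed
  have ev: "eventually (\<lambda>n. n > 0 \<and> a \<le> s n \<and> s n \<le> b) sequentially"
    using eventually_gt_at_top[of 0] order_tendstoD(2)[OF lims a_less_b]
  proof eventually_elim
    case (elim n)
    have "1 \<le> root n 2" using elim by simp
    then have "a * 1 \<le> a * root n 2" using a_pos by (intro mult_left_mono) auto
    then show ?case using elim by (simp add: s_def)
  qed
  have limP': "(\<lambda>n. proj n (s n) x) \<longlonglongrightarrow> P x" for x
  proof -
    have "(\<lambda>n. K * (C * C * \<bar>s n - a\<bar> * norm x)) \<longlonglongrightarrow> K * (C * C * \<bar>a - a\<bar> * norm x)"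
      by (intro tendsto_intros lims)
    then have z: "(\<lambda>n. K * (C * C * \<bar>s n - a\<bar> * norm x)) \<longlonglongrightarrow> 0" by simp
    have "(\<lambda>n. proj n (s n) x - proj n a x) \<longlonglongrightarrow> 0"
    proof (rule Lim_null_comparison[OF _ z])
      show "eventually (\<lambda>n. norm (proj n (s n) x - proj n a x) \<le> K * (C * C * \<bar>s n - a\<bar> * norm x)) sequentially"
        using ev
      proof eventually_elim
        case (elim n)
        have "proj n (s n) x - proj n a x = A (mean n (s n) x - mean n a x)"
          by (simp add: proj_def bounded_op_simps[OF A])
        then have "norm (proj n (s n) x - proj n a x) \<le> K * norm (mean n (s n) x - mean n a x)"
          using K(2) by simp
        also have "\<dots> \<le> K * (C * C * \<bar>s n - a\<bar> * norm x)"
          using mean_radius[of "s n" a n x] elim ra K(1) by (intro mult_left_mono) auto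
        finally show ?case .
      qed
    qed
    from tendsto_add[OF this limP[of x]] show ?thesis by simp
  qed
  have PP: "P (P x) = P x" for x
  proof -
    \<comment> \<open>Here the operators act on a moving vector, so pointwise convergence is
      complemented by the uniform bound \<open>norm_proj\<close>.\<close>
    have "(\<lambda>n. proj n a (proj n (s n) x - P x)) \<longlonglongrightarrow> 0"
    proof (rule Lim_null_comparison)
      show "eventually (\<lambda>n. norm (proj n a (proj n (s n) x - P x)) \<le> (1 + K * C) * norm (proj n (s n) x - P x)) sequentially"
        using eventually_gt_at_top[of 0] by eventually_elim (rule norm_proj)
      show "(\<lambda>n. (1 + K * C) * norm (proj n (s n) x - P x)) \<longlonglongrightarrow> 0"
        using limP'[of x] by (intro tendsto_mult_right_zero tendsto_norm_zero) (simp add: LIM_zero)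
    qed
    then have "(\<lambda>n. proj n a (proj n (s n) x - P x) + proj n a (P x)) \<longlonglongrightarrow> 0 + P (P x)"
      by (intro tendsto_add limP)
    then have l1: "(\<lambda>n. proj n a (proj n (s n) x)) \<longlonglongrightarrow> P (P x)" by (simp add: proj_diff[OF ra])
    have l2: "(\<lambda>n. scaleC 2 (proj n a x) - proj n (s n) x) \<longlonglongrightarrow> scaleC 2 (P x) - P x"
      by (intro tendsto_diff scaleC.tendsto tendsto_const limP limP')
    have "eventually (\<lambda>n. scaleC 2 (proj n a x) - proj n (s n) x = proj n a (proj n (s n) x)) sequentially"
      using ev
    proof eventually_elim
      case (elim n)
      have "s n ^ n = 2 * a ^ n" using elim by (simp add: s_def power_mult_distrib)
      then show ?case using proj_mult[OF ra, of "s n" n x] elim by simp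
    qed
    from LIMSEQ_unique[OF Lim_transform_eventually[OF l2 this] l1] show ?thesis
      using scaleC_add_left[of 1 1 "P x"] by (simp add: scaleC_one)
  qed
  obtain KP where KP: "KP > 0" "\<And>x. norm (P x) \<le> KP * norm x" using bounded_op_bound[OF bP] by blast
  \<comment> \<open>The value 1/2 allows norm (z - u) to be absorbed on the left, at the price of a
    factor 2; then 1/(4 KP) makes 2 c KP \<le> 1/2.\<close>
  define c where "c = min (1/2) (1 / (4 * KP))"
  have "c > 0" using KP by (simp add: c_def)
  then have "eventually (\<lambda>n. K * rate / real n < c) sequentially"
    by (rule order_tendstoD(2)[OF lim_const_over_n])
  then have "eventually (\<lambda>n. n > 0 \<and> K * rate / real n < c) sequentially"
    using eventually_gt_at_top[of 0] by eventually_elim simp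
  then obtain n where n: "n > 0" "K * rate / real n < c" by (auto simp: eventually_sequentially)
  have pw: "norm ((A ^^ n) (P x)) \<le> a ^ n / 2 * norm x" for x
  proof -
    define z where "z = P x"
    \<comment> \<open>u = (1 - (A/a)^n) z, so \<open>proj n a\<close> sends u back to z while P
      fixes u. Hence (A/a)^n z = z - u = (proj n a - P) u, which is small because the two operators
      are close in norm.\<close>
    define u where "u = z - scaleC (1 / of_real a ^ n) ((A ^^ n) z)"
    have a0: "(of_real a :: complex) ^ n \<noteq> 0" using a_pos by simp
    have "P ((A ^^ n) y) = (A ^^ n) (P y)" for y using funpow_commute_op[of A P, OF AP] by simp
    then have Pu: "P u = u" by (simp add: u_def z_def bounded_op_simps[OF bP] bounded_opD[OF bP] PP)
    have "proj n a u = proj n a z - scaleC (1 / of_real a ^ n) ((A ^^ n) (proj n a z))"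
      unfolding u_def by (simp only: proj_diff[OF ra] proj_linear(2)[OF ra] proj_funpow[OF ra])
    also have "\<dots> = z" using a_pos by (simp add: funpow_proj[OF ra n(1)] scaleC_scaleC scaleC_one)
    finally have zu: "z - u = proj n a u - P u" using Pu by simp
    have "norm (z - u) \<le> K * rate / real n * norm u" unfolding zu by (rule projP[OF n(1)])
    also have "\<dots> \<le> c * norm u" using n(2) by (intro mult_right_mono) auto
    also have "\<dots> \<le> c * (norm z + norm (z - u))"
      using \<open>c > 0\<close> norm_triangle_ineq4[of z "z - u"] by (intro mult_left_mono) auto
    also have "\<dots> \<le> c * norm z + (1/2) * norm (z - u)"
      unfolding distrib_left by (intro add_left_mono mult_right_mono) (auto simp: c_def)
    finally have "norm (z - u) \<le> 2 * c * norm z" by simp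
    also have "\<dots> \<le> 2 * c * (KP * norm x)" using KP(2)[of x] \<open>c > 0\<close> by (intro mult_left_mono) (auto simp: z_def)
    also have "\<dots> = (2 * c * KP) * norm x" by simp
    also have "\<dots> \<le> (1/2) * norm x"
    proof (rule mult_right_mono)
      have "c * KP \<le> 1 / (4 * KP) * KP" using KP(1) by (intro mult_right_mono) (auto simp: c_def)
      then show "2 * c * KP \<le> 1/2" using KP(1) by simp
    qed simp
    finally have d: "norm (z - u) \<le> norm x / 2" by simp
    have "(A ^^ n) z = scaleC (of_real a ^ n) (z - u)"
      using a_pos by (simp add: u_def scaleC_scaleC scaleC_one)
    then have "norm ((A ^^ n) z) = a ^ n * norm (z - u)"
      using a_pos by (simp add: norm_scaleC norm_power)
    also have "\<dots> \<le> a ^ n * (norm x / 2)" using d a_pos by (intro mult_left_mono) auto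
    finally show ?thesis by (simp add: z_def)
  qed
  have "A (V (P x)) = 0" for x using PP[of x] by (simp add: P_def[of "P x"])
  then have "A (V (x + A (V x))) = 0 \<and> V (A (x + A (V x))) = 0" for x using AV by (simp add: P_def)
  then show ?thesis using that[OF bV AV _ n(1)] pw by (simp add: P_def)
qed

end

section \<open>Generalized Drazin-Riesz invertibility\<close>

lemma Phi_uminus:
  assumes "bounded_op S" "Phi S" shows "Phi (\<lambda>x. - S x)"
proof -
  have u: "bounded_op (uminus :: 'a \<Rightarrow> 'a)" using bounded_op_minus[OF bounded_op_id] .
  have "bij (uminus :: 'a \<Rightarrow> 'a)" by (rule bij_uminus)
  then show ?thesis using Phi_compose[OF u assms(1) bij_imp_Phi[OF u] assms(2)] by simp
qed

text \<open>W^n - \<nu>^n has W - \<nu> as a left factor, which gives surjectivity; an eigenvector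
  of W for \<nu> is one of W^n for \<nu>^n, which gives injectivity. A norm bound on a power thereby
  yields information on W.\<close>

lemma bij_shift_of_funpow:
  assumes W: "bounded_op W" and bij: "bij (shift (W ^^ n) (\<nu> ^ n))"
  shows "bij (shift W \<nu>)"
proof -
  have "\<exists>G. \<forall>x. shift (W ^^ n) (\<nu> ^ n) x = shift W \<nu> (G x)" for n
  proof (induction n)
    case 0
    have "shift (W ^^ 0) (\<nu> ^ 0) x = shift W \<nu> 0" for x
      using bounded_op_simps(1)[OF bounded_op_shift[OF W]] by (simp add: shift_def scaleC_one)
    then show ?case by (intro exI[of _ "\<lambda>_. 0"]) blast
  next
    case (Suc n)
    then obtain G where G: "\<And>x. shift (W ^^ n) (\<nu> ^ n) x = shift W \<nu> (G x)" by blast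
    have "shift (W ^^ Suc n) (\<nu> ^ Suc n) x = shift W \<nu> ((W ^^ n) x + scaleC \<nu> (G x))" for x
    proof -
      have "shift W \<nu> ((W ^^ n) x + scaleC \<nu> (G x)) = shift W \<nu> ((W ^^ n) x) + scaleC \<nu> (shift W \<nu> (G x))"
        by (simp only: bounded_opD[OF bounded_op_shift[OF W]])
      also have "\<dots> = shift W \<nu> ((W ^^ n) x) + scaleC \<nu> (shift (W ^^ n) (\<nu> ^ n) x)" by (simp only: G)
      also have "\<dots> = shift (W ^^ Suc n) (\<nu> ^ Suc n) x"
        by (simp add: shift_def cvs.scale_right_diff_distrib scaleC_scaleC)
      finally show ?thesis by simp
    qed
    then show ?case by (intro exI[of _ "\<lambda>x. (W ^^ n) x + scaleC \<nu> (G x)"]) blast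
  qed
  then obtain G where G: "\<And>x. shift (W ^^ n) (\<nu> ^ n) x = shift W \<nu> (G x)" by blast
  have "y \<in> range (shift W \<nu>)" for y
  proof -
    obtain x where "y = shift (W ^^ n) (\<nu> ^ n) x" using bij by (metis bij_def surjD)
    then show ?thesis using G by blast
  qed
  then have surj: "range (shift W \<nu>) = UNIV" by blast
  have "x = 0" if x: "x \<in> ker_on UNIV (shift W \<nu>)" for x
  proof -
    have "W x = scaleC \<nu> x" using x by (simp add: ker_on_def shift_def)
    then have "(W ^^ k) x = scaleC (\<nu> ^ k) x" for k
      by (induction k) (simp_all add: scaleC_one bounded_opD[OF W] scaleC_scaleC mult.commute)
    then have "shift (W ^^ n) (\<nu> ^ n) x = shift (W ^^ n) (\<nu> ^ n) 0"
      using bounded_op_simps(1)[OF bounded_op_funpow[OF W]] by (simp add: shift_def)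
    then show ?thesis using bij by (meson bij_def injD)
  qed
  then have "ker_on UNIV (shift W \<nu>) = {0}"
    using bounded_op_simps(1)[OF bounded_op_shift[OF W]] by (auto simp: ker_on_def)
  then have "inj (shift W \<nu>)" using inj_on_subspace_iff[OF bounded_op_shift[OF W] cvs.subspace_UNIV] by blast
  then show ?thesis using surj by (simp add: bij_def)
qed

text \<open>A P acts as A on the range of P and as 0 on its kernel, where the shift is the
  invertible scalar -\<nu>. So kernel and cokernel come from the range of P, where they are
  controlled by those of A - \<nu>.\<close>

lemma Phi_shift_compression:
  assumes A: "bounded_op A" and P: "bounded_op P" and comm: "\<And>x. A (P x) = P (A x)"
    and idem: "\<And>x. P (P x) = P x" and nu: "\<nu> \<noteq> 0" and F: "Phi (shift A \<nu>)"
  shows "Phi (shift (\<lambda>x. A (P x)) \<nu>)"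
proof -
  let ?B = "shift (\<lambda>x. A (P x)) \<nu>"
  have W: "bounded_op (\<lambda>x. A (P x))" by (rule bounded_op_compose[OF A P])
  note bB = bounded_op_shift[OF W, of \<nu>]
  have k: "cfin_dim (ker_on UNIV (shift A \<nu>))" and c: "fin_codim UNIV (range (shift A \<nu>))"
    using F by (auto simp: Phi_iff[OF bounded_op_shift[OF A]])
  have "ker_on UNIV ?B \<subseteq> ker_on UNIV (shift A \<nu>)"
  proof
    fix x assume "x \<in> ker_on UNIV ?B"
    then have x: "A (P x) = scaleC \<nu> x" by (simp add: ker_on_def shift_def)
    have "P (A (P x)) = A (P x)" by (simp add: comm[symmetric] idem)
    then have "scaleC \<nu> (P x) = scaleC \<nu> x" by (simp add: x bounded_opD[OF P])
    then have "P x = x" using nu by simp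
    then show "x \<in> ker_on UNIV (shift A \<nu>)" using x by (simp add: ker_on_def shift_def)
  qed
  then have kB: "cfin_dim (ker_on UNIV ?B)" using k cfin_dim_subset by blast
  obtain D where D: "finite D" "\<And>x. \<exists>r\<in>range (shift A \<nu>). \<exists>f\<in>cvs.span D. x = r + f"
    using c by (auto simp: fin_codim_UNIV_iff)
  have "\<exists>r\<in>range ?B. \<exists>f\<in>cvs.span (P ` D). x = r + f" for x
  proof -
    obtain y f where y: "x = shift A \<nu> y + f" "f \<in> cvs.span D" using D(2) by blast
    have 1: "P (shift A \<nu> y) = ?B (P y)"
      by (simp add: shift_def idem comm bounded_op_simps[OF P] bounded_opD[OF P])
    \<comment> \<open>The component of x in the kernel of P is solved for exactly by dividing by
      \<nu>; only the other component needs the finite-dimensional correction P f.\<close>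
    have 2: "?B (scaleC (1/\<nu>) (x - P x)) = P x - x"
      using nu by (simp add: shift_def idem bounded_op_simps[OF P] bounded_opD[OF P] bounded_op_simps[OF A]
          bounded_opD[OF A] scaleC_scaleC scaleC_one)
    have "?B (P y - scaleC (1/\<nu>) (x - P x)) = P (shift A \<nu> y) - (P x - x)"
      by (simp only: bounded_op_simps(3)[OF bB] 1 2)
    also have "P (shift A \<nu> y) = P x - P f" by (simp add: y(1) bounded_opD[OF P])
    finally have "x = ?B (P y - scaleC (1/\<nu>) (x - P x)) + P f" by simp
    moreover have "P f \<in> cvs.span (P ` D)"
      using y(2) module_hom.span_image[OF bounded_op_linear[OF P], of D] by auto
    ultimately show ?thesis by blast
  qed
  then have "fin_codim UNIV (range ?B)"
    unfolding fin_codim_UNIV_iff using D(1) by (intro exI[of _ "P ` D"]) blast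
  then show ?thesis using kB by (simp add: Phi_iff[OF bB])
qed

text \<open>A S A - A turns out to be -A P. Its shift by \<mu> with |\<mu>| \<le> a is Fredholm by
  compression of A, and for |\<mu>| > a it is bijective by the bound on the n-th power.\<close>

lemma (in resolvent_annulus) gDR_invertible_of_Phi:
  assumes F: "\<And>\<nu>. \<nu> \<noteq> 0 \<Longrightarrow> cmod \<nu> \<le> a \<Longrightarrow> Phi (shift A \<nu>)"
  shows "gDR_invertible A"
proof -
  obtain V n where V: "bounded_op V" "\<And>x. A (V x) = V (A x)"
    "\<And>x. A (V (x + A (V x))) = 0 \<and> V (A (x + A (V x))) = 0"
    and n: "n > 0" "\<And>x. norm ((A ^^ n) (x + A (V x))) \<le> a ^ n / 2 * norm x"
    using spectral_projection by blast
  define P where "P x = x + A (V x)" for x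
  have bP: "bounded_op P"
    unfolding P_def by (intro bounded_op_add bounded_op_id bounded_op_compose[OF A V(1)])
  have AP: "A (P x) = P (A x)" for x by (simp add: P_def bounded_opD[OF A] V(2))
  have AVP: "A (V (P x)) = 0" for x using V(3) by (simp add: P_def)
  have PP: "P (P x) = P x" for x using AVP[of x] by (simp add: P_def[of "P x"])
  have AV: "A (V x) = P x - x" for x by (simp add: P_def)
  have VA: "V (A x) = P x - x" for x using AV V(2) by simp
  \<comment> \<open>V acts as -A^(-1) on the kernel of P. The product V A V restores the sign and
    vanishes on the range of P because A V P = 0.\<close>
  define S where "S x = V (A (V x))" for x
  have AS: "A (S x) = x - P x" for x
  proof -
    have "A (S x) = P (A (V x)) - A (V x)" unfolding S_def by (rule AV)
    then show ?thesis by (simp add: AV bounded_op_simps[OF bP] PP)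
  qed
  define W where "W x = A (P x)" for x
  have bW: "bounded_op W" unfolding W_def by (rule bounded_op_compose[OF A bP])
  have "bounded_op S" unfolding S_def by (intro bounded_op_compose[OF V(1)] bounded_op_compose[OF A] V(1))
  moreover have "A \<circ> S = S \<circ> A" by (rule ext) (simp add: S_def V(2))
  moreover have "S \<circ> A \<circ> S = S"
  proof
    fix x
    have "(S \<circ> A \<circ> S) x = V (A (V (x - P x)))" by (simp add: AS) (simp add: S_def)
    also have "V (x - P x) = V x - V (P x)" by (rule bounded_op_simps(3)[OF V(1)])
    also have "A (V x - V (P x)) = A (V x)" by (simp add: bounded_op_simps[OF A] AVP)
    finally show "(S \<circ> A \<circ> S) x = S x" by (simp add: S_def)
  qed
  moreover have "is_riesz (\<lambda>x. A (S (A x)) - A x)"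
    unfolding is_riesz_def riesz_on_def fredholm_on_UNIV_iff
  proof (intro allI impI)
    fix \<mu> :: complex assume mu: "\<mu> \<noteq> 0"
    have eq: "shift (\<lambda>x. A (S (A x)) - A x) \<mu> = (\<lambda>x. - shift W (- \<mu>) x)"
      by (rule ext) (simp add: shift_def AS W_def AP)
    have "Phi (shift W (- \<mu>))"
    proof (cases "cmod \<mu> \<le> a")
      case True
      then show ?thesis
        unfolding W_def using mu F[of "- \<mu>"] by (intro Phi_shift_compression[OF A bP AP PP]) auto
    next
      case False
      have Wk: "(W ^^ Suc k) x = (A ^^ Suc k) (P x)" for k x
      proof (induction k)
        case (Suc k)
        have "(W ^^ Suc (Suc k)) x = A (P ((A ^^ Suc k) (P x)))" 
          unfolding funpow.simps(2)[of "Suc k"] o_apply Suc by (rule W_def)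
        also have "P ((A ^^ Suc k) (P x)) = (A ^^ Suc k) (P (P x))"
          by (rule funpow_commute_op[of A P, OF AP, symmetric])
        finally show ?case by (simp add: PP)
      qed (simp add: W_def)
      have Wn: "(W ^^ n) x = (A ^^ n) (P x)" for x using Wk[of "n - 1" x] n(1) by simp
      have "bij (shift (W ^^ n) ((- \<mu>) ^ n))"
      proof (rule bij_shift_of_norm_less[OF bounded_op_funpow[OF bW]])
        show "norm ((W ^^ n) x) \<le> a ^ n / 2 * norm x" for x using n(2)[of x] by (simp add: Wn P_def)
        show "0 \<le> a ^ n / 2" using a_pos by simp
        \<comment> \<open>The factor 1/2 supplies strict inequality, uniformly for all |\<mu>| \<ge>
          a.\<close>
        have "a ^ n / 2 < a ^ n" using a_pos by simp
        also have "a ^ n \<le> cmod \<mu> ^ n" using False a_pos by (intro power_mono) auto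
        finally show "a ^ n / 2 < cmod ((- \<mu>) ^ n)" by (simp add: norm_power)
      qed
      then have "bij (shift W (- \<mu>))" by (rule bij_shift_of_funpow[OF bW])
      then show ?thesis by (rule bij_imp_Phi[OF bounded_op_shift[OF bW]])
    qed
    then show "Phi (shift (\<lambda>x. A (S (A x)) - A x) \<mu>)"
      unfolding eq by (rule Phi_uminus[OF bounded_op_shift[OF bW]])
  qed
  ultimately show ?thesis unfolding gDR_invertible_def by blast
qed

text \<open>Near \<kappa> all other points are Browder, hence isolated in the spectrum, although the
  spectrum may accumulate at \<kappa> itself. A circle around \<kappa> avoiding it still exists,
  because an annulus away from the centre contains only finitely many spectral points.\<close>

lemma gDR_empty_of_finite_spec_Browder:
  assumes T: "bounded_op T" and fin: "finite (spec Browder T)"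
  shows "sigma_gDR T = {}"
proof -
  have "gDR_invertible (shift T \<kappa>)" for \<kappa>
  proof -
    define A where "A = shift T \<kappa>"
    have A: "bounded_op A" unfolding A_def by (rule bounded_op_shift[OF T])
    have "open (- (spec Browder T - {\<kappa>}))" using fin by (intro open_Compl finite_imp_closed) auto
    then obtain d0 where d0: "d0 > 0" "ball \<kappa> d0 \<subseteq> - (spec Browder T - {\<kappa>})"
      using open_contains_ball by (metis ComplI DiffE singletonI)
    define d where "d = d0 / 2"
    have d: "d > 0" using d0 by (simp add: d_def)
    have Br: "Browder (shift A \<nu>)" if "\<nu> \<noteq> 0" "cmod \<nu> \<le> d" for \<nu>
    proof -
      have "\<kappa> + \<nu> \<in> ball \<kappa> d0" using that d0(1) by (simp add: dist_norm d_def)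
      then show ?thesis using d0(2) that by (auto simp: A_def shift_shift spec_def)
    qed
    \<comment> \<open>Removing the inner disc keeps any limit point of these spectral points away
      from 0, where it would have to be isolated.\<close>
    define W where "W = (cball 0 d - ball 0 (d / 2)) - resolvent A"
    have cW: "compact W"
      unfolding W_def by (intro compact_diff compact_cball open_ball open_resolvent[OF A])
    have "finite W"
    proof (rule ccontr)
      assume "infinite W"
      then obtain z where z: "z \<in> W" "z islimpt W"
        using cW unfolding compact_eq_Bolzano_Weierstrass by blast
      have "z \<noteq> 0" "cmod z \<le> d" using z(1) d by (auto simp: W_def)
      then have "core_nilpotent (shift A z)"
        using Browder_imp_core_nilpotent[OF bounded_op_shift[OF A]] Br by blast
      then obtain \<epsilon> where e: "\<epsilon> > 0" "ball z \<epsilon> - {z} \<subseteq> resolvent A"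
        using core_nilpotent_isolated[OF A] by blast
      obtain w where "w \<in> W" "w \<noteq> z" "dist w z < \<epsilon>" using z(2) e(1) unfolding islimpt_approachable by blast
      then have "w \<in> ball z \<epsilon> - {z}" "w \<notin> resolvent A" by (auto simp: W_def dist_commute)
      then show False using e(2) by blast
    qed
    then have fW: "finite (cmod ` W)" by simp
    have "infinite {d / 2<..<d}" using d by (simp add: infinite_Ioo)
    then have "\<not> {d / 2<..<d} \<subseteq> cmod ` W" using fW finite_subset by blast
    then obtain a where "a \<in> {d / 2<..<d}" and aW: "a \<notin> cmod ` W" by blast
    then have a: "d / 2 < a" "a < d" "a \<notin> cmod ` W" by simp_all
    have "open (- (cmod ` W))" using fW by (intro open_Compl finite_imp_closed)
    then obtain e where e: "e > 0" "ball a e \<subseteq> - (cmod ` W)"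
      using a(3) open_contains_ball by (metis ComplI)
    \<comment> \<open>a + e/2 stays in the gap free of moduli of \<open>W\<close>, and the cap
      \<open>d\<close> stays where \<open>W\<close> accounts for all spectral points.\<close>
    define b where "b = min (a + e / 2) d"
    have ab: "0 < a" "a < b" using a d e(1) by (auto simp: b_def)
    have ann: "z \<in> resolvent A" if z: "a \<le> cmod z" "cmod z \<le> b" for z
    proof (rule ccontr)
      assume "z \<notin> resolvent A"
      then have "z \<in> W" using z a by (auto simp: W_def b_def)
      moreover have "cmod z \<in> ball a e" using z e(1) by (auto simp: b_def dist_norm)
      ultimately show False using e(2) by auto
    qed
    have "compact (cball (0::complex) b - ball 0 a)" by (intro compact_diff compact_cball open_ball)
    moreover have "cball 0 b - ball 0 a \<subseteq> resolvent A" using ann by auto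
    ultimately obtain C where C: "C > 0"
      "\<And>z x. z \<in> cball 0 b - ball 0 a \<Longrightarrow> norm x \<le> C * norm (shift A z x)"
      using resolvent_uniform_bound[OF A] by blast
    interpret resolvent_annulus A a b C
      by unfold_locales (use A ab C ann in \<open>auto simp: resolvent_def\<close>)
    show "gDR_invertible (shift T \<kappa>)"
      using gDR_invertible_of_Phi Br a unfolding A_def Browder_def by (meson less_imp_le order_trans)
  qed
  then show ?thesis by (auto simp: sigma_gDR_def spec_def)
qed

text \<open>E = A S is an idempotent commuting with A. On its range A is invertible with inverse S,
  hence Kato; on its kernel A S A - A is -A, so A inherits the Riesz property.\<close>

lemma gKR_decomposable_of_gDR_invertible:
  assumes A: "bounded_op A" and g: "gDR_invertible A"
  shows "gKR_decomposable A"
proof -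
  obtain S where S: "bounded_op S" "\<And>x. A (S x) = S (A x)" "\<And>x. S (A (S x)) = S x"
    and rz: "is_riesz (\<lambda>x. A (S (A x)) - A x)"
    using g unfolding gDR_invertible_def fun_eq_iff o_def by blast
  define E where "E x = A (S x)" for x
  have bE: "bounded_op E" unfolding E_def by (rule bounded_op_compose[OF A S(1)])
  have EE: "E (E x) = E x" for x by (simp add: E_def S(3))
  have AE: "A (E x) = E (A x)" for x by (simp add: E_def S(2))
  have ES: "E (S x) = S x" for x
  proof -
    have "E (S x) = S (A (S x))" unfolding E_def by (rule S(2))
    then show ?thesis by (simp add: S(3))
  qed
  define M where "M = range E"
  define N where "N = ker_on UNIV E"
  have ME: "x \<in> M \<longleftrightarrow> E x = x" for x unfolding M_def using EE by (metis rangeE rangeI)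
  have NE: "x \<in> N \<longleftrightarrow> E x = 0" for x by (simp add: N_def ker_on_def)
  have "M = ker_on UNIV (\<lambda>x. E x - x)" by (auto simp: ME ker_on_def)
  then have clM: "closed M" using closed_ker_on[OF bounded_op_diff[OF bE bounded_op_id] closed_UNIV] by simp
  have clN: "closed N" unfolding N_def by (rule closed_ker_on[OF bE closed_UNIV])
  have sM: "cvs.subspace M" unfolding M_def by (rule subspace_range_op[OF bE])
  have sN: "cvs.subspace N" unfolding N_def by (rule subspace_ker_on[OF bE cvs.subspace_UNIV])
  have AM: "A ` M \<subseteq> M" by (auto simp: ME AE[symmetric])
  have AN: "A ` N \<subseteq> N" by (auto simp: NE AE[symmetric] bounded_op_simps[OF A])
  have xE: "x - E x \<in> N" for x by (simp add: NE bounded_op_simps[OF bE] EE)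
  have ds: "direct_sum M N" unfolding direct_sum_def
  proof
    have "0 \<in> M \<inter> N" using sM sN cvs.subspace_0 by blast
    moreover have "M \<inter> N \<subseteq> {0}" using ME NE by auto
    ultimately show "M \<inter> N = {0}" by blast
    show "\<forall>x. \<exists>m\<in>M. \<exists>n\<in>N. x = m + n"
    proof
      fix x
      have "x = E x + (x - E x)" by simp
      moreover have "E x \<in> M" by (simp add: M_def)
      ultimately show "\<exists>m\<in>M. \<exists>n\<in>N. x = m + n" using xE by blast
    qed
  qed
  have "M \<subseteq> A ` M"
  proof
    fix y assume "y \<in> M"
    then have "y = A (S y)" by (simp add: ME E_def)
    moreover have "S y \<in> M" by (simp add: ME ES)
    ultimately show "y \<in> A ` M" by blast
  qed
  then have AMM: "A ` M = M" using AM by blast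
  have "ker_on M A \<subseteq> {0}"
  proof
    fix x assume "x \<in> ker_on M A"
    then have "E x = x" "A x = 0" by (auto simp: ker_on_def ME)
    moreover have "E x = S (A x)" unfolding E_def by (rule S(2))
    ultimately show "x \<in> {0}" by (simp add: bounded_op_simps[OF S(1)])
  qed
  moreover have "0 \<in> (A ^^ n) ` M" for n
    by (rule cvs.subspace_0[OF subspace_image_op[OF bounded_op_funpow[OF A] sM]])
  ultimately have kato: "kato_on M A" unfolding kato_on_def using clM AMM by auto
  have "riesz_on N A" unfolding riesz_on_def
  proof (intro allI impI)
    fix \<mu> :: complex assume mu: "\<mu> \<noteq> 0"
    define B where "B = (\<lambda>x. A (S (A x)) - A x)"
    have bB: "bounded_op B" unfolding B_def by (intro bounded_op_diff bounded_op_compose[OF A] bounded_op_compose[OF S(1)] A)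
    \<comment> \<open>On \<open>N\<close> this is -(A - \<mu>) and on \<open>M\<close> it is
      multiplication by \<mu>, so its Fredholm property can be read on \<open>N\<close>.\<close>
    let ?F = "shift B (- \<mu>)"
    have bF: "bounded_op ?F" by (rule bounded_op_shift[OF bB])
    have "Phi ?F" using rz mu unfolding is_riesz_def riesz_on_def fredholm_on_UNIV_iff B_def by simp
    then have k: "cfin_dim (ker_on UNIV ?F)" and c: "fin_codim UNIV (range ?F)" by (auto simp: Phi_iff[OF bF])
    have BE: "B x = E (A x) - A x" for x by (simp add: B_def E_def)
    have EF: "E (?F x) = ?F (E x)" for x
      by (simp add: shift_def BE bounded_op_simps[OF bE] bounded_opD[OF bE] AE)
    have FN: "?F x = - shift A \<mu> x" if "x \<in> N" for x
      using that AE[of x] by (simp add: shift_def BE NE bounded_op_simps[OF A])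
    have F1: "?F (x - E x) \<in> shift A \<mu> ` N" for x
    proof -
      have "?F (x - E x) = shift A \<mu> (- (x - E x))"
        unfolding FN[OF xE] bounded_op_simps(2)[OF bounded_op_shift[OF A]] by (rule refl)
      moreover have "- (x - E x) \<in> N" using xE sN by (intro cvs.subspace_neg)
      ultimately show ?thesis by blast
    qed
    have "ker_on N (shift A \<mu>) \<subseteq> ker_on UNIV ?F" using FN by (auto simp: ker_on_def)
    then have kN: "cfin_dim (ker_on N (shift A \<mu>))" using k cfin_dim_subset by blast
    \<comment> \<open>Exhibiting the image as an intersection of closed sets gives its closedness
      without an open mapping argument on \<open>N\<close>.\<close>
    have "shift A \<mu> ` N = range ?F \<inter> N"
    proof
      show "shift A \<mu> ` N \<subseteq> range ?F \<inter> N"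
      proof
        fix y assume "y \<in> shift A \<mu> ` N"
        then obtain x where x: "x \<in> N" "y = shift A \<mu> x" by blast
        have "- x \<in> N" using x(1) sN by (intro cvs.subspace_neg)
        then have "?F (- x) = y" using FN x bounded_op_simps(2)[OF bounded_op_shift[OF A]] by simp
        moreover have "y \<in> N" using x AN by (auto intro!: shift_in_subspace[OF sN])
        ultimately show "y \<in> range ?F \<inter> N" by blast
      qed
      show "range ?F \<inter> N \<subseteq> shift A \<mu> ` N"
      proof
        fix y assume "y \<in> range ?F \<inter> N"
        then obtain x where x: "y = ?F x" "y \<in> N" by blast
        have "?F (E x) = 0" using x EF NE by simp
        then have "y = ?F (x - E x)" using x by (simp add: bounded_op_simps[OF bF])
        then show "y \<in> shift A \<mu> ` N" using F1 by simp
      qed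
    qed
    then have cl: "closed (shift A \<mu> ` N)" using closed_range_of_fin_codim[OF bF c] clN by (metis closed_Int)
    obtain D where D: "finite D" "\<And>x. \<exists>r\<in>range ?F. \<exists>f\<in>cvs.span D. x = r + f"
      using c by (auto simp: fin_codim_UNIV_iff)
    have bQ: "bounded_op (\<lambda>x. x - E x)" by (intro bounded_op_diff bounded_op_id bE)
    have "y \<in> {r + f |r f. r \<in> shift A \<mu> ` N \<and> f \<in> cvs.span ((\<lambda>x. x - E x) ` D)}" if y: "y \<in> N" for y
    proof -
      obtain x f where x: "y = ?F x + f" "f \<in> cvs.span D" using D(2) by blast
      have "y = y - E y" using y by (simp add: NE)
      also have "\<dots> = ?F (x - E x) + (f - E f)"
        by (simp add: x bounded_opD[OF bE] EF bounded_op_simps(3)[OF bF])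
      finally have "y = ?F (x - E x) + (f - E f)" .
      moreover have "f - E f \<in> cvs.span ((\<lambda>x. x - E x) ` D)"
        using x(2) module_hom.span_image[OF bounded_op_linear[OF bQ], of D] by auto
      ultimately show ?thesis using F1 by blast
    qed
    then have "fin_codim N (shift A \<mu> ` N)"
      unfolding fin_codim_def cspan_eq using D(1) xE
      by (intro exI[of _ "(\<lambda>x. x - E x) ` D"]) auto
    then show "fredholm_on N (shift A \<mu>)"
      using kN cl by (simp add: fredholm_on_def upper_fredholm_on_def lower_fredholm_on_def)
  qed
  then show ?thesis
    unfolding gKR_decomposable_def csubspace_eq invariant_def
    using sM sN clM clN AM AN ds kato by blast
qed

theorem theorem3p18:
  fixes T :: "'a::complex_banach \<Rightarrow> 'a"
  assumes "\<not> cfin_dim (UNIV :: 'a set)"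
    and "bounded_op T"
  shows "(sigma_gKR T = {} \<longleftrightarrow> sigma_gDR T = {})
       \<and> (sigma_gDR T = {} \<longleftrightarrow> polynomially_riesz T)
       \<and> (polynomially_riesz T \<longleftrightarrow> finite (spec Browder T))
       \<and> (\<forall>\<theta> \<in> {sigma_eK, spec Phi_plus, spec Phi_minus, spec Phi, spec W_plus,
                  spec W_minus, spec Weyl, spec B_plus, spec B_minus}.
            polynomially_riesz T \<longleftrightarrow> finite (\<theta> T))"
proof -
  note T = assms(2)
  note bT = bounded_op_shift[OF T]
  have gKR: "sigma_gKR T = {}" if "sigma_gDR T = {}"
    using that gKR_decomposable_of_gDR_invertible[OF bT] by (auto simp: sigma_gKR_def sigma_gDR_def spec_def)
  \<comment> \<open>The three conditions form a cycle: gDR implies gKR, gKR implies a finite Browder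
    spectrum, and that implies gDR.\<close>
  have i: "sigma_gKR T = {} \<longleftrightarrow> finite (spec Browder T)" and ii: "sigma_gDR T = {} \<longleftrightarrow> finite (spec Browder T)"
    using gKR gDR_empty_of_finite_spec_Browder[OF T] finite_spec_Browder_of_gKR[OF T] by blast+
  have iii: "polynomially_riesz T \<longleftrightarrow> finite (spec Browder T)"
    using finite_spec_Browder_of_polynomially_riesz[OF T] polynomially_riesz_of_finite_spec_Browder[OF T] by blast
  \<comment> \<open>Every class in (v) lies between \<open>Browder\<close> and
    \<open>semi_fredholm_like\<close>, so its spectrum is squeezed between two sets that are finite
    simultaneously. For the three Weyl classes the lower inclusion is the vanishing of the
    index.\<close>
  have v: "finite (spec Browder T) \<longleftrightarrow> finite (spec R T)"
    if R: "\<And>S. bounded_op S \<Longrightarrow> Browder S \<Longrightarrow> R S" "\<And>S. R S \<Longrightarrow> semi_fredholm_like S" for R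
  proof
    have "spec R T \<subseteq> spec Browder T" using R(1)[OF bT] by (auto simp: spec_def)
    then show "finite (spec R T)" if "finite (spec Browder T)" using that finite_subset by blast
    have "{\<kappa>. \<not> semi_fredholm_like (shift T \<kappa>)} \<subseteq> spec R T" using R(2) by (auto simp: spec_def)
    then show "finite (spec Browder T)" if "finite (spec R T)"
      using that finite_subset finite_spec_Browder_of_semi_fredholm_like[OF T] by blast
  qed
  have "finite (spec Browder T) \<longleftrightarrow> finite (sigma_eK T)"
    unfolding sigma_eK_def by (rule v) (auto simp: semi_fredholm_like_def intro: Browder_imp_essentially_kato)
  moreover have "finite (spec Browder T) \<longleftrightarrow> finite (spec Phi_plus T)"
    by (rule v) (simp_all add: semi_fredholm_like_def Browder_def Phi_def)
  moreover have "finite (spec Browder T) \<longleftrightarrow> finite (spec Phi_minus T)"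
    by (rule v) (simp_all add: semi_fredholm_like_def Browder_def Phi_def)
  moreover have "finite (spec Browder T) \<longleftrightarrow> finite (spec Phi T)"
    by (rule v) (simp_all add: semi_fredholm_like_def Browder_def Phi_def)
  moreover have "finite (spec Browder T) \<longleftrightarrow> finite (spec W_plus T)"
    by (rule v) (simp_all add: semi_fredholm_like_def W_plus_def Browder_op_index, simp add: Browder_def Phi_def)
  moreover have "finite (spec Browder T) \<longleftrightarrow> finite (spec W_minus T)"
    by (rule v) (simp_all add: semi_fredholm_like_def W_minus_def Browder_op_index, simp add: Browder_def Phi_def)
  moreover have "finite (spec Browder T) \<longleftrightarrow> finite (spec Weyl T)"
    by (rule v) (simp_all add: semi_fredholm_like_def Weyl_def Browder_op_index, simp_all add: Browder_def Phi_def)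
  moreover have "finite (spec Browder T) \<longleftrightarrow> finite (spec B_plus T)"
    by (rule v) (simp_all add: semi_fredholm_like_def Browder_def Phi_def B_plus_def)
  moreover have "finite (spec Browder T) \<longleftrightarrow> finite (spec B_minus T)"
    by (rule v) (simp_all add: semi_fredholm_like_def Browder_def Phi_def B_minus_def)
  ultimately show ?thesis using i ii iii by simp
qed

end
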